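(* Let $\lambda>1$, $g=\frac{(\lambda-1)^2}{\lambda^2+1}$, and let $\mathbf{M}=\mathbf{W}+\lambda\mathbf{U}\mathbf{U}^\top$, where $\mathbf{W}\sim\mathrm{GOE}(d)$ and $\mathbf{U}$ uniform on $\mathrm{Stief}(d,r)$ are independent. Then for every query algorithm (as in the context), every $d\ge g^{-1/2}$, $\delta\in(0,1)$ and $r'\in\{1,\dots,r\}$, $$\mathbb{E}_{\mathbf{U}}\,\mathsf{P}_{\mathbf{U}}\left[\forall k\in\{1,\dots,d\}:\ \lambda_{r'}(\mathbf{U}^\top\mathsf{V}_k\mathsf{V}_k^\top\mathbf{U})\ \le\ \frac{26\,r\,\lambda^{9k/r'}\log(20d^2)\log(e\delta^{-1})}{d\,g^2}\right]\ge1-\delta .$$ (Here $k$ ranges over those $k\le d$ that are rounds of the algorithm.)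
   Context: $\mathrm{GOE}(d)$: random symmetric $\mathbf{W}$ with independent entries $\{\mathbf{W}_{ij}\}_{i\le j}$, $\mathbf{W}_{ij}\sim\mathcal{N}(0,1/d)$ for $i<j$, $\mathbf{W}_{ii}\sim\mathcal{N}(0,2/d)$. $\mathrm{Stief}(d,r)=\{V\in\mathbb{R}^{d\times r}:V^\top V=I_r\}$ with its rotation-invariant probability measure. $\lambda_{1}(A)\ge\lambda_2(A)\ge\cdots$ are the eigenvalues of a symmetric matrix $A$ (the scalar $\lambda$ without index is the spike strength). Query algorithm: in rounds $k=1,2,\dots,N$ ($N\le d$) it plays unit vectors $\mathsf{v}^{(k)}$ orthogonal to $\mathsf{v}^{(1)},\dots,\mathsf{v}^{(k-1)}$ and observes $\mathsf{w}^{(k)}=(I-\mathsf{V}_{k-1}\mathsf{V}_{k-1}^\top)\mathbf{M}\mathsf{v}^{(k)}$, where $\mathsf{V}_k=[\mathsf{v}^{(1)}|\cdots|\mathsf{v}^{(k)}]\in\mathbb{R}^{d\times k}$ has orthonormal columns ($\mathsf V_0$ empty). The query $\mathsf{v}^{(k+1)}$ is a deterministic measurable function of the history $(\mathsf{v}^{(j)},\mathsf{w}^{(j)})_{1\le j\le k}$. $\mathsf{P}_U$ denotes the law of the history conditional on $\mathbf{U}=U$. *)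

theory Defs
  imports "HOL-Probability.Probability" "HOL-Computational_Algebra.Polynomial"
begin

section \<open>Ordered eigenvalues\<close>

definition char_poly_mat :: "real^'n^'n \<Rightarrow> real poly" where
  "char_poly_mat A = det (mat [:0, 1:] - (\<chi> i j. [:A $ i $ j:]))"

text \<open>The \<open>i\<close>-th largest (real) eigenvalue, \<open>i = 1, 2, \<dots>\<close>, counted with multiplicity.  It is
  meaningful for symmetric \<open>A\<close>, where the characteristic polynomial splits over the reals,
  and \<open>i \<in> {1..CARD('n)}\<close>.\<close>

definition nth_eigenvalue :: "nat \<Rightarrow> real^'n^'n \<Rightarrow> real" where
  "nth_eigenvalue i A = rev (sorted_list_of_multiset (proots (char_poly_mat A))) ! (i - 1)"


section \<open>The random matrices\<close>

definition is_GOE :: "'w measure \<Rightarrow> ('w \<Rightarrow> real^('d::{finite,linorder})^('d::_)) \<Rightarrow> bool" where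
  "is_GOE \<Omega> W \<longleftrightarrow>
     W \<in> borel_measurable \<Omega> \<and>
     (AE \<omega> in \<Omega>. transpose (W \<omega>) = W \<omega>) \<and>
     prob_space.indep_vars \<Omega> (\<lambda>_. borel) (\<lambda>(i, j) \<omega>. W \<omega> $ i $ j) {(i, j). i \<le> j} \<and>
     (\<forall>i j. i < j \<longrightarrow>
        distributed \<Omega> lborel (\<lambda>\<omega>. W \<omega> $ i $ j) (normal_density 0 (sqrt (1 / real CARD('d))))) \<and>
     (\<forall>i. distributed \<Omega> lborel (\<lambda>\<omega>. W \<omega> $ i $ i) (normal_density 0 (sqrt (2 / real CARD('d)))))"

definition Stiefel :: "(real^'r^'d) set" where
  "Stiefel = {V. transpose V ** V = mat 1}"

text \<open>Invariance is under the full orthogonal group, which acts transitively on the Stiefel manifold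
  also when \<open>r = d\<close> (there \<open>SO(d)\<close> does not); hence at most one measure satisfies this
  predicate, and one exists exactly if \<open>r \<le> d\<close>.\<close>

definition uniform_Stiefel :: "(real^'r^'d) measure \<Rightarrow> bool" where
  "uniform_Stiefel \<mu> \<longleftrightarrow>
     prob_space \<mu> \<and> sets \<mu> = sets borel \<and> (AE V in \<mu>. V \<in> Stiefel) \<and>
     (\<forall>Q. orthogonal_matrix Q \<longrightarrow> distr \<mu> borel (\<lambda>V. Q ** V) = \<mu>)"


section \<open>Query algorithms\<close>

text \<open>A history of \<open>k\<close> rounds is a function on \<open>{1..k}\<close> (extensional, i.e. \<open>undefined\<close>
  elsewhere) whose value at \<open>j\<close> is the pair of the \<open>j\<close>-th query and the \<open>j\<close>-th observation.\<close>

type_synonym 'd history = "nat \<Rightarrow> (real^'d) \<times> (real^'d)"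

definition history_space :: "nat \<Rightarrow> ('d::finite) history measure" where
  "history_space k = PiM {1..k} (\<lambda>_. borel)"

definition query :: "'d history \<Rightarrow> nat \<Rightarrow> real^'d" where
  "query h j = fst (h j)"

text \<open>The matrix \<open>V\<^sub>k V\<^sub>k\<^sup>T\<close>, where \<open>V\<^sub>k\<close> has the first \<open>k\<close> queries as its columns.\<close>

definition VVT :: "'d history \<Rightarrow> nat \<Rightarrow> real^'d^'d" where
  "VVT h k = (\<chi> i j. \<Sum>l=1..k. query h l $ i * query h l $ j)"

text \<open>The interaction with the matrix \<open>M\<close>: \<open>alg k\<close> computes the query of round \<open>k + 1\<close> from the
  history of the first \<open>k\<close> rounds.\<close>

primrec run :: "(nat \<Rightarrow> 'd history \<Rightarrow> real^'d) \<Rightarrow> real^'d^'d \<Rightarrow> nat \<Rightarrow> 'd history" where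
  "run alg M 0 = (\<lambda>_. undefined)"
| "run alg M (Suc k) =
     (let h = run alg M k;
          v = alg k h;
          w = (mat 1 - VVT h k) *v (M *v v)
      in h(Suc k := (v, w)))"

definition query_algorithm :: "nat \<Rightarrow> (nat \<Rightarrow> ('d::finite) history \<Rightarrow> real^'d) \<Rightarrow> bool" where
  "query_algorithm N alg \<longleftrightarrow>
     N \<le> CARD('d) \<and>
     (\<forall>k<N. alg k \<in> borel_measurable (history_space k)) \<and>
     (\<forall>M. transpose M = M \<longrightarrow>
        (\<forall>k\<in>{1..N}. norm (query (run alg M N) k) = 1 \<and>
           (\<forall>j\<in>{1..<k}. query (run alg M N) j \<bullet> query (run alg M N) k = 0)))"


section \<open>Independence and conditional laws\<close>

text \<open>The library's \<open>indep_var\<close> needs both variables to have values in the same type.\<close>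

definition indep_rv ::
  "'w measure \<Rightarrow> 'a measure \<Rightarrow> ('w \<Rightarrow> 'a) \<Rightarrow> 'b measure \<Rightarrow> ('w \<Rightarrow> 'b) \<Rightarrow> bool" where
  "indep_rv \<Omega> MX X MY Y \<longleftrightarrow>
     X \<in> \<Omega> \<rightarrow>\<^sub>M MX \<and> Y \<in> \<Omega> \<rightarrow>\<^sub>M MY \<and>
     prob_space.indep_set \<Omega>
       {X -` A \<inter> space \<Omega> | A. A \<in> sets MX} {Y -` B \<inter> space \<Omega> | B. B \<in> sets MY}"

text \<open>\<open>P\<close> is a (version of the) regular conditional distribution of \<open>Y\<close> given \<open>X\<close>.\<close>

definition conditional_law ::
  "'w measure \<Rightarrow> 'a measure \<Rightarrow> ('w \<Rightarrow> 'a) \<Rightarrow> 'b measure \<Rightarrow> ('w \<Rightarrow> 'b) \<Rightarrow> ('a \<Rightarrow> 'b measure) \<Rightarrow> bool" where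
  "conditional_law \<Omega> MX X MY Y P \<longleftrightarrow>
     P \<in> MX \<rightarrow>\<^sub>M prob_algebra MY \<and>
     (\<forall>A\<in>sets MX. \<forall>B\<in>sets MY.
        measure \<Omega> {\<omega> \<in> space \<Omega>. X \<omega> \<in> A \<and> Y \<omega> \<in> B} =
        (\<integral>\<omega>. indicator A (X \<omega>) * measure (P (X \<omega>)) B \<partial>\<Omega>))"

end

theory Submission
  imports Defs
begin

text \<open>
  Fix a unit vector \<open>b\<close> and let \<open>\<Phi>\<^sub>k\<close> be the squared norm of the projection of \<open>u = U b\<close> onto the first
  \<open>k\<close> queries. Removing the spike in direction \<open>u\<close> changes the law of the first \<open>k\<close> rounds by a
  likelihood ratio whose moments are controlled by \<open>exp (const * d * \<Phi>\<^sub>k)\<close>, and without this spike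
  \<open>u\<close> is uniform on a sphere and independent of the next query. Hence
  \<open>exp (a \<Phi>\<^sub>k\<^sub>+\<^sub>1 - s \<Phi>\<^sub>k)\<close> has bounded expectation, so that \<open>\<Phi>\<^sub>k\<^sub>+\<^sub>1 \<le> lam ^ 5 * \<Phi>\<^sub>k + c / d\<close> with high
  probability, simultaneously for all \<open>k\<close> and all \<open>b\<close> in a fine grid. With
  \<open>A\<^sub>k = U\<^sup>T V\<^sub>k V\<^sub>k\<^sup>T U + \<kappa>\<close> this says \<open>A\<^sub>k\<^sub>+\<^sub>1 \<le> lam ^ 5 * A\<^sub>k\<close> as quadratic forms. A query is a rank one
  update, so only one relative eigenvalue moves and \<open>det A\<^sub>k\<close>, too, grows by at most \<open>lam ^ 5\<close> per
  round. As all eigenvalues of \<open>A\<^sub>k\<close> are at least \<open>\<kappa>\<close>, raising the \<open>r'\<close>-th largest one takes \<open>r'\<close>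
  times as many rounds.
\<close>

section \<open>Standard Gaussian vectors and the GOE\<close>

text \<open>The obstacle is adaptivity: queries depend on the noise, so the remaining randomness has
  to be described given a history. The noise is therefore realized as \<open>sym_part G\<close> with
  \<open>G\<close> a full matrix of independent standard normals. What a history leaves unseen is
  then an orthogonal projection of \<open>G\<close>, and resampling it preserves the law although
  the projection depends on \<open>G\<close>. The other \<open>r - 1\<close> spike directions are
  kept and act as a fixed matrix; given them, \<open>u\<close> is uniform on the unit sphere of a
  space of dimension \<open>m = d + 1 - r\<close>. Young's inequality with exponent
  \<open>lam\<close> leads to \<open>s / a = lam ^ 4 * d / m\<close>. One may assume
  \<open>d \<le> lam * m\<close>, since otherwise the claimed bound is at least 1 and eigenvalues of
  a compressed projection never exceed 1; this gives \<open>lam ^ 5\<close>. The additive error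
  grows linearly with the number of rounds; absorbing it costs another
  \<open>lam powr (4 k / r')\<close>, hence the exponent 9. The grid lives in dimension
  \<open>r\<close>, not \<open>d\<close>, so the union bound costs only
  \<open>r * ln (3 d\<^sup>2)\<close>.\<close>

definition std_gauss :: "'a::euclidean_space measure" where
  "std_gauss = density lborel (\<lambda>x. ennreal (exp (- (x \<bullet> x) / 2) / sqrt (2 * pi) ^ DIM('a)))"

lemma borel_measurable_linear:
  fixes f :: "'a::euclidean_space \<Rightarrow> 'b::euclidean_space"
  assumes "linear f"
  shows "f \<in> borel_measurable borel"
  using assms by (intro borel_measurable_continuous_onI linear_continuous_on linear_conv_bounded_linear[THEN iffD1])

lemma sets_std_gauss [simp, measurable_cong]: "sets std_gauss = sets borel"
  by (simp add: std_gauss_def)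

lemma space_std_gauss [simp]: "space std_gauss = UNIV"
  by (simp add: std_gauss_def)

text \<open>The density factors into \<open>std_normal_density\<close> over the coordinates, so
  Tonelli's theorem applies factor by factor.\<close>

lemma nn_integral_std_gauss_prod:
  fixes f :: "'a::euclidean_space \<Rightarrow> real \<Rightarrow> ennreal"
  assumes [measurable]: "\<And>b. b \<in> Basis \<Longrightarrow> f b \<in> borel_measurable borel"
  shows "(\<integral>\<^sup>+x. (\<Prod>b\<in>Basis. f b (x \<bullet> b)) \<partial>std_gauss)
    = (\<Prod>b\<in>Basis. \<integral>\<^sup>+y. f b y \<partial>density lborel std_normal_density)"
proof -
  have *: "ennreal (exp (- (x \<bullet> x) / 2) / sqrt (2 * pi) ^ DIM('a))
    = (\<Prod>b\<in>Basis. ennreal (std_normal_density (x \<bullet> b)))" for x :: 'a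
  proof -
    have "- (x \<bullet> x) / 2 = (\<Sum>b\<in>Basis. - (x \<bullet> b)\<^sup>2 / 2)"
      by (subst euclidean_inner) (simp add: power2_eq_square sum_negf sum_divide_distrib)
    then show ?thesis
      by (simp add: std_normal_density_def prod_ennreal prod_dividef exp_sum prod_constant
          power_one_over divide_simps)
  qed
  have "(\<integral>\<^sup>+x. (\<Prod>b\<in>Basis. f b (x \<bullet> b)) \<partial>std_gauss)
    = (\<integral>\<^sup>+x. (\<Prod>b\<in>Basis. (\<lambda>b y. ennreal (std_normal_density y) * f b y) b (x \<bullet> b)) \<partial>lborel)"
    unfolding std_gauss_def
    by (subst nn_integral_density) (simp_all only: * prod.distrib, measurable)
  also have "\<dots> = (\<Prod>b\<in>Basis. \<integral>\<^sup>+y. ennreal (std_normal_density y) * f b y \<partial>lborel)"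
    by (subst nn_integral_lborel_prod) auto
  also have "\<dots> = (\<Prod>b\<in>Basis. \<integral>\<^sup>+y. f b y \<partial>density lborel std_normal_density)"
    by (intro prod.cong refl, subst nn_integral_density) auto
  finally show ?thesis .
qed

lemma prob_space_std_gauss: "prob_space (std_gauss :: 'a::euclidean_space measure)"
proof
  interpret N: prob_space "density lborel std_normal_density"
    by (rule prob_space_normal_density) simp
  show "emeasure (std_gauss :: 'a measure) (space std_gauss) = 1"
    using nn_integral_std_gauss_prod[where 'a='a and f = "\<lambda>_ _. 1"] N.emeasure_space_1 by simp
qed

lemma nn_integral_lborel_translate:
  fixes a :: "'a::euclidean_space"
  assumes [measurable]: "f \<in> borel_measurable borel"
  shows "(\<integral>\<^sup>+x. f (a + x) \<partial>lborel) = (\<integral>\<^sup>+x. f x \<partial>lborel)"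
proof -
  have "(\<integral>\<^sup>+x. f x \<partial>lborel) = (\<integral>\<^sup>+x. f x \<partial>(distr lborel borel ((+) a)))"
    by (simp add: lborel_distr_plus)
  then show ?thesis by (simp add: nn_integral_distr)
qed

text \<open>Both measures are translation invariant, hence proportional; the unit ball fixes the factor.\<close>

lemma lborel_orthogonal_transformation:
  fixes f :: "'a::euclidean_space \<Rightarrow> 'a"
  assumes f: "orthogonal_transformation f"
  shows "distr lborel borel f = lborel"
proof (rule measure_eqI)
  have lin: "linear f" using f by (rule orthogonal_transformation_linear)
  have [measurable]: "f \<in> borel_measurable borel"
    using lin by (rule borel_measurable_linear)
  obtain f' where f': "orthogonal_transformation f'" "\<And>x. f (f' x) = x" "\<And>x. f' (f x) = x"
    using orthogonal_transformation_inv[OF f] orthogonal_transformation_bij[OF f]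
    by (metis bij_inv_eq_iff)
  fix A assume "A \<in> sets (distr lborel borel f)"
  then have [measurable]: "A \<in> sets borel" by simp
  define B where "B = (ball 0 1 :: 'a set)"
  have [measurable]: "B \<in> sets borel" by (simp add: B_def)
  have Bsym: "indicator B (- x) = (indicator B x :: ennreal)" for x by (auto simp: B_def indicator_def)
  have Bf: "indicator B (f x) = (indicator B x :: ennreal)" for x
    using orthogonal_transformation_norm[OF f] by (auto simp: B_def indicator_def)
  have eq: "emeasure lborel B * emeasure (distr lborel borel f) A = emeasure lborel B * emeasure lborel A"
  proof -
    have "emeasure lborel B * emeasure (distr lborel borel f) A
      = (\<integral>\<^sup>+x. (\<integral>\<^sup>+y. indicator A (f x) * indicator B y \<partial>lborel) \<partial>lborel)"
    proof -
      have "emeasure (distr lborel borel f) A = (\<integral>\<^sup>+x. indicator A x \<partial>distr lborel borel f)"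
        by simp
      also have "\<dots> = (\<integral>\<^sup>+x. indicator A (f x) \<partial>lborel)"
        by (subst nn_integral_distr) auto
      finally show ?thesis
        by (simp add: nn_integral_cmult nn_integral_multc mult.commute)
    qed
    also have "\<dots> = (\<integral>\<^sup>+x. (\<integral>\<^sup>+y. indicator A (f x) * indicator B (- f x + y) \<partial>lborel) \<partial>lborel)"
      by (intro nn_integral_cong nn_integral_lborel_translate[symmetric]) measurable
    also have "\<dots> = (\<integral>\<^sup>+y. (\<integral>\<^sup>+x. indicator A (f x) * indicator B (- f x + y) \<partial>lborel) \<partial>lborel)"
      by (intro lborel_pair.Fubini') (measurable)
    also have "\<dots> = (\<integral>\<^sup>+y. (\<integral>\<^sup>+x. indicator A (f (f' y + x)) * indicator B (- f (f' y + x) + y) \<partial>lborel) \<partial>lborel)"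
      by (intro nn_integral_cong nn_integral_lborel_translate[symmetric]) measurable
    also have "\<dots> = (\<integral>\<^sup>+y. (\<integral>\<^sup>+x. indicator A (y + f x) * indicator B x \<partial>lborel) \<partial>lborel)"
      using lin by (simp add: linear_add f' Bsym Bf)
    also have "\<dots> = (\<integral>\<^sup>+x. (\<integral>\<^sup>+y. indicator A (f x + y) * indicator B x \<partial>lborel) \<partial>lborel)"
      by (subst lborel_pair.Fubini') (auto simp: add.commute)
    also have "\<dots> = (\<integral>\<^sup>+x. emeasure lborel A * indicator B x \<partial>lborel)"
      by (intro nn_integral_cong, subst nn_integral_multc)
         (auto simp: nn_integral_lborel_translate)
    also have "\<dots> = emeasure lborel B * emeasure lborel A"
      by (subst nn_integral_cmult) (auto simp: mult.commute)
    finally show ?thesis .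
  qed
  have "emeasure lborel B \<noteq> 0"
    unfolding B_def using content_ball_pos[of 1 "0::'a"] by (auto simp: measure_def)
  moreover have "emeasure lborel B \<noteq> \<infinity>"
    unfolding B_def by (metis emeasure_lborel_ball_finite infinity_ennreal_def less_irrefl)
  ultimately show "emeasure (distr lborel borel f) A = emeasure lborel A"
    using eq by (simp add: ennreal_mult_cancel_left)
qed simp

text \<open>The density depends on \<open>x \<bullet> x\<close> only, and Lebesgue measure is
  invariant.\<close>

lemma std_gauss_orthogonal_transformation:
  fixes f :: "'a::euclidean_space \<Rightarrow> 'a"
  assumes f: "orthogonal_transformation f"
  shows "distr std_gauss borel f = std_gauss"
proof (rule measure_eqI)
  have lin: "linear f" using f by (rule orthogonal_transformation_linear)
  have [measurable]: "f \<in> borel_measurable borel"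
    using lin by (rule borel_measurable_linear)
  fix A :: "'a set" assume "A \<in> sets (distr std_gauss borel f)"
  then have [measurable]: "A \<in> sets borel" by simp
  have ff: "f x \<bullet> f x = x \<bullet> x" for x using f by (simp add: orthogonal_transformation_def)
  have "emeasure std_gauss A = (\<integral>\<^sup>+x. ennreal (exp (- (x \<bullet> x) / 2) / sqrt (2 * pi) ^ DIM('a)) * indicator A x \<partial>distr lborel borel f)"
    unfolding lborel_orthogonal_transformation[OF f] std_gauss_def by (rule emeasure_density) auto
  also have "\<dots> = (\<integral>\<^sup>+x. ennreal (exp (- (x \<bullet> x) / 2) / sqrt (2 * pi) ^ DIM('a)) * indicator (f -` A) x \<partial>lborel)"
    by (subst nn_integral_distr) (auto simp: ff indicator_vimage[symmetric] indicator_def)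
  also have "\<dots> = emeasure std_gauss (f -` A)"
    unfolding std_gauss_def by (subst emeasure_density) (auto intro: measurable_sets_borel[OF \<open>f \<in> borel_measurable borel\<close>])
  also have "\<dots> = emeasure (distr std_gauss borel f) A"
    by (simp add: emeasure_distr)
  finally show "emeasure (distr std_gauss borel f) A = emeasure std_gauss A" ..
qed simp

text \<open>Lets a Gaussian vector and an independent copy be rotated together, as one Gaussian
  vector of the product space.\<close>

lemma pair_std_gauss:
  "(std_gauss :: 'a::euclidean_space measure) \<Otimes>\<^sub>M (std_gauss :: 'b::euclidean_space measure) = std_gauss"
proof -
  have "sigma_finite_measure (std_gauss :: 'b measure)"
    using prob_space_std_gauss prob_space_imp_sigma_finite by blast
  then have "(std_gauss :: 'a measure) \<Otimes>\<^sub>M (std_gauss :: 'b measure)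
    = density (lborel \<Otimes>\<^sub>M lborel) (\<lambda>(x, y). ennreal (exp (- (x \<bullet> x) / 2) / sqrt (2 * pi) ^ DIM('a)) *
        ennreal (exp (- (y \<bullet> y) / 2) / sqrt (2 * pi) ^ DIM('b)))"
    unfolding std_gauss_def by (intro pair_measure_density) (auto simp: sigma_finite_lborel)
  also have "\<dots> = std_gauss"
    unfolding std_gauss_def lborel_prod
    by (intro arg_cong[where f="density lborel"] ext)
       (auto simp: inner_prod_def power_add exp_add[symmetric] field_simps simp flip: ennreal_mult')
  finally show ?thesis .
qed

text \<open>Cameron-Martin formula: expanding \<open>(x - b) \<bullet> (x - b)\<close> in the
  translated density produces the exponential weight.\<close>

lemma std_gauss_translate:
  fixes b :: "'a::euclidean_space"
  assumes [measurable]: "f \<in> borel_measurable borel"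
  shows "(\<integral>\<^sup>+x. f (x + b) \<partial>std_gauss) = (\<integral>\<^sup>+x. f x * ennreal (exp (x \<bullet> b - (b \<bullet> b) / 2)) \<partial>std_gauss)"
proof -
  let ?d = "\<lambda>x::'a. exp (- (x \<bullet> x) / 2) / sqrt (2 * pi) ^ DIM('a)"
  have "(\<integral>\<^sup>+x. f (x + b) \<partial>std_gauss) = (\<integral>\<^sup>+x. ennreal (?d x) * f (x + b) \<partial>lborel)"
    unfolding std_gauss_def by (subst nn_integral_density) auto
  also have "\<dots> = (\<integral>\<^sup>+x. ennreal (?d ((b + x) - b)) * f (b + x) \<partial>lborel)"
    by (simp add: add.commute)
  also have "\<dots> = (\<integral>\<^sup>+x. ennreal (?d (x - b)) * f x \<partial>lborel)"
    by (subst nn_integral_lborel_translate[where f="\<lambda>x. ennreal (?d (x - b)) * f x"]) auto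
  also have "\<dots> = (\<integral>\<^sup>+x. ennreal (?d x) * (f x * ennreal (exp (x \<bullet> b - (b \<bullet> b) / 2))) \<partial>lborel)"
  proof (intro nn_integral_cong)
    fix x :: 'a
    have "?d (x - b) = ?d x * exp (x \<bullet> b - (b \<bullet> b) / 2)"
      by (simp add: inner_diff inner_commute exp_add[symmetric] field_simps)
    then show "ennreal (?d (x - b)) * f x = ennreal (?d x) * (f x * ennreal (exp (x \<bullet> b - (b \<bullet> b) / 2)))"
      by (simp only: ennreal_mult' exp_ge_zero mult_ac)
  qed
  also have "\<dots> = (\<integral>\<^sup>+x. f x * ennreal (exp (x \<bullet> b - (b \<bullet> b) / 2)) \<partial>std_gauss)"
    unfolding std_gauss_def by (subst nn_integral_density) auto
  finally show ?thesis .
qed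

text \<open>The weight in \<open>std_gauss_translate\<close> has total mass one; this is solved for
  the exponential moment.\<close>

lemma nn_integral_std_gauss_exp:
  fixes b :: "'a::euclidean_space"
  shows "(\<integral>\<^sup>+x. ennreal (exp (x \<bullet> b)) \<partial>std_gauss) = ennreal (exp ((b \<bullet> b) / 2))"
proof -
  interpret prob_space "std_gauss :: 'a measure" by (rule prob_space_std_gauss)
  have "1 = (\<integral>\<^sup>+x. 1 * ennreal (exp (x \<bullet> b - (b \<bullet> b) / 2)) \<partial>std_gauss)"
    using std_gauss_translate[of "\<lambda>_. 1" b] emeasure_space_1 by simp
  also have "\<dots> = (\<integral>\<^sup>+x. ennreal (exp (- (b \<bullet> b) / 2)) * ennreal (exp (x \<bullet> b)) \<partial>std_gauss)"
    by (intro nn_integral_cong) (simp add: exp_add[symmetric] field_simps flip: ennreal_mult')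
  also have "\<dots> = ennreal (exp (- (b \<bullet> b) / 2)) * (\<integral>\<^sup>+x. ennreal (exp (x \<bullet> b)) \<partial>std_gauss)"
    by (subst nn_integral_cmult) auto
  finally have "ennreal (exp ((b \<bullet> b) / 2)) * 1 = ennreal (exp ((b \<bullet> b) / 2)) * (ennreal (exp (- (b \<bullet> b) / 2)) * (\<integral>\<^sup>+x. ennreal (exp (x \<bullet> b)) \<partial>std_gauss))"
    by simp
  then show ?thesis
    by (simp add: mult.assoc[symmetric] flip: ennreal_mult' exp_add)
qed

text \<open>Induction step: the reflection in the hyperplane orthogonal to \<open>f (e i) - e' i\<close> moves
  \<open>f (e i)\<close> to \<open>e' i\<close> and fixes the earlier \<open>e' j\<close>.\<close>

lemma orthonormal_families_transformation:
  fixes e e' :: "'i \<Rightarrow> 'a::euclidean_space"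
  assumes "finite I"
    and "\<And>i j. i \<in> I \<Longrightarrow> j \<in> I \<Longrightarrow> e i \<bullet> e j = (if i = j then 1 else 0)"
    and "\<And>i j. i \<in> I \<Longrightarrow> j \<in> I \<Longrightarrow> e' i \<bullet> e' j = (if i = j then 1 else 0)"
  shows "\<exists>f. orthogonal_transformation f \<and> (\<forall>i\<in>I. f (e i) = e' i)"
  using assms
proof (induction I)
  case empty
  show ?case by (intro exI[of _ "\<lambda>x. x"]) simp
next
  case (insert i I)
  then have "\<exists>f. orthogonal_transformation f \<and> (\<forall>i\<in>I. f (e i) = e' i)"
    by simp
  then obtain f where f: "orthogonal_transformation f" "\<And>j. j \<in> I \<Longrightarrow> f (e j) = e' j"
    by auto
  define w where "w = f (e i) - e' i"
  define h where "h x = x - (2 * (x \<bullet> w) / (w \<bullet> w)) *\<^sub>R w" for x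
  have lin: "linear h"
    unfolding h_def by (auto intro!: linearI simp: algebra_simps add_divide_distrib)
  have ortho: "orthogonal_transformation h"
    unfolding orthogonal_transformation_def
  proof (intro conjI lin allI)
    fix x y show "h x \<bullet> h y = x \<bullet> y"
      by (cases "w = 0") (auto simp: h_def inner_diff inner_commute divide_simps)
  qed
  have fin: "f x \<bullet> f y = x \<bullet> y" for x y using f(1) by (simp add: orthogonal_transformation_def)
  have "w \<bullet> w = 2 * (f (e i) \<bullet> w)"
    using insert.prems(1)[of i i] insert.prems(2)[of i i]
    by (simp add: w_def inner_diff fin inner_commute)
  then have 1: "h (f (e i)) = e' i"
    by (cases "w = 0") (auto simp: h_def w_def)
  have 2: "h (e' j) = e' j" if "j \<in> I" for j
  proof -
    have "i \<noteq> j" using that insert.hyps by auto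
    then have "e' j \<bullet> w = 0"
      using insert.prems(1)[of i j] insert.prems(2)[of i j] that fin[of "e i" "e j"] f(2)[OF that]
      by (simp add: w_def inner_diff inner_commute)
    then show ?thesis by (simp add: h_def)
  qed
  show ?case
    using 1 2 f ortho orthogonal_transformation_compose[of h f]
    by (intro exI[of _ "h \<circ> f"]) (auto simp: o_def)
qed

text \<open>By rotation invariance the family may be moved onto distinct vectors of
  \<open>Basis\<close>, where the coordinatewise product formula applies.\<close>

lemma nn_integral_std_gauss_orthonormal:
  fixes e :: "'i \<Rightarrow> 'a::euclidean_space"
  assumes fin: "finite I"
    and e: "\<And>i j. i \<in> I \<Longrightarrow> j \<in> I \<Longrightarrow> e i \<bullet> e j = (if i = j then 1 else 0)"
    and F [measurable]: "\<And>i. i \<in> I \<Longrightarrow> F i \<in> borel_measurable borel"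
  shows "(\<integral>\<^sup>+x. (\<Prod>i\<in>I. F i (x \<bullet> e i)) \<partial>std_gauss) = (\<Prod>i\<in>I. \<integral>\<^sup>+y. F i y \<partial>density lborel std_normal_density)"
proof -
  interpret N: prob_space "density lborel std_normal_density"
    by (rule prob_space_normal_density) simp
  have inj: "inj_on e I"
    by (rule inj_onI) (metis e zero_neq_one)
  have "0 \<notin> e ` I"
    using e by force
  moreover have "pairwise orthogonal (e ` I)"
    using e by (auto simp: pairwise_def orthogonal_def)
  ultimately have "independent (e ` I)"
    using pairwise_orthogonal_independent by blast
  then have "card I \<le> DIM('a)"
    using independent_bound card_image[OF inj] by metis
  then obtain c where c: "c ` I \<subseteq> (Basis :: 'a set)" "inj_on c I"
    using card_le_inj[OF fin finite_Basis] by blast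
  have "\<exists>f. orthogonal_transformation f \<and> (\<forall>i\<in>I. f (e i) = c i)"
  proof (rule orthonormal_families_transformation[OF fin e])
    show "c i \<bullet> c j = (if i = j then 1 else 0)" if "i \<in> I" "j \<in> I" for i j
      using c that by (auto simp: inner_Basis inj_on_def image_subset_iff)
  qed
  then obtain f where f: "orthogonal_transformation f" "\<And>i. i \<in> I \<Longrightarrow> f (e i) = c i" by auto
  have [measurable]: "f \<in> borel_measurable borel"
    using orthogonal_transformation_linear[OF f(1)]
    by (rule borel_measurable_linear)
  \<comment> \<open>Basis vectors that are not hit by \<open>c\<close> get the factor 1, whose
    integral is 1.\<close>
  define F' where "F' b = (if b \<in> c ` I then F (inv_into I c b) else (\<lambda>_. 1))" for b
  have [measurable]: "F' b \<in> borel_measurable borel" for b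
    by (auto simp: F'_def intro!: F inv_into_into)
  have F'c: "F' (c i) = F i" if "i \<in> I" for i using that c by (simp add: F'_def)
  have split: "(\<Prod>b\<in>Basis. G b) = (\<Prod>i\<in>I. G (c i))" if "\<And>b. b \<notin> c ` I \<Longrightarrow> G b = 1" for G :: "'a \<Rightarrow> ennreal"
  proof -
    have "(\<Prod>b\<in>Basis. G b) = (\<Prod>b\<in>c ` I. G b)"
      using c that by (intro prod.mono_neutral_right) auto
    then show ?thesis by (simp add: prod.reindex[OF c(2)])
  qed
  have "(\<integral>\<^sup>+x. (\<Prod>i\<in>I. F i (x \<bullet> e i)) \<partial>std_gauss) = (\<integral>\<^sup>+x. (\<Prod>i\<in>I. F i (f x \<bullet> c i)) \<partial>std_gauss)"
    using f by (intro nn_integral_cong prod.cong refl) (metis orthogonal_transformation_def)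
  also have "\<dots> = (\<integral>\<^sup>+x. (\<Prod>i\<in>I. F i (x \<bullet> c i)) \<partial>distr std_gauss borel f)"
    by (subst nn_integral_distr) auto
  also have "\<dots> = (\<integral>\<^sup>+x. (\<Prod>b\<in>Basis. F' b (x \<bullet> b)) \<partial>std_gauss)"
    unfolding std_gauss_orthogonal_transformation[OF f(1)]
    by (subst split) (auto simp: F'_def[of "_ :: 'a"] c(2) intro!: nn_integral_cong prod.cong)
  also have "\<dots> = (\<Prod>b\<in>Basis. \<integral>\<^sup>+y. F' b y \<partial>density lborel std_normal_density)"
    by (rule nn_integral_std_gauss_prod) simp
  also have "\<dots> = (\<Prod>i\<in>I. \<integral>\<^sup>+y. F i y \<partial>density lborel std_normal_density)"
    using N.emeasure_space_1 by (subst split) (auto simp: F'_def c(2))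
  finally show ?thesis .
qed

text \<open>Product formula with indicators as factors: one index gives the marginal law, all
  indices together give independence.\<close>

lemma
  fixes e :: "'i \<Rightarrow> 'a::euclidean_space"
  assumes fin: "finite I" and ne: "I \<noteq> {}"
    and e: "\<And>i j. i \<in> I \<Longrightarrow> j \<in> I \<Longrightarrow> e i \<bullet> e j = (if i = j then 1 else 0)"
  shows distributed_std_gauss_orthonormal:
      "i \<in> I \<Longrightarrow> distributed std_gauss lborel (\<lambda>x. x \<bullet> e i) std_normal_density"
    and indep_vars_std_gauss_orthonormal:
      "prob_space.indep_vars std_gauss (\<lambda>_. borel) (\<lambda>i x. x \<bullet> e i) I"
proof -
  interpret prob_space "std_gauss :: 'a measure" by (rule prob_space_std_gauss)
  interpret N: prob_space "density lborel std_normal_density"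
    by (rule prob_space_normal_density) simp
  have distr: "distr std_gauss borel (\<lambda>x. x \<bullet> e i) = density lborel std_normal_density" if "i \<in> I" for i
  proof (rule measure_eqI)
    fix A assume "A \<in> sets (distr std_gauss borel (\<lambda>x. x \<bullet> e i))"
    then have [measurable]: "A \<in> sets borel" by simp
    have "emeasure (distr std_gauss borel (\<lambda>x. x \<bullet> e i)) A = (\<integral>\<^sup>+x. (\<Prod>j\<in>{i}. indicator A (x \<bullet> e j)) \<partial>std_gauss)"
    proof -
      have "emeasure (distr std_gauss borel (\<lambda>x. x \<bullet> e i)) A = (\<integral>\<^sup>+y. indicator A y \<partial>distr std_gauss borel (\<lambda>x. x \<bullet> e i))"
        by simp
      also have "\<dots> = (\<integral>\<^sup>+x. indicator A (x \<bullet> e i) \<partial>std_gauss)"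
        by (subst nn_integral_distr) auto
      finally show ?thesis by simp
    qed
    also have "\<dots> = emeasure (density lborel std_normal_density) A"
      using that e by (subst nn_integral_std_gauss_orthonormal) auto
    finally show "emeasure (distr std_gauss borel (\<lambda>x. x \<bullet> e i)) A = emeasure (density lborel std_normal_density) A" .
  qed simp
  then show "i \<in> I \<Longrightarrow> distributed std_gauss lborel (\<lambda>x. x \<bullet> e i) std_normal_density"
    by (simp add: distributed_def cong: distr_cong)
  show "indep_vars (\<lambda>_. borel) (\<lambda>i x. x \<bullet> e i) I"
  proof (subst indep_vars_iff_distr_eq_PiM'[OF ne])
    have "distr std_gauss (PiM I (\<lambda>_. borel)) (\<lambda>x. \<lambda>i\<in>I. x \<bullet> e i) = PiM I (\<lambda>i. density lborel std_normal_density)"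
    proof (rule product_sigma_finite.PiM_eqI)
      show "product_sigma_finite (\<lambda>_. density lborel std_normal_density)"
        by (simp add: product_sigma_finite_def N.sigma_finite_measure_axioms)
      fix A assume "\<And>i. i \<in> I \<Longrightarrow> A i \<in> sets (density lborel std_normal_density)"
      then have [measurable]: "\<And>i. i \<in> I \<Longrightarrow> A i \<in> sets borel" by simp
      have [measurable]: "Pi\<^sub>E I A \<in> sets (PiM I (\<lambda>_. borel))"
        using fin by (intro sets_PiM_I_finite) auto
      have "emeasure (distr std_gauss (PiM I (\<lambda>_. borel)) (\<lambda>x. \<lambda>i\<in>I. x \<bullet> e i)) (Pi\<^sub>E I A)
        = (\<integral>\<^sup>+x. (\<Prod>i\<in>I. indicator (A i) (x \<bullet> e i)) \<partial>std_gauss)"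
      proof -
        have "emeasure (distr std_gauss (PiM I (\<lambda>_. borel)) (\<lambda>x. \<lambda>i\<in>I. x \<bullet> e i)) (Pi\<^sub>E I A)
          = (\<integral>\<^sup>+x. indicator (Pi\<^sub>E I A) (\<lambda>i\<in>I. x \<bullet> e i) \<partial>std_gauss)"
          by (subst nn_integral_distr[where f="indicator (Pi\<^sub>E I A)" and M'="PiM I (\<lambda>_. borel)", symmetric])
            (auto intro!: measurable_restrict)
        also have "\<dots> = (\<integral>\<^sup>+x. (\<Prod>i\<in>I. indicator (A i) (x \<bullet> e i)) \<partial>std_gauss)"
        proof (intro nn_integral_cong)
          fix x
          show "indicator (Pi\<^sub>E I A) (\<lambda>i\<in>I. x \<bullet> e i) = (\<Prod>i\<in>I. indicator (A i) (x \<bullet> e i) :: ennreal)"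
          proof (cases "\<forall>i\<in>I. x \<bullet> e i \<in> A i")
            case False
            then have "(\<Prod>i\<in>I. indicator (A i) (x \<bullet> e i) :: ennreal) = 0"
              using fin by (auto simp: prod_zero_iff indicator_def)
            with False show ?thesis by (auto simp: indicator_def Pi_iff)
          qed (simp add: indicator_def Pi_iff)
        qed
        finally show ?thesis .
      qed
      also have "\<dots> = (\<Prod>i\<in>I. emeasure (density lborel std_normal_density) (A i))"
        using fin e by (subst nn_integral_std_gauss_orthonormal) auto
      finally show "emeasure (distr std_gauss (PiM I (\<lambda>_. borel)) (\<lambda>x. \<lambda>i\<in>I. x \<bullet> e i)) (Pi\<^sub>E I A) =
        (\<Prod>i\<in>I. emeasure (density lborel std_normal_density) (A i))" .
    qed (auto simp: fin intro!: sets_PiM_cong)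
    also have "\<dots> = PiM I (\<lambda>i. distr std_gauss borel (\<lambda>x. x \<bullet> e i))"
      by (intro PiM_cong refl) (simp add: distr)
    finally show "distr std_gauss (PiM I (\<lambda>_. borel)) (\<lambda>x. \<lambda>i\<in>I. x \<bullet> e i) = PiM I (\<lambda>i. distr std_gauss borel (\<lambda>x. x \<bullet> e i))" .
  qed simp
qed

text \<open>For independent standard normal entries, \<open>G + transpose G\<close> has variance 2
  off the diagonal and 4 on it; division by \<open>sqrt (2 d)\<close> turns this into
  \<open>1 / d\<close> and \<open>2 / d\<close>. The argument is an arbitrary square matrix so that
  all facts on \<open>std_gauss\<close> are available for it.\<close>

definition sym_part :: "real^'d^'d \<Rightarrow> real^'d^('d::finite)" where
  "sym_part G = (1 / sqrt (2 * real CARD('d))) *\<^sub>R (G + transpose G)"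

lemma measurable_vec_nthI [measurable]:
  fixes f :: "'a \<Rightarrow> 'b::euclidean_space^'n"
  shows "f \<in> borel_measurable M \<Longrightarrow> (\<lambda>x. f x $ i) \<in> borel_measurable M"
  by (rule measurable_compose[OF _ borel_measurable_continuous_onI]) (auto intro: continuous_intros)

lemma measurable_vec_lambdaI:
  fixes f :: "'a \<Rightarrow> 'n::finite \<Rightarrow> 'b::euclidean_space"
  assumes [measurable]: "\<And>i. (\<lambda>x. f x i) \<in> borel_measurable M"
  shows "(\<lambda>x. \<chi> i. f x i) \<in> borel_measurable M"
  by (subst borel_measurable_euclidean_space) (auto simp: Basis_vec_def inner_axis)

text \<open>Entry \<open>(i, j)\<close> with \<open>i \<le> j\<close> is
  \<open>\<sigma> (i, j)\<close> times the inner product of \<open>G\<close> with the matrix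
  \<open>e (i, j)\<close>; these matrices are orthonormal, which yields both the independence and
  the variances.\<close>

lemma is_GOE_sym_part: "is_GOE (std_gauss :: (real^('d::{finite,linorder})^('d::_)) measure) sym_part"
proof -
  let ?n = "real CARD('d)"
  interpret prob_space "std_gauss :: (((real, 'd) vec, 'd) vec) measure" by (rule prob_space_std_gauss)
  define E :: "'d \<times> 'd \<Rightarrow> ((real, 'd) vec, 'd) vec" where "E = (\<lambda>(i, j). axis i (axis j 1))"
  have E: "E p \<bullet> E q = (if p = q then 1 else 0)" for p q
    by (auto simp: E_def inner_axis_axis split: prod.splits)
  have EG: "G \<bullet> E (i, j) = G $ i $ j" for G i j
    by (simp add: E_def inner_axis)
  define e where "e = (\<lambda>(i, j). if i = j then E (i, j) else (1 / sqrt 2) *\<^sub>R (E (i, j) + E (j, i)))"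
  define \<sigma> where "\<sigma> = (\<lambda>(i::'d, j::'d). if i = j then sqrt (2 / ?n) else sqrt (1 / ?n))"
  have n: "?n > 0" by simp
  have entry: "sym_part G $ i $ j = \<sigma> (i, j) * (G \<bullet> e (i, j))" for G i j
  proof (cases "i = j")
    case True
    have "2 / sqrt (2 * ?n) = sqrt (2 / ?n)"
    proof -
      have "2 / (sqrt 2 * c) = (2 / sqrt 2) / c" for c :: real by simp
      then show ?thesis by (simp only: real_sqrt_divide real_sqrt_mult real_div_sqrt)
    qed
    then have "x * 2 / sqrt (2 * ?n) = x * sqrt (2 / ?n)" for x
      by (simp only: times_divide_eq_right[symmetric])
    note * = this[of "G $ i $ j"]
    have "sym_part G $ i $ j = G $ i $ j * 2 / sqrt (2 * ?n)"
      using True by (simp add: sym_part_def transpose_def)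
    also note *
    also have "G $ i $ j * sqrt (2 / ?n) = \<sigma> (i, j) * (G \<bullet> e (i, j))"
      using True by (simp add: e_def \<sigma>_def EG)
    finally show ?thesis .
  next
    case False
    have "1 / sqrt (2 * ?n) = sqrt (1 / ?n) * (1 / sqrt 2)"
      by (simp add: real_sqrt_divide real_sqrt_mult)
    with False show ?thesis
      by (simp add: sym_part_def e_def \<sigma>_def EG transpose_def inner_add_right)
  qed
  have \<sigma>: "\<sigma> p > 0" for p using n by (auto simp: \<sigma>_def split: prod.splits)
  let ?I = "{(i, j). i \<le> j} :: ('d \<times> 'd) set"
  have ort: "e p \<bullet> e q = (if p = q then 1 else 0)" if "p \<in> ?I" "q \<in> ?I" for p q
  proof -
    obtain i j k l where p: "p = (i, j)" and q: "q = (k, l)" by (cases p, cases q)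
    have ij: "i \<le> j" "k \<le> l" using that p q by auto
    have "(1 / sqrt 2) * ((1 / sqrt 2) * x) = x / 2" for x :: real
      by simp
    then show ?thesis
      using ij by (cases "i = j"; cases "k = l") (auto simp: e_def p q E inner_add_left inner_add_right)
  qed
  have fin: "finite ?I" by (rule finite_subset[of _ UNIV]) auto
  have ne: "?I \<noteq> {}" by auto
  have meas [measurable]: "(sym_part :: ((real, 'd) vec, 'd) vec \<Rightarrow> _) \<in> borel_measurable borel"
  proof (rule borel_measurable_continuous_onI)
    show "continuous_on UNIV (sym_part :: ((real, 'd) vec, 'd) vec \<Rightarrow> _)"
      unfolding sym_part_def transpose_def by (intro continuous_intros)
  qed
  have dist: "distributed std_gauss lborel (\<lambda>G. sym_part G $ i $ j) (normal_density 0 (\<sigma> (i, j)))" if "i \<le> j" for i j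
  proof -
    have "distributed std_gauss lborel (\<lambda>G. 0 + \<sigma> (i, j) * (G \<bullet> e (i, j))) (normal_density (0 + \<sigma> (i, j) * 0) (\<bar>\<sigma> (i, j)\<bar> * 1))"
      using distributed_std_gauss_orthonormal[OF fin ne ort, of "(i, j)"] that \<sigma>[of "(i, j)"]
      by (intro normal_density_affine) (auto simp: \<sigma>[THEN less_imp_neq, symmetric])
    then show ?thesis using \<sigma>[of "(i, j)"] by (simp add: entry)
  qed
  have "indep_vars (\<lambda>_. borel) (\<lambda>p x. (\<lambda>y. \<sigma> p * y) (x \<bullet> e p)) ?I"
    by (rule indep_vars_compose2[OF indep_vars_std_gauss_orthonormal[OF fin ne ort]]) auto
  also have "(\<lambda>p x. (\<lambda>y. \<sigma> p * y) (x \<bullet> e p)) = (\<lambda>(i, j) x. sym_part x $ i $ j)"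
    by (auto simp: entry fun_eq_iff)
  finally have "indep_vars (\<lambda>_. borel) (\<lambda>(i, j) \<omega>. sym_part \<omega> $ i $ j) ?I" .
  moreover have "transpose (sym_part G) = sym_part G" for G :: "((real, 'd) vec, 'd) vec"
    by (simp add: sym_part_def transpose_def vec_eq_iff add.commute)
  ultimately show ?thesis
    unfolding is_GOE_def
  proof (intro conjI allI impI)
    show "distributed std_gauss lborel (\<lambda>\<omega>. sym_part \<omega> $ i $ j) (normal_density 0 (sqrt (1 / ?n)))" if "i < j" for i j :: "'d"
      using dist[OF less_imp_le[OF that]] less_imp_neq[OF that] by (simp add: \<sigma>_def)
    show "distributed std_gauss lborel (\<lambda>\<omega>. sym_part \<omega> $ i $ i) (normal_density 0 (sqrt (2 / ?n)))" for i :: "'d"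
      using dist[of i i] by (simp add: \<sigma>_def)
  qed (use meas in \<open>auto simp: measurable_cong_sets[OF sets_std_gauss refl]\<close>)
qed

text \<open>The predicate fixes the joint law of the entries with \<open>i \<le> j\<close>, and
  almost sure symmetry lets \<open>H\<close> rebuild the matrix from them. It allows an abstract
  \<open>W\<close> to be replaced by \<open>sym_part G\<close>.\<close>

lemma is_GOE_law_unique:
  fixes W :: "'w \<Rightarrow> real^('d::{finite,linorder})^('d::_)" and W' :: "'v \<Rightarrow> real^('d::{finite,linorder})^('d::_)"
  assumes "prob_space \<Omega>" "is_GOE \<Omega> W" "prob_space \<Omega>'" "is_GOE \<Omega>' W'"
  shows "distr \<Omega> borel W = distr \<Omega>' borel W'"
proof -
  let ?I = "{(i, j). i \<le> j} :: ('d \<times> 'd) set"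
  define \<sigma> where "\<sigma> = (\<lambda>(i::'d, j::'d). if i = j then sqrt (2 / real CARD('d)) else sqrt (1 / real CARD('d)))"
  define H :: "('d \<times> 'd \<Rightarrow> real) \<Rightarrow> ((real, 'd) vec, 'd) vec" where
    "H x = (\<chi> i j. x (if i \<le> j then (i, j) else (j, i)))" for x
  have H [measurable]: "H \<in> borel_measurable (PiM ?I (\<lambda>_. borel))"
    unfolding H_def by (intro measurable_vec_lambdaI measurable_component_singleton) auto
  have main: "distr \<Omega> borel W = distr (PiM ?I (\<lambda>p. density lborel (normal_density 0 (\<sigma> p)))) borel H"
    if "prob_space \<Omega>" and G: "is_GOE \<Omega> W" for \<Omega> and W :: "'x \<Rightarrow> ((real, 'd) vec, 'd) vec"
  proof -
    interpret prob_space \<Omega> by fact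
    have [measurable]: "W \<in> borel_measurable \<Omega>" using G by (simp add: is_GOE_def)
    have ind: "indep_vars (\<lambda>_. borel) (\<lambda>p \<omega>. W \<omega> $ fst p $ snd p) ?I"
      using G by (simp add: is_GOE_def case_prod_beta')
    have dist: "distr \<Omega> borel (\<lambda>\<omega>. W \<omega> $ fst p $ snd p) = density lborel (normal_density 0 (\<sigma> p))" if p: "p \<in> ?I" for p
    proof -
      have "distributed \<Omega> lborel (\<lambda>\<omega>. W \<omega> $ fst p $ snd p) (normal_density 0 (\<sigma> p))"
        using p G by (cases "fst p = snd p") (auto simp: is_GOE_def \<sigma>_def)
      then show ?thesis by (simp add: distributed_def cong: distr_cong)
    qed
    have "distr \<Omega> borel W = distr \<Omega> borel (\<lambda>\<omega>. H (\<lambda>p\<in>?I. W \<omega> $ fst p $ snd p))"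
    proof (rule distr_cong_AE)
      have *: "H (\<lambda>p\<in>?I. A $ fst p $ snd p) = A" if "transpose A = A" for A
      proof -
        have "A $ i $ j = A $ j $ i" for i j
          using arg_cong[OF that, of "\<lambda>A. A $ i $ j"] by (simp add: transpose_def)
        then show ?thesis by (auto simp: H_def vec_eq_iff)
      qed
      show "AE \<omega> in \<Omega>. W \<omega> = H (\<lambda>p\<in>?I. W \<omega> $ fst p $ snd p)"
        using G unfolding is_GOE_def by (auto elim!: AE_mp simp: *)
    qed (auto intro!: measurable_compose[OF _ H] measurable_restrict)
    also have "\<dots> = distr (distr \<Omega> (PiM ?I (\<lambda>_. borel)) (\<lambda>\<omega>. \<lambda>p\<in>?I. W \<omega> $ fst p $ snd p)) borel H"
      by (subst distr_distr) (auto intro!: measurable_restrict simp: o_def)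
    also have "distr \<Omega> (PiM ?I (\<lambda>_. borel)) (\<lambda>\<omega>. \<lambda>p\<in>?I. W \<omega> $ fst p $ snd p)
       = PiM ?I (\<lambda>p. distr \<Omega> borel (\<lambda>\<omega>. W \<omega> $ fst p $ snd p))"
      using ind by (subst (asm) indep_vars_iff_distr_eq_PiM') auto
    also have "\<dots> = PiM ?I (\<lambda>p. density lborel (normal_density 0 (\<sigma> p)))"
      by (intro PiM_cong refl dist)
    finally show ?thesis .
  qed
  show ?thesis using main[OF assms(1,2)] main[OF assms(3,4)] by simp
qed

section \<open>Invariant measures\<close>

text \<open>Count the pairs at distance less than \<open>e\<close> whose \<open>N\<close>-component
  lies in \<open>C\<close>: their other component lies in the neighbourhood \<open>T e\<close>. As
  all balls of radius \<open>e\<close> have the same mass \<open>m\<close>, Fubini gives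
  \<open>m * N C \<le> m * M (T e)\<close>. Since \<open>C\<close> is closed, \<open>T e\<close>
  shrinks to \<open>C\<close> as \<open>e\<close> tends to 0.\<close>

lemma emeasure_le_of_equal_balls:
  fixes M N :: "'a::{metric_space, second_countable_topology} measure"
  assumes M: "prob_space M" "sets M = sets borel" and N: "prob_space N" "sets N = sets borel"
    and S: "AE x in M. x \<in> S" "AE x in N. x \<in> S"
    and const: "\<And>x y e. x \<in> S \<Longrightarrow> y \<in> S \<Longrightarrow> e > 0 \<Longrightarrow> emeasure M (ball x e) = emeasure N (ball y e)"
    and C: "closed C"
  shows "emeasure N C \<le> emeasure M C"
proof (cases "C = {}")
  case False
  interpret M: prob_space M by fact
  interpret N: prob_space N by fact
  interpret MN: pair_sigma_finite M N ..
  note [measurable_cong] = M(2) N(2)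
  have [measurable]: "closed C" by fact
  have [measurable]: "C \<in> sets borel" using C by simp
  define T where "T e = {x. infdist x C < e}" for e
  have T [measurable]: "T e \<in> sets borel" for e
    unfolding T_def by (intro borel_open open_Collect_less continuous_intros)
  have le: "emeasure N C \<le> emeasure M (T e)" if "e > 0" for e
  proof -
    obtain x0 where x0: "x0 \<in> S"
    proof -
      have "S \<noteq> {}"
      proof
        assume "S = {}"
        then have "AE x in M. False" using S(1) by simp
        then show False by simp
      qed
      then show thesis using that by blast
    qed
    define m where "m = emeasure N (ball x0 e)"
    have mN: "emeasure N (ball x e) = m" "emeasure M (ball x e) = m" if "x \<in> S" for x
      unfolding m_def using const[OF x0 that \<open>e > 0\<close>] const[OF that x0 \<open>e > 0\<close>] const[OF x0 x0 \<open>e > 0\<close>] by simp_all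
    \<comment> \<open>Otherwise, by Lindelof, countably many null balls would cover
      \<open>S\<close>.\<close>
    have "m \<noteq> 0"
    proof
      assume "m = 0"
      have "\<exists>D. countable D \<and> D \<subseteq> (\<lambda>x. ball x e) ` S \<and> \<Union>D = \<Union>((\<lambda>x. ball x e) ` S)"
        by (rule Lindelof[of "(\<lambda>x. ball x e) ` S"]) auto
      then obtain D where D: "countable D" "D \<subseteq> (\<lambda>x. ball x e) ` S" "\<Union>D = \<Union>((\<lambda>x. ball x e) ` S)" by auto
      have "\<Union>D \<in> null_sets N"
      proof (rule null_sets_UN'[OF D(1), where N="\<lambda>x. x", simplified])
        fix B assume "B \<in> D"
        then obtain x where "x \<in> S" "B = ball x e" using D by auto
        then show "B \<in> null_sets N" using mN \<open>m = 0\<close> by (auto simp: N)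
      qed
      moreover have "S \<subseteq> \<Union>D" using D \<open>e > 0\<close> by auto
      ultimately have "AE x in N. x \<notin> S" by (auto intro!: AE_I')
      with S(2) have "AE x in N. False" by eventually_elim auto
      then show False by simp
    qed
    have "m \<noteq> \<infinity>" unfolding m_def by simp
    have "m * emeasure N C = (\<integral>\<^sup>+x. m * indicator C x \<partial>N)"
      by (simp add: nn_integral_cmult)
    also have "\<dots> = (\<integral>\<^sup>+x. (\<integral>\<^sup>+y. indicator {..<e} (dist x y) * indicator C x \<partial>M) \<partial>N)"
    proof (rule nn_integral_cong_AE, use S(2) in eventually_elim)
      case (elim x)
      have "m = (\<integral>\<^sup>+y. indicator (ball x e) y \<partial>M)" using mN[OF elim] by simp
      also have "\<dots> = (\<integral>\<^sup>+y. indicator {..<e} (dist x y) \<partial>M)"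
        by (intro nn_integral_cong) (auto simp: indicator_def)
      finally show ?case by (simp add: nn_integral_multc)
    qed
    also have "\<dots> \<le> (\<integral>\<^sup>+x. (\<integral>\<^sup>+y. indicator {..<e} (dist x y) * indicator (T e) y \<partial>M) \<partial>N)"
    proof (intro nn_integral_mono)
      fix x y
      have "infdist y C < e" if "x \<in> C" "dist x y < e"
        using infdist_le[OF that(1), of y] that by (simp add: dist_commute)
      then show "indicator {..<e} (dist x y) * indicator C x \<le> (indicator {..<e} (dist x y) * indicator (T e) y :: ennreal)"
        by (auto simp: indicator_def T_def)
    qed
    also have "\<dots> = (\<integral>\<^sup>+y. (\<integral>\<^sup>+x. indicator {..<e} (dist x y) * indicator (T e) y \<partial>N) \<partial>M)"
      by (rule MN.Fubini') measurable
    also have "\<dots> = (\<integral>\<^sup>+y. m * indicator (T e) y \<partial>M)"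
    proof (rule nn_integral_cong_AE, use S(1) in eventually_elim)
      case (elim x)
      have "m = (\<integral>\<^sup>+y. indicator (ball x e) y \<partial>N)" using mN[OF elim] by simp
      also have "\<dots> = (\<integral>\<^sup>+y. indicator {..<e} (dist y x) \<partial>N)"
        by (intro nn_integral_cong) (auto simp: indicator_def dist_commute)
      finally show ?case by (simp add: nn_integral_multc)
    qed
    also have "\<dots> = m * emeasure M (T e)"
      by (simp add: nn_integral_cmult)
    finally show ?thesis
      using \<open>m \<noteq> 0\<close> \<open>m \<noteq> \<infinity>\<close> by (simp add: ennreal_mult_le_mult_iff)
  qed
  have CT: "(\<Inter>n. T (1 / Suc n)) = C"
  proof (intro set_eqI iffI)
    fix x assume "x \<in> (\<Inter>n. T (1 / Suc n))"
    then have lt: "infdist x C < 1 / Suc n" for n by (auto simp: T_def)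
    have "infdist x C = 0"
    proof (rule ccontr)
      assume "infdist x C \<noteq> 0"
      then have "infdist x C > 0" using infdist_nonneg[of x C] by simp
      then obtain n where "inverse (Suc n) < infdist x C" using reals_Archimedean by blast
      with lt[of n] show False by (simp add: inverse_eq_divide)
    qed
    then show "x \<in> C" using in_closed_iff_infdist_zero[OF C False] by simp
  qed (auto simp: T_def)
  have "(\<lambda>n. emeasure M (T (1 / Suc n))) \<longlonglongrightarrow> emeasure M (\<Inter>n. T (1 / Suc n))"
  proof (rule Lim_emeasure_decseq)
    show "decseq (\<lambda>n. T (1 / Suc n))"
    proof (rule decseq_SucI)
      fix n have "1 / real (Suc (Suc n)) \<le> 1 / Suc n" by (simp add: field_simps)
      then show "T (1 / Suc (Suc n)) \<subseteq> T (1 / Suc n)" by (auto simp: T_def)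
    qed
  qed (auto simp: M)
  then have "(\<lambda>n. emeasure M (T (1 / Suc n))) \<longlonglongrightarrow> emeasure M C"
    unfolding CT .
  then show ?thesis
    by (rule LIMSEQ_le_const) (auto intro!: le exI[of _ 0])
qed simp

text \<open>By symmetry of \<open>dist\<close> and Fubini, the two constant values of the measure of an \<open>e\<close>-ball
  centred in \<open>S\<close> agree; comparing averages over small balls then identifies the measures.\<close>

theorem invariant_measure_unique:
  fixes M N :: "'a::{metric_space, second_countable_topology} measure"
  assumes M: "prob_space M" "sets M = sets borel" and N: "prob_space N" "sets N = sets borel"
    and S: "AE x in M. x \<in> S" "AE x in N. x \<in> S"
    and trans: "\<And>x y. x \<in> S \<Longrightarrow> y \<in> S \<Longrightarrow> \<exists>f. f x = y \<and> (\<forall>a b. dist (f a) (f b) = dist a b)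
      \<and> distr M borel f = M \<and> distr N borel f = N"
  shows "M = N"
proof -
  interpret M: prob_space M by fact
  interpret N: prob_space N by fact
  interpret MN: pair_sigma_finite M N ..
  note [measurable_cong] = M(2) N(2)
  have inv: "emeasure M (ball x e) = emeasure M (ball y e) \<and> emeasure N (ball x e) = emeasure N (ball y e)"
    if xy: "x \<in> S" "y \<in> S" for x y e
  proof -
    obtain f where f: "f x = y" "\<And>a b. dist (f a) (f b) = dist a b"
      "distr M borel f = M" "distr N borel f = N"
      using trans[OF xy] by auto
    have "continuous_on UNIV f"
      unfolding continuous_on_iff using f(2) by metis
    then have [measurable]: "f \<in> borel_measurable borel" by (rule borel_measurable_continuous_onI)
    have "f -` ball y e = ball x e" using f(1,2) by auto
    then have "emeasure (distr M borel f) (ball y e) = emeasure M (ball x e)"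
      "emeasure (distr N borel f) (ball y e) = emeasure N (ball x e)"
      using sets_eq_imp_space_eq[OF M(2)] sets_eq_imp_space_eq[OF N(2)]
      by (simp_all add: emeasure_distr)
    then show ?thesis using f by simp
  qed
  have eq: "emeasure M (ball x e) = emeasure N (ball y e)" if xy: "x \<in> S" "y \<in> S" for x y e
  proof -
    have "emeasure M (ball x e) = (\<integral>\<^sup>+z. emeasure M (ball x e) \<partial>N)"
      using N.emeasure_space_1 by simp
    also have "\<dots> = (\<integral>\<^sup>+z. (\<integral>\<^sup>+w. indicator {..<e} (dist z w) \<partial>M) \<partial>N)"
    proof (rule nn_integral_cong_AE, use S(2) in eventually_elim)
      case (elim z)
      have "emeasure M (ball x e) = (\<integral>\<^sup>+w. indicator (ball z e) w \<partial>M)" using inv[OF xy(1) elim] by (simp add: M)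
      also have "\<dots> = (\<integral>\<^sup>+w. indicator {..<e} (dist z w) \<partial>M)"
        by (intro nn_integral_cong) (auto simp: indicator_def)
      finally show ?case .
    qed
    also have "\<dots> = (\<integral>\<^sup>+w. (\<integral>\<^sup>+z. indicator {..<e} (dist z w) \<partial>N) \<partial>M)"
      by (rule MN.Fubini') measurable
    also have "\<dots> = (\<integral>\<^sup>+w. emeasure N (ball y e) \<partial>M)"
    proof (rule nn_integral_cong_AE, use S(1) in eventually_elim)
      case (elim z)
      have "emeasure N (ball y e) = (\<integral>\<^sup>+w. indicator (ball z e) w \<partial>N)" using inv[OF xy(2) elim] by (simp add: N)
      also have "\<dots> = (\<integral>\<^sup>+w. indicator {..<e} (dist w z) \<partial>N)"
        by (intro nn_integral_cong) (auto simp: indicator_def dist_commute)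
      finally show ?case by simp
    qed
    also have "\<dots> = emeasure N (ball y e)" using M.emeasure_space_1 by simp
    finally show ?thesis .
  qed
  have closed_eq: "emeasure M C = emeasure N C" if "closed C" for C
  proof (rule antisym)
    show "emeasure N C \<le> emeasure M C"
      by (rule emeasure_le_of_equal_balls[OF M N S _ that]) (rule eq)
    show "emeasure M C \<le> emeasure N C"
      by (rule emeasure_le_of_equal_balls[OF N M S(2,1) _ that]) (rule eq[symmetric])
  qed
  show ?thesis
  proof (rule measure_eqI_generator_eq[where \<Omega>=UNIV and E="{C. closed C}" and A="\<lambda>_. UNIV"])
    show "Int_stable {C :: 'a set. closed C}" by (auto simp: Int_stable_def)
    show "sets M = sigma_sets UNIV {C. closed C}" "sets N = sigma_sets UNIV {C. closed C}"
      unfolding M N by (simp_all add: borel_eq_closed)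
    show "emeasure M UNIV \<noteq> \<infinity>" using M.emeasure_finite by simp
  qed (auto simp: closed_eq)
qed

section \<open>Gaussian shifts seen by an adaptive observer\<close>

definition ortho_proj :: "('a::euclidean_space \<Rightarrow> 'a) \<Rightarrow> bool" where
  "ortho_proj p \<longleftrightarrow> linear p \<and> (\<forall>x. p (p x) = p x) \<and> (\<forall>x y. p x \<bullet> y = x \<bullet> p y)"

text \<open>The map \<open>T\<close> exchanges the \<open>p\<close>-components of two independent
  vectors. It is orthogonal on the product space, so the first component of its image is again a
  standard Gaussian vector.\<close>

lemma resample_ortho_proj:
  fixes p :: "'a::euclidean_space \<Rightarrow> 'a"
  assumes p: "ortho_proj p" and f [measurable]: "f \<in> borel_measurable borel"
  shows "(\<integral>\<^sup>+x. (\<integral>\<^sup>+y. f (x - p x + p y) \<partial>std_gauss) \<partial>std_gauss) = (\<integral>\<^sup>+x. f x \<partial>std_gauss)"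
proof -
  interpret G: prob_space "std_gauss :: 'a measure" by (rule prob_space_std_gauss)
  have lin: "linear p" and idem: "\<And>x. p (p x) = p x" and adj: "\<And>x y. p x \<bullet> y = x \<bullet> p y"
    using p by (auto simp: ortho_proj_def)
  define T :: "'a \<times> 'a \<Rightarrow> 'a \<times> 'a" where
    "T = (\<lambda>(x, y). (x - p x + p y, y - p y + p x))"
  have [measurable]: "p \<in> borel_measurable borel"
    using lin by (rule borel_measurable_linear)
  have T: "orthogonal_transformation T"
    unfolding orthogonal_transformation_def
  proof (intro conjI allI)
    show "linear T"
      unfolding T_def by (auto intro!: linearI simp: linear_add[OF lin] linear_cmul[OF lin] algebra_simps)
    have pp: "p a \<bullet> p b = a \<bullet> p b" for a b by (simp add: adj idem)
    show "T v \<bullet> T w = v \<bullet> w" for v w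
      by (cases v; cases w) (simp add: T_def inner_prod_def inner_diff inner_add inner_add_right inner_diff_right adj pp idem)
  qed
  have [measurable]: "T \<in> borel \<rightarrow>\<^sub>M borel"
    using orthogonal_transformation_linear[OF T]
    by (rule borel_measurable_linear)
  have [measurable]: "(fst :: 'a \<times> 'a \<Rightarrow> 'a) \<in> borel \<rightarrow>\<^sub>M borel"
    by (simp add: borel_prod[symmetric])
  have "(\<integral>\<^sup>+x. (\<integral>\<^sup>+y. f (x - p x + p y) \<partial>std_gauss) \<partial>std_gauss)
     = (\<integral>\<^sup>+z. f (fst (T z)) \<partial>(std_gauss \<Otimes>\<^sub>M std_gauss))"
    by (subst G.nn_integral_fst[symmetric]) (auto simp: T_def case_prod_beta)
  also have "\<dots> = (\<integral>\<^sup>+z. f (fst (T z)) \<partial>std_gauss)"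
    by (simp add: pair_std_gauss)
  also have "\<dots> = (\<integral>\<^sup>+z. f (fst z) \<partial>distr std_gauss borel T)"
    by (subst nn_integral_distr[where f="\<lambda>z. f (fst z)"]) simp_all
  also have "\<dots> = (\<integral>\<^sup>+z. f (fst z) \<partial>(std_gauss \<Otimes>\<^sub>M (std_gauss :: 'a measure)))"
    by (simp add: std_gauss_orthogonal_transformation[OF T] pair_std_gauss)
  also have "\<dots> = (\<integral>\<^sup>+x. f x \<partial>std_gauss)"
    using G.emeasure_space_1 by (subst G.nn_integral_fst[symmetric]) auto
  finally show ?thesis .
qed

text \<open>Here the projection may depend on the vector itself, as for an adaptive observer who
  sees \<open>x - p x x\<close>. The integral identity says that, given what is seen, the unseen
  part is still standard Gaussian on the range of \<open>p x\<close>.\<close>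

definition resampling :: "('a::euclidean_space \<Rightarrow> 'a \<Rightarrow> 'a) \<Rightarrow> bool" where
  "resampling p \<longleftrightarrow> (\<forall>x. ortho_proj (p x)) \<and> (\<lambda>(x, y). p x y) \<in> borel \<Otimes>\<^sub>M borel \<rightarrow>\<^sub>M borel \<and>
     (\<forall>f\<in>borel_measurable borel.
       (\<integral>\<^sup>+x. (\<integral>\<^sup>+y. f (x - p x x + p x y) \<partial>std_gauss) \<partial>std_gauss) = (\<integral>\<^sup>+x. f x \<partial>std_gauss))"

text \<open>One more observation: the range of \<open>q x\<close> lies in that of \<open>p x\<close>
  by \<open>pq\<close>, and \<open>q\<close> is determined by what \<open>p\<close> leaves visible
  by \<open>inv\<close>. Resampling through \<open>p\<close> and then through \<open>q\<close>
  amounts to resampling the fresh copy used for \<open>p\<close>, and for that copy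
  \<open>q x\<close> is a fixed projection.\<close>

lemma resampling_step:
  fixes p q :: "'a::euclidean_space \<Rightarrow> 'a \<Rightarrow> 'a"
  assumes p: "resampling p" and q: "\<And>x. ortho_proj (q x)"
    and meas: "(\<lambda>(x, y). q x y) \<in> borel \<Otimes>\<^sub>M borel \<rightarrow>\<^sub>M borel"
    and pq: "\<And>x y. p x (q x y) = q x y"
    and inv: "\<And>x z. q (x + p x z) = q x"
  shows "resampling q"
  unfolding resampling_def
proof (intro conjI ballI allI q meas)
  fix f :: "'a \<Rightarrow> ennreal" assume f [measurable]: "f \<in> borel_measurable borel"
  interpret G: prob_space "std_gauss :: 'a measure" by (rule prob_space_std_gauss)
  interpret GG: pair_sigma_finite "std_gauss :: 'a measure" "std_gauss :: 'a measure" ..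
  have pm [measurable]: "(\<lambda>(x, y). p x y) \<in> borel \<Otimes>\<^sub>M borel \<rightarrow>\<^sub>M borel"
    using p by (simp add: resampling_def)
  have pm' [measurable]: "(\<lambda>\<omega>. p (g \<omega>) (h \<omega>)) \<in> borel_measurable M"
    if "g \<in> borel_measurable M" "h \<in> borel_measurable M" for g h and M :: "'x measure"
    using measurable_compose[OF measurable_Pair[OF that] pm] by simp
  have qm' [measurable]: "(\<lambda>\<omega>. q (g \<omega>) (h \<omega>)) \<in> borel_measurable M"
    if "g \<in> borel_measurable M" "h \<in> borel_measurable M" for g h and M :: "'x measure"
    using measurable_compose[OF measurable_Pair[OF that] meas] by simp
  have pf: "(\<integral>\<^sup>+x. (\<integral>\<^sup>+y. h (x - p x x + p x y) \<partial>std_gauss) \<partial>std_gauss) = (\<integral>\<^sup>+x. h x \<partial>std_gauss)"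
    if "h \<in> borel_measurable borel" for h
    using p that by (simp add: resampling_def)
  have linp: "linear (p x)" and idemp: "p x (p x y) = p x y" and adjp: "p x y \<bullet> z = y \<bullet> p x z" for x y z
    using p by (auto simp: resampling_def ortho_proj_def)
  have linq: "linear (q x)" and adjq: "q x y \<bullet> z = y \<bullet> q x z" for x y z
    using q[of x] by (auto simp: ortho_proj_def)
  \<comment> \<open>The adjoint form of \<open>pq\<close>.\<close>
  have qp: "q x (p x y) = q x y" for x y
  proof -
    have "q x (p x y) \<bullet> z = q x y \<bullet> z" for z
      by (simp add: adjq adjp pq)
    then show ?thesis using vector_eq_rdot by blast
  qed
  \<comment> \<open>With \<open>x\<close> held fixed, the \<open>q\<close>-resampling acts on
    \<open>y\<close> alone, so \<open>resample_ortho_proj\<close> applies to the inner two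
    integrals.\<close>
  have key: "(x - p x x + p x y) - q (x - p x x + p x y) (x - p x x + p x y) + q (x - p x x + p x y) z
    = x - p x x + p x (y - q x y + q x z)" for x y z
  proof -
    have *: "x - p x x + p x y = x + p x (y - x)"
      by (simp add: linear_diff[OF linp])
    have "q x (x - p x x + p x y) = q x y"
      by (simp add: linear_diff[OF linq] linear_add[OF linq] qp)
    moreover have "q (x - p x x + p x y) = q x" unfolding * by (rule inv)
    moreover have "p x (y - q x y + q x z) = p x y - q x y + q x z"
      by (simp add: linear_diff[OF linp] linear_add[OF linp] pq)
    ultimately show ?thesis by simp
  qed
  have "(\<integral>\<^sup>+x. (\<integral>\<^sup>+z. f (x - q x x + q x z) \<partial>std_gauss) \<partial>std_gauss)
    = (\<integral>\<^sup>+x. (\<integral>\<^sup>+y. (\<integral>\<^sup>+z. f (x - p x x + p x (y - q x y + q x z)) \<partial>std_gauss) \<partial>std_gauss) \<partial>std_gauss)"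
    by (subst pf[symmetric]) (simp_all add: key)
  also have "\<dots> = (\<integral>\<^sup>+x. (\<integral>\<^sup>+y. f (x - p x x + p x y) \<partial>std_gauss) \<partial>std_gauss)"
    by (intro nn_integral_cong resample_ortho_proj[where f="\<lambda>y. f (_ - p _ _ + p _ y)"] q) measurable
  also have "\<dots> = (\<integral>\<^sup>+x. f x \<partial>std_gauss)" by (rule pf) simp
  finally show "(\<integral>\<^sup>+x. (\<integral>\<^sup>+z. f (x - q x x + q x z) \<partial>std_gauss) \<partial>std_gauss) = (\<integral>\<^sup>+x. f x \<partial>std_gauss)" .
qed

lemma resampling_const:
  "ortho_proj p \<Longrightarrow> resampling (\<lambda>_. p)"
proof -
  assume p: "ortho_proj p"
  then have "linear p" by (simp add: ortho_proj_def)
  then have [measurable]: "p \<in> borel_measurable borel"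
    by (rule borel_measurable_linear)
  show ?thesis using p by (auto simp: resampling_def resample_ortho_proj)
qed

text \<open>Integrating out the unseen component in the Cameron-Martin formula leaves only the part of the
  shift that is seen.\<close>

lemma resampling_shift:
  fixes p :: "'a::euclidean_space \<Rightarrow> 'a \<Rightarrow> 'a"
  assumes p: "resampling p" and f [measurable]: "f \<in> borel_measurable borel"
    and inv: "\<And>x z. f (x + p x z) = f x"
  shows "(\<integral>\<^sup>+x. f (x + b) \<partial>std_gauss) =
    (\<integral>\<^sup>+x. f x * ennreal (exp (x \<bullet> (b - p x b) - (b \<bullet> b - p x b \<bullet> p x b) / 2)) \<partial>std_gauss)"
proof -
  interpret G: prob_space "std_gauss :: 'a measure" by (rule prob_space_std_gauss)
  have pm [measurable]: "(\<lambda>(x, y). p x y) \<in> borel \<Otimes>\<^sub>M borel \<rightarrow>\<^sub>M borel"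
    using p by (simp add: resampling_def)
  have pm' [measurable]: "(\<lambda>\<omega>. p (g \<omega>) (h \<omega>)) \<in> borel_measurable M"
    if "g \<in> borel_measurable M" "h \<in> borel_measurable M" for g h and M :: "'x measure"
    using measurable_compose[OF measurable_Pair[OF that] pm] by simp
  have lin: "linear (p x)" and adj: "p x y \<bullet> z = y \<bullet> p x z" for x y z
    using p by (auto simp: resampling_def ortho_proj_def)
  let ?h = "\<lambda>x. f x * ennreal (exp (x \<bullet> b - (b \<bullet> b) / 2))"
  have "(\<integral>\<^sup>+x. f (x + b) \<partial>std_gauss) = (\<integral>\<^sup>+x. ?h x \<partial>std_gauss)"
    by (rule std_gauss_translate) simp
  also have "\<dots> = (\<integral>\<^sup>+x. (\<integral>\<^sup>+y. ?h (x - p x x + p x y) \<partial>std_gauss) \<partial>std_gauss)"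
  proof -
    have h: "?h \<in> borel_measurable borel" by measurable
    have "\<forall>h\<in>borel_measurable borel.
       (\<integral>\<^sup>+x. (\<integral>\<^sup>+y. h (x - p x x + p x y) \<partial>std_gauss) \<partial>std_gauss) = (\<integral>\<^sup>+x. h x \<partial>std_gauss)"
      using p by (simp add: resampling_def)
    from bspec[OF this h] show ?thesis by simp
  qed
  also have "\<dots> = (\<integral>\<^sup>+x. f x * ennreal (exp (x \<bullet> (b - p x b) - (b \<bullet> b - p x b \<bullet> p x b) / 2)) \<partial>std_gauss)"
  proof (intro nn_integral_cong)
    fix x
    have *: "x - p x x + p x y = x + p x (y - x)" for y
      by (simp add: linear_diff[OF lin])
    \<comment> \<open>Since \<open>f\<close> ignores the unseen part, only
      \<open>y \<bullet> p x b\<close> is random; its exponential moment restores half the squared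
      norm of \<open>p x b\<close>.\<close>
    have "?h (x - p x x + p x y) = (f x * ennreal (exp (x \<bullet> (b - p x b) - (b \<bullet> b) / 2))) * ennreal (exp (y \<bullet> p x b))" for y
    proof -
      have "f (x - p x x + p x y) = f x" unfolding * by (rule inv)
      moreover have "(x - p x x + p x y) \<bullet> b - (b \<bullet> b) / 2 = (x \<bullet> (b - p x b) - (b \<bullet> b) / 2) + y \<bullet> p x b"
        by (simp add: inner_diff inner_add inner_diff_right inner_add_left adj)
      ultimately show ?thesis
        by (simp only: exp_add ennreal_mult' exp_ge_zero mult.assoc)
    qed
    then have "(\<integral>\<^sup>+y. ?h (x - p x x + p x y) \<partial>std_gauss)
      = (f x * ennreal (exp (x \<bullet> (b - p x b) - (b \<bullet> b) / 2))) * ennreal (exp ((p x b \<bullet> p x b) / 2))"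
      by (simp only:) (subst nn_integral_cmult, auto simp: nn_integral_std_gauss_exp)
    also have "\<dots> = f x * ennreal (exp (x \<bullet> (b - p x b) - (b \<bullet> b - p x b \<bullet> p x b) / 2))"
    proof -
      have "x \<bullet> (b - p x b) - (b \<bullet> b) / 2 + (p x b \<bullet> p x b) / 2 = x \<bullet> (b - p x b) - (b \<bullet> b - p x b \<bullet> p x b) / 2"
        by (simp add: field_simps)
      then show ?thesis
        by (simp only: mult.assoc ennreal_mult'[symmetric] exp_ge_zero exp_add[symmetric])
    qed
    finally show "(\<integral>\<^sup>+y. ?h (x - p x x + p x y) \<partial>std_gauss) = f x * ennreal (exp (x \<bullet> (b - p x b) - (b \<bullet> b - p x b \<bullet> p x b) / 2))" .
  qed
  finally show ?thesis .
qed

section \<open>Eigenvalues of symmetric matrices\<close>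

text \<open>A maximizer \<open>v\<close> of the Rayleigh quotient on the unit sphere of
  \<open>T\<close> is an eigenvector: moving from \<open>v\<close> along the residual
  \<open>w = f v - c v\<close> changes the quotient to first order by a multiple of
  \<open>w \<bullet> w\<close>, so \<open>w = 0\<close>.\<close>

lemma self_adjoint_eigenvector_exists:
  fixes f :: "'a::euclidean_space \<Rightarrow> 'a"
  assumes lin: "linear f" and adj: "\<And>x y. f x \<bullet> y = x \<bullet> f y"
    and T: "subspace T" "f ` T \<subseteq> T" "x0 \<in> T" "x0 \<noteq> 0"
  shows "\<exists>v\<in>T. norm v = 1 \<and> (\<exists>c. f v = c *\<^sub>R v)"
proof -
  let ?S = "sphere 0 1 \<inter> T"
  have "compact ?S"
    by (intro compact_Int_closed compact_sphere closed_subspace T)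
  moreover have "x0 /\<^sub>R norm x0 \<in> ?S"
    using T by (auto intro: subspace_mul)
  then have "?S \<noteq> {}" by blast
  moreover have "continuous_on ?S (\<lambda>x. x \<bullet> f x)"
    using linear_continuous_on[OF lin[unfolded linear_conv_bounded_linear]]
    by (intro continuous_intros)
  ultimately obtain v where v: "v \<in> ?S" and max: "\<And>y. y \<in> ?S \<Longrightarrow> y \<bullet> f y \<le> v \<bullet> f v"
    using continuous_attains_sup[of ?S "\<lambda>x. x \<bullet> f x"] by blast
  define c where "c = v \<bullet> f v"
  have vv: "v \<bullet> v = 1" using v by (simp add: dot_square_norm)
  have quad: "y \<bullet> f y \<le> c * (y \<bullet> y)" if "y \<in> T" for y
  proof (cases "y = 0")
    case False
    have "(y /\<^sub>R norm y) \<bullet> f (y /\<^sub>R norm y) \<le> c"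
      unfolding c_def using T False that by (intro max) (auto intro: subspace_mul)
    then show ?thesis
      using False by (simp add: linear_cmul[OF lin] dot_square_norm power2_eq_square field_simps)
  qed (simp add: linear_0[OF lin])
  define w where "w = f v - c *\<^sub>R v"
  have wT: "w \<in> T" unfolding w_def using v T by (intro subspace_diff subspace_mul) auto
  have wv: "w \<bullet> v = 0" "v \<bullet> w = 0" by (simp_all add: w_def inner_diff vv c_def inner_commute inner_diff_right)
  have "f v = w + c *\<^sub>R v" by (simp add: w_def)
  then have wfv: "w \<bullet> f v = w \<bullet> w" "v \<bullet> f w = w \<bullet> w"
    using wv adj[of v w] by (simp_all add: inner_add_left inner_add_right)
  let ?K = "c * (w \<bullet> w) - w \<bullet> f w"
  have ineq: "2 * t * (w \<bullet> w) \<le> t\<^sup>2 * ?K" for t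
  proof -
    have "(v + t *\<^sub>R w) \<bullet> f (v + t *\<^sub>R w) \<le> c * ((v + t *\<^sub>R w) \<bullet> (v + t *\<^sub>R w))"
      using v wT T by (intro quad subspace_add subspace_mul) auto
    then show ?thesis
      by (simp add: linear_add[OF lin] linear_cmul[OF lin] inner_add_left inner_add_right wfv wv vv c_def[symmetric] power2_eq_square algebra_simps)
  qed
  have "w \<bullet> w = 0"
  proof (rule ccontr)
    assume "w \<bullet> w \<noteq> 0"
    then have pos: "w \<bullet> w > 0" by simp
    \<comment> \<open>Small enough for the second order term:
      \<open>t * ?K \<le> w \<bullet> w\<close>.\<close>
    define t where "t = (w \<bullet> w) / (\<bar>?K\<bar> + 1)"
    have t: "t > 0" unfolding t_def using pos by simp
    have "2 * (w \<bullet> w) \<le> t * ?K"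
      using ineq[of t] t by (simp add: power2_eq_square mult.assoc)
    also have "\<dots> \<le> t * (\<bar>?K\<bar> + 1)" using t by (intro mult_left_mono) auto
    also have "\<dots> = w \<bullet> w" unfolding t_def by simp
    finally show False using pos by simp
  qed
  then have "f v = c *\<^sub>R v" by (simp add: w_def)
  then show ?thesis using v by auto
qed

text \<open>The orthogonal complement \<open>T\<close> of the eigenvectors found so far is invariant
  under a self-adjoint map, and nonzero while there are fewer than \<open>DIM('a)\<close> of
  them.\<close>

lemma self_adjoint_orthonormal_eigenvectors:
  fixes f :: "'a::euclidean_space \<Rightarrow> 'a"
  assumes lin: "linear f" and adj: "\<And>x y. f x \<bullet> y = x \<bullet> f y" and n: "n \<le> DIM('a)"
  shows "\<exists>B. finite B \<and> card B = n \<and> (\<forall>x\<in>B. \<forall>y\<in>B. x \<bullet> y = (if x = y then 1 else 0)) \<and> (\<forall>x\<in>B. \<exists>c. f x = c *\<^sub>R x)"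
  using n
proof (induction n)
  case 0
  show ?case by (intro exI[of _ "{}"]) auto
next
  case (Suc n)
  then obtain B where B: "finite B" "card B = n" "\<And>x y. x \<in> B \<Longrightarrow> y \<in> B \<Longrightarrow> x \<bullet> y = (if x = y then 1 else 0)"
    "\<And>x. x \<in> B \<Longrightarrow> \<exists>c. f x = c *\<^sub>R x" by auto
  define T where "T = {x. \<forall>b\<in>B. x \<bullet> b = 0}"
  have sT: "subspace T" by (auto simp: T_def subspace_def inner_add_left)
  have fT: "f ` T \<subseteq> T"
  proof (intro image_subsetI)
    fix x assume x: "x \<in> T"
    show "f x \<in> T" unfolding T_def
    proof (intro CollectI ballI)
      fix b assume b: "b \<in> B"
      then obtain c where "f b = c *\<^sub>R b" using B by blast
      then show "f x \<bullet> b = 0" using x b by (simp add: adj T_def)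
    qed
  qed
  have "dim (span B) < DIM('a)"
    using B(1,2) Suc.prems dim_le_card'[OF B(1)] by simp
  then obtain x0 where x0: "x0 \<noteq> 0" "\<And>y. y \<in> span (span B) \<Longrightarrow> orthogonal x0 y"
    using orthogonal_to_subspace_exists[of "span B"] by auto
  then have "x0 \<in> T" by (auto simp: T_def orthogonal_def span_base)
  from self_adjoint_eigenvector_exists[OF lin adj sT fT this x0(1)]
  obtain v c where v: "v \<in> T" "norm v = 1" "f v = c *\<^sub>R v" by auto
  have vv: "v \<bullet> v = 1" using v by (simp add: dot_square_norm)
  have "v \<notin> B" using v(1) vv by (auto simp: T_def)
  then show ?case
    using B v vv by (intro exI[of _ "insert v B"]) (auto simp: T_def inner_commute)
qed

section \<open>Eigenbases of symmetric matrices and ordered eigenvalues\<close>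

lemma transpose_plus: "transpose (A + B) = transpose A + transpose B" for A B :: "real^'n^'m"
  by (simp add: transpose_def vec_eq_iff)

lemma transpose_scaleR: "transpose (c *\<^sub>R A) = c *\<^sub>R transpose A" for A :: "real^'n^'m"
  by (simp add: transpose_def vec_eq_iff)

definition eigen_system :: "real^'n^'n \<Rightarrow> ('n \<Rightarrow> real^'n) \<Rightarrow> ('n \<Rightarrow> real) \<Rightarrow> bool" where
  "eigen_system A e d \<longleftrightarrow> (\<forall>i j. e i \<bullet> e j = (if i = j then 1 else 0)) \<and> (\<forall>i. A *v e i = d i *\<^sub>R e i)"

lemma symmetric_inner: "transpose A = A \<Longrightarrow> (A *v x) \<bullet> y = x \<bullet> (A *v y)" for A :: "real^'n^'n"
  using dot_lmul_matrix[of x A y] vector_transpose_matrix[of x A] by simp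

lemma eigen_system_exists:
  fixes A :: "real^'n^'n"
  assumes "transpose A = A"
  obtains e d where "eigen_system A e d"
proof -
  obtain B where B: "finite B" "card B = DIM(real^'n)" "\<And>x y. x \<in> B \<Longrightarrow> y \<in> B \<Longrightarrow> x \<bullet> y = (if x = y then 1 else 0)"
    "\<And>x. x \<in> B \<Longrightarrow> \<exists>c. A *v x = c *\<^sub>R x"
    using self_adjoint_orthonormal_eigenvectors[of "(*v) A" "DIM(real^'n)", OF matrix_vector_mul_linear symmetric_inner[OF assms]]
    by auto
  obtain e :: "'n \<Rightarrow> real^'n" where e: "bij_betw e UNIV B"
    using finite_same_card_bij[of "UNIV :: 'n set" B] B(1,2) by auto
  have eB: "e i \<in> B" for i using e by (auto simp: bij_betw_def)
  have "\<forall>i. \<exists>c. A *v e i = c *\<^sub>R e i" using B(4) eB by blast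
  from choice[OF this] obtain d where d: "\<And>i. A *v e i = d i *\<^sub>R e i" by auto
  have "e i \<bullet> e j = (if i = j then 1 else 0)" for i j
    using B(3)[OF eB eB, of i j] e by (auto simp: bij_betw_def inj_on_def)
  then show ?thesis using d that unfolding eigen_system_def by blast
qed

lemma orthonormal_family_independent:
  fixes e :: "'n \<Rightarrow> real^('n::finite)"
  assumes ort: "\<And>i j. e i \<bullet> e j = (if i = j then 1 else 0)"
  shows "independent (e ` J)" and "dim (e ` J) = card J"
proof -
  have inj: "inj_on e J"
  proof (rule inj_onI)
    fix i j assume "e i = e j"
    then show "i = j" using ort[of i i] ort[of i j] by (simp split: if_splits)
  qed
  show "independent (e ` J)"
  proof (rule pairwise_orthogonal_independent)
    show "pairwise orthogonal (e ` J)"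
      using ort by (auto simp: pairwise_def orthogonal_def)
    show "0 \<notin> e ` J"
    proof
      assume "0 \<in> e ` J"
      then obtain i where "e i = 0" by auto
      then show False using ort[of i i] by simp
    qed
  qed
  then show "dim (e ` J) = card J"
    using card_image[OF inj] dim_eq_card_independent by metis
qed

lemma eigen_system_expansion:
  assumes "eigen_system A e d"
  shows "x = (\<Sum>i\<in>UNIV. (x \<bullet> e i) *\<^sub>R e i)"
    and "x \<bullet> x = (\<Sum>i\<in>UNIV. (x \<bullet> e i)\<^sup>2)"
    and "x \<bullet> (A *v x) = (\<Sum>i\<in>UNIV. d i * (x \<bullet> e i)\<^sup>2)"
proof -
  have ort: "e i \<bullet> e j = (if i = j then 1 else 0)" and eig: "A *v e i = d i *\<^sub>R e i" for i j
    using assms by (auto simp: eigen_system_def)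
  have "span (range e) = UNIV"
    using orthonormal_family_independent(2)[of e UNIV] ort by (simp add: dim_eq_full[symmetric] del: DIM_cart) simp
  have orth_all: "y = 0" if "\<And>i. y \<bullet> e i = 0" for y
  proof -
    have "y \<in> span (range e)" using \<open>span (range e) = UNIV\<close> by simp
    then have "orthogonal y y"
      by (rule orthogonal_to_span) (use that in \<open>auto simp: orthogonal_def\<close>)
    then show ?thesis by (simp add: orthogonal_def)
  qed
  show *: "x = (\<Sum>i\<in>UNIV. (x \<bullet> e i) *\<^sub>R e i)"
    using orth_all[of "x - (\<Sum>i\<in>UNIV. (x \<bullet> e i) *\<^sub>R e i)"]
    by (simp add: inner_diff_left inner_sum_left ort if_distrib[of "\<lambda>c. _ * c"] cong: if_cong)
  have lc: "(\<Sum>i\<in>UNIV. a i *\<^sub>R e i) \<bullet> (\<Sum>i\<in>UNIV. b i *\<^sub>R e i) = (\<Sum>i\<in>UNIV. a i * b i)" for a b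
    by (simp add: mult.commute inner_sum_left inner_sum_right ort if_distrib[of "\<lambda>c. _ * c"] cong: if_cong)
  show "x \<bullet> x = (\<Sum>i\<in>UNIV. (x \<bullet> e i)\<^sup>2)"
    using lc[of "\<lambda>i. x \<bullet> e i" "\<lambda>i. x \<bullet> e i"] *[symmetric] by (simp add: power2_eq_square)
  have "A *v x = (\<Sum>i\<in>UNIV. (x \<bullet> e i * d i) *\<^sub>R e i)"
  proof -
    have "A *v (\<Sum>i\<in>UNIV. (x \<bullet> e i) *\<^sub>R e i) = (\<Sum>i\<in>UNIV. (x \<bullet> e i * d i) *\<^sub>R e i)"
      by (simp add: linear_sum[OF matrix_vector_mul_linear] matrix_vector_mult_scaleR eig)
    then show ?thesis by (simp only: *[symmetric])
  qed
  then show "x \<bullet> (A *v x) = (\<Sum>i\<in>UNIV. d i * (x \<bullet> e i)\<^sup>2)"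
    using lc[of "\<lambda>i. x \<bullet> e i" "\<lambda>i. x \<bullet> e i * d i"] *[symmetric] by (simp add: power2_eq_square mult_ac)
qed

text \<open>The matrix \<open>Q\<close> with the eigenvectors as columns diagonalizes
  \<open>A\<close>; for the characteristic polynomial the same similarity is carried out over the
  ring of polynomials.\<close>

lemma det_eigen_system:
  fixes A :: "real^'n^'n"
  assumes "eigen_system A e d"
  shows "det A = (\<Prod>i\<in>UNIV. d i)"
    and "char_poly_mat A = (\<Prod>i\<in>UNIV. [:- d i, 1:])"
proof -
  have ort: "e i \<bullet> e j = (if i = j then 1 else 0)" and eig: "A *v e i = d i *\<^sub>R e i" for i j
    using assms by (auto simp: eigen_system_def)
  define Q where "Q = (\<chi> i j. e j $ i)"
  define D :: "real^'n^'n" where "D = (\<chi> i j. if i = j then d i else 0)"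
  have QQ: "transpose Q ** Q = mat 1"
    using ort by (simp add: vec_eq_iff matrix_matrix_mult_def transpose_def Q_def mat_def inner_vec_def)
  have AQ: "A ** Q = Q ** D"
    using eig by (simp add: vec_eq_iff matrix_matrix_mult_def Q_def D_def matrix_vector_mult_def if_distrib[of "\<lambda>c. _ * c"] mult.commute cong: if_cong)
  have "det (transpose Q) * det Q = 1" using arg_cong[OF QQ, of det] by (simp add: det_mul)
  moreover have "det A * det Q = det Q * det D" using arg_cong[OF AQ, of det] by (simp add: det_mul)
  moreover have "det D = (\<Prod>i\<in>UNIV. d i)" by (subst det_diagonal) (auto simp: D_def)
  ultimately show "det A = (\<Prod>i\<in>UNIV. d i)" by auto
  \<comment> \<open>Embeds real matrices as matrices of constant polynomials. It is multiplicative,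
    so \<open>det (L Q)\<close> is nonzero and can be cancelled.\<close>
  define L :: "real^'n^'n \<Rightarrow> real poly^'n^'n" where "L M = (\<chi> i j. [:M $ i $ j:])" for M
  have L: "L (M ** N) = L M ** L N" for M N
  proof -
    have "[:\<Sum>k\<in>K. f k:] = (\<Sum>k\<in>K. [:f k:])" for f :: "'n \<Rightarrow> real" and K
      by (rule poly_eqI) (simp add: coeff_sum coeff_pCons split: nat.split)
    then show ?thesis by (simp add: L_def vec_eq_iff matrix_matrix_mult_def mult.commute)
  qed
  have "L (mat 1) = mat 1" by (simp add: L_def mat_def vec_eq_iff pCons_one)
  then have "det (L (transpose Q)) * det (L Q) = 1"
    using arg_cong[OF QQ, of "\<lambda>M. det (L M)"] by (simp add: L det_mul)
  then have nz: "det (L Q) \<noteq> 0" by auto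
  have "(mat [:0, 1:] - L A) ** L Q = mat [:0, 1:] ** L Q - L (A ** Q)"
    unfolding L by (simp add: vec_eq_iff matrix_matrix_mult_def left_diff_distrib sum_subtractf)
  also have "\<dots> = L Q ** mat [:0, 1:] - L (Q ** D)"
  proof -
    have "mat [:0, 1:] ** B = B ** mat [:0, 1:]" for B :: "real poly^'n^'n"
      by (simp add: vec_eq_iff matrix_matrix_mult_def mat_def if_distrib[of "\<lambda>c. _ * c"] if_distrib[of "\<lambda>c. c * _"] mult.commute cong: if_cong)
    then show ?thesis by (simp add: AQ)
  qed
  also have "\<dots> = L Q ** (mat [:0, 1:] - L D)"
    unfolding L by (simp add: vec_eq_iff matrix_matrix_mult_def right_diff_distrib sum_subtractf)
  finally have "det (mat [:0, 1:] - L A) * det (L Q) = det (L Q) * det (mat [:0, 1:] - L D)"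
    by (simp only: det_mul[symmetric])
  then have "det (mat [:0, 1:] - L A) = det (mat [:0, 1:] - L D)" using nz by simp
  also have "\<dots> = (\<Prod>i\<in>UNIV. [:- d i, 1:])"
    by (subst det_diagonal) (auto simp: L_def D_def mat_def)
  finally show "char_poly_mat A = (\<Prod>i\<in>UNIV. [:- d i, 1:])"
    by (simp add: char_poly_mat_def L_def)
qed

text \<open>In a descending list the elements of an upward closed set form a prefix.\<close>

lemma sorted_desc_nth_iff:
  fixes xs :: "'a::linorder list"
  assumes "sorted_wrt (\<ge>) xs" "i < length xs" and up: "\<And>x y. P x \<Longrightarrow> x \<le> y \<Longrightarrow> P y"
  shows "P (xs ! i) \<longleftrightarrow> i < length (filter P xs)"
  using assms(1,2)
proof (induction xs arbitrary: i)
  case (Cons x xs)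
  show ?case
  proof (cases "P x")
    case True
    then show ?thesis using Cons by (cases i) auto
  next
    case False
    then have "\<not> P y" if "y \<in> set xs" for y using Cons.prems up that by auto
    then have "filter P xs = []" by (simp add: filter_empty_conv)
    moreover have "\<not> P ((x # xs) ! i)"
      using False \<open>\<And>y. y \<in> set xs \<Longrightarrow> \<not> P y\<close> Cons.prems(2) by (cases i) auto
    ultimately show ?thesis using False by simp
  qed
qed simp

text \<open>Replaces the sorted list of roots by a count of eigenvalues. An upward closed
  \<open>P\<close> covers strict and non-strict thresholds at once.\<close>

lemma nth_eigenvalue_iff:
  fixes A :: "real^'n^'n"
  assumes A: "eigen_system A e d" and i: "i \<in> {1..CARD('n)}" and up: "\<And>x y. P x \<Longrightarrow> x \<le> y \<Longrightarrow> P y"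
  shows "P (nth_eigenvalue i A) \<longleftrightarrow> i \<le> card {j. P (d j)}"
proof -
  define M where "M = image_mset d (mset_set UNIV)"
  have "proots (char_poly_mat A) = M"
    unfolding det_eigen_system(2)[OF A] M_def by (subst proots_prod) (auto simp: sum_unfold_sum_mset)
  then have nth: "nth_eigenvalue i A = rev (sorted_list_of_multiset M) ! (i - 1)"
    by (simp add: nth_eigenvalue_def)
  have "size M = CARD('n)" by (simp add: M_def)
  then have len: "length (rev (sorted_list_of_multiset M)) = CARD('n)"
    using size_mset[of "sorted_list_of_multiset M"] by simp
  have "length (filter P (rev (sorted_list_of_multiset M))) = size (filter_mset P M)"
    by (simp add: size_mset[symmetric] del: size_mset)
  also have "\<dots> = card {j. P (d j)}"
    by (simp add: M_def filter_mset_image_mset)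
  finally have *: "length (filter P (rev (sorted_list_of_multiset M))) = card {j. P (d j)}" .
  have "sorted_wrt (\<ge>) (rev (sorted_list_of_multiset M))"
    by (simp add: sorted_wrt_rev sorted_sorted_list_of_multiset)
  then have "P (rev (sorted_list_of_multiset M) ! (i - 1)) \<longleftrightarrow> i - 1 < card {j. P (d j)}"
    unfolding *[symmetric]
  proof (rule sorted_desc_nth_iff)
    show "i - 1 < length (rev (sorted_list_of_multiset M))" using len i by auto
  qed (rule up)
  with i show ?thesis unfolding nth by auto
qed

lemma span_orthonormal_image_inner:
  fixes e :: "'n \<Rightarrow> real^('n::finite)"
  assumes ort: "\<And>i j. e i \<bullet> e j = (if i = j then 1 else 0)" and x: "x \<in> span (e ` J)" and i: "i \<notin> J"
  shows "x \<bullet> e i = 0"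
proof -
  have "orthogonal (e i) x"
    using x by (rule orthogonal_to_span) (use ort i in \<open>auto simp: orthogonal_def\<close>)
  then show ?thesis by (simp add: orthogonal_def inner_commute)
qed

text \<open>Courant-Fischer, with a strict gap on the subspace so that the condition is open in \<open>A\<close>.\<close>

lemma nth_eigenvalue_greater_iff:
  fixes A :: "real^'n^'n"
  assumes A: "transpose A = A" and k: "k \<in> {1..CARD('n)}"
  shows "c < nth_eigenvalue k A \<longleftrightarrow>
    (\<exists>T \<epsilon>. subspace T \<and> k \<le> dim T \<and> \<epsilon> > 0 \<and> (\<forall>x\<in>T. (c + \<epsilon>) * (x \<bullet> x) \<le> x \<bullet> (A *v x)))"
proof -
  obtain e d where E: "eigen_system A e d" using eigen_system_exists[OF A] .
  have ort: "e i \<bullet> e j = (if i = j then 1 else 0)" for i j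
    using E by (auto simp: eigen_system_def)
  let ?J = "{j. c < d j}"
  have *: "c < nth_eigenvalue k A \<longleftrightarrow> k \<le> card ?J"
    using nth_eigenvalue_iff[OF E k, of "\<lambda>y. c < y"] by auto
  show ?thesis
    unfolding *
  proof
    assume k: "k \<le> card ?J"
    \<comment> \<open>The smallest gap above \<open>c\<close> among the eigenvalues in
      \<open>?J\<close>; any positive number does if \<open>?J\<close> is empty.\<close>
    obtain \<epsilon> where \<epsilon>: "\<epsilon> > 0" "\<And>j. j \<in> ?J \<Longrightarrow> c + \<epsilon> \<le> d j"
    proof (cases "?J = {}")
      case False
      have "Min (d ` ?J) \<in> d ` ?J" using False by (intro Min_in) auto
      then have "Min (d ` ?J) > c" by auto
      moreover have "Min (d ` ?J) \<le> d j" if "j \<in> ?J" for j using that by (intro Min_le) auto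
      ultimately show thesis by (intro that[of "Min (d ` ?J) - c"]) auto
    qed (auto intro: that[of 1])
    have "(c + \<epsilon>) * (x \<bullet> x) \<le> x \<bullet> (A *v x)" if x: "x \<in> span (e ` ?J)" for x
    proof -
      have "(c + \<epsilon>) * (x \<bullet> e i)\<^sup>2 \<le> d i * (x \<bullet> e i)\<^sup>2" for i
        using \<epsilon>(2)[of i] span_orthonormal_image_inner[OF ort x, of i] by (cases "i \<in> ?J") (auto intro: mult_right_mono)
      then show ?thesis
        unfolding eigen_system_expansion(2,3)[OF E, of x] sum_distrib_left by (intro sum_mono)
    qed
    moreover have "dim (span (e ` ?J)) = card ?J"
      using orthonormal_family_independent(2)[of e ?J] ort by simp
    ultimately show "\<exists>T \<epsilon>. subspace T \<and> k \<le> dim T \<and> \<epsilon> > 0 \<and> (\<forall>x\<in>T. (c + \<epsilon>) * (x \<bullet> x) \<le> x \<bullet> (A *v x))"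
      using k \<epsilon>(1) by (intro exI[of _ "span (e ` ?J)"] exI[of _ \<epsilon>]) auto
  next
    assume "\<exists>T \<epsilon>. subspace T \<and> k \<le> dim T \<and> \<epsilon> > 0 \<and> (\<forall>x\<in>T. (c + \<epsilon>) * (x \<bullet> x) \<le> x \<bullet> (A *v x))"
    then obtain T \<epsilon> where T: "subspace T" "k \<le> dim T" "\<epsilon> > 0" "\<And>x. x \<in> T \<Longrightarrow> (c + \<epsilon>) * (x \<bullet> x) \<le> x \<bullet> (A *v x)" by auto
    show "k \<le> card ?J"
    proof (rule ccontr)
      assume "\<not> k \<le> card ?J"
      let ?S = "span (e ` (- ?J))"
      have "dim ?S = card (- ?J)" using orthonormal_family_independent(2)[of e "- ?J"] ort by simp
      also have "\<dots> = CARD('n) - card ?J" by (simp add: Compl_eq_Diff_UNIV card_Diff_subset)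
      finally have S: "dim ?S + card ?J = CARD('n)" using card_mono[of UNIV ?J] by simp
      \<comment> \<open>The dimensions of \<open>T\<close> and \<open>?S\<close> add up to more than
        \<open>CARD('n)\<close>, so \<open>T\<close> contains a nonzero combination of eigenvectors
        with eigenvalues at most \<open>c\<close>.\<close>
      have "dim {x + y |x y. x \<in> T \<and> y \<in> ?S} + dim (T \<inter> ?S) = dim T + dim ?S"
        by (rule dim_sums_Int) (auto simp: T)
      moreover have "dim {x + y |x y. x \<in> T \<and> y \<in> ?S} \<le> CARD('n)"
        using dim_subset_UNIV[of "{x + y |x y. x \<in> T \<and> y \<in> ?S}"] by simp
      ultimately have "dim (T \<inter> ?S) \<noteq> 0" using S T(2) \<open>\<not> k \<le> card ?J\<close> by linarith
      then obtain x where x: "x \<in> T" "x \<in> ?S" "x \<noteq> 0" by auto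
      have "d i * (x \<bullet> e i)\<^sup>2 \<le> c * (x \<bullet> e i)\<^sup>2" for i
        using span_orthonormal_image_inner[OF ort x(2), of i] by (cases "i \<in> ?J") (auto intro: mult_right_mono)
      then have "x \<bullet> (A *v x) \<le> c * (x \<bullet> x)"
        unfolding eigen_system_expansion(2,3)[OF E, of x] sum_distrib_left by (intro sum_mono)
      moreover have "\<epsilon> * (x \<bullet> x) > 0" using T(3) x(3) by simp
      ultimately show False using T(4)[OF x(1)] by (simp add: distrib_right)
    qed
  qed
qed

text \<open>By the Courant-Fischer criterion each superlevel set is the preimage of the set
  \<open>O'\<close>, which is open because half of the gap \<open>\<epsilon>\<close> survives a
  small perturbation of the matrix.\<close>

lemma borel_measurable_nth_eigenvalue:
  fixes A :: "'a \<Rightarrow> real^'n^'n"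
  assumes A [measurable]: "A \<in> borel_measurable M" and sym: "\<And>\<omega>. transpose (A \<omega>) = A \<omega>"
    and k: "k \<in> {1..CARD('n)}"
  shows "(\<lambda>\<omega>. nth_eigenvalue k (A \<omega>)) \<in> borel_measurable M"
proof (rule borel_measurableI_greater)
  fix c :: real
  define O' where "O' = {A :: real^'n^'n. \<exists>T \<epsilon>. subspace T \<and> k \<le> dim T \<and> \<epsilon> > 0 \<and> (\<forall>x\<in>T. (c + \<epsilon>) * (x \<bullet> x) \<le> x \<bullet> (A *v x))}"
  have bl: "bounded_bilinear ((*v) :: real^'n^'n \<Rightarrow> _)"
    by (rule bilinear_conv_bounded_bilinear[THEN iffD1])
       (auto simp: bilinear_def matrix_vector_mult_add_rdistrib scaleR_matrix_vector_assoc intro!: linearI matrix_vector_mul_linear)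
  obtain K where K: "K > 0" "\<And>A x. norm (A *v x :: real^'n) \<le> norm A * norm (x :: real^'n) * K"
    using bounded_bilinear.pos_bounded[OF bl] by blast
  have "open O'"
    unfolding open_dist
  proof
    fix B assume "B \<in> O'"
    then obtain T \<epsilon> where T: "subspace T" "k \<le> dim T" "\<epsilon> > 0" "\<And>x. x \<in> T \<Longrightarrow> (c + \<epsilon>) * (x \<bullet> x) \<le> x \<bullet> (B *v x)"
      by (auto simp: O'_def)
    \<comment> \<open>\<open>K\<close> bounds the product of a matrix with a vector, so this radius
      changes the quadratic form by at most \<open>\<epsilon> / 2 * (x \<bullet> x)\<close>.\<close>
    have "B' \<in> O'" if B': "dist B' B < \<epsilon> / (2 * K)" for B'
    proof -
      have "(c + \<epsilon> / 2) * (x \<bullet> x) \<le> x \<bullet> (B' *v x)" if "x \<in> T" for x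
      proof -
        have "\<bar>x \<bullet> ((B' - B) *v x)\<bar> \<le> norm x * norm ((B' - B) *v x)" by (rule Cauchy_Schwarz_ineq2)
        also have "\<dots> \<le> norm x * ((\<epsilon> / (2 * K)) * norm x * K)"
          using B' K(1) by (intro mult_left_mono order.trans[OF K(2)] mult_right_mono) (auto simp: dist_norm)
        also have "\<dots> = \<epsilon> / 2 * (x \<bullet> x)" using K(1) by (simp add: dot_square_norm power2_eq_square)
        finally have "\<bar>x \<bullet> (B' *v x) - x \<bullet> (B *v x)\<bar> \<le> \<epsilon> / 2 * (x \<bullet> x)"
          by (simp add: matrix_vector_mult_diff_rdistrib inner_diff_right)
        then have "x \<bullet> (B' *v x) \<ge> x \<bullet> (B *v x) - \<epsilon> / 2 * (x \<bullet> x)"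
          by linarith
        then show ?thesis using T(4)[OF that] by (simp add: algebra_simps)
      qed
      then show ?thesis unfolding O'_def using T by (intro CollectI exI[of _ T] exI[of _ "\<epsilon> / 2"]) auto
    qed
    then show "\<exists>e>0. \<forall>B'. dist B' B < e \<longrightarrow> B' \<in> O'"
      using T(3) K(1) by (intro exI[of _ "\<epsilon> / (2 * K)"]) auto
  qed
  have "{\<omega> \<in> space M. c < nth_eigenvalue k (A \<omega>)} = A -` O' \<inter> space M"
    using nth_eigenvalue_greater_iff[OF sym k] by (auto simp: O'_def)
  also have "\<dots> \<in> sets M" using \<open>open O'\<close> by measurable
  finally show "{\<omega> \<in> space M. c < nth_eigenvalue k (A \<omega>)} \<in> sets M" .
qed

section \<open>Determinants under rank one updates\<close>

definition outer :: "real^'n \<Rightarrow> real^'n^'n" where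
  "outer x = (\<chi> i j. x $ i * x $ j)"

lemma outer_mult: "outer x *v y = (x \<bullet> y) *\<^sub>R x"
  by (simp add: outer_def vec_eq_iff matrix_vector_mult_def inner_vec_def sum_distrib_left sum_distrib_right mult_ac)

lemma transpose_outer [simp]: "transpose (outer x) = outer x"
  by (simp add: outer_def transpose_def vec_eq_iff mult.commute)

text \<open>An orthogonal map sending an arbitrary coordinate axis \<open>k\<close> to the direction
  of \<open>z\<close> turns the standard basis into an eigenbasis, with eigenvalue
  \<open>1 + z \<bullet> z\<close> for \<open>k\<close> and 1 for the others.\<close>

lemma det_identity_plus_outer: "det (mat 1 + outer z) = 1 + z \<bullet> z" for z :: "real^'n"
proof -
  define k :: 'n where "k = undefined"
  obtain f :: "real^'n \<Rightarrow> real^'n" where f: "orthogonal_transformation f" "f (norm z *\<^sub>R axis k 1) = z"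
    using orthogonal_transformation_exists[of "norm z *\<^sub>R axis k 1" z] by (auto simp: norm_axis_1)
  have fin: "f x \<bullet> f y = x \<bullet> y" for x y using f(1) by (simp add: orthogonal_transformation_def)
  have z: "z = norm z *\<^sub>R f (axis k 1)"
    using f orthogonal_transformation_scaleR by metis
  define d where "d i = (if i = k then 1 + z \<bullet> z else 1)" for i
  have ort: "f (axis i 1) \<bullet> f (axis j 1) = (if i = j then 1 else 0)" for i j
    by (simp add: fin inner_axis_axis)
  have "eigen_system (mat 1 + outer z) (\<lambda>i. f (axis i 1)) d"
    unfolding eigen_system_def
  proof (intro conjI allI ort)
    fix i
    have "z \<bullet> f (axis i 1) = norm z * (if k = i then 1 else 0)"
      by (subst z) (simp add: ort)
    moreover have "(norm z * norm z) *\<^sub>R f (axis k 1) = norm z *\<^sub>R z"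
      by (subst (4) z) simp
    ultimately show "(mat 1 + outer z) *v f (axis i 1) = d i *\<^sub>R f (axis i 1)"
      by (auto simp: matrix_vector_mult_add_rdistrib outer_mult d_def scaleR_add_left dot_square_norm power2_eq_square)
  qed
  from det_eigen_system(1)[OF this] show ?thesis by (simp add: d_def prod.delta)
qed

text \<open>A rank one update changes only one eigenvalue of \<open>B\<close> relative to \<open>B\<close> itself, so the growth
  of the quadratic form bounds the growth of the whole determinant.\<close>

lemma det_add_outer_le:
  fixes B :: "real^'n^'n"
  assumes sym: "transpose B = B" and pos: "\<And>a. a \<noteq> 0 \<Longrightarrow> a \<bullet> (B *v a) > 0"
    and le: "\<And>a. a \<bullet> (B *v a) + (x \<bullet> a)\<^sup>2 \<le> \<rho> * (a \<bullet> (B *v a))" and \<rho>: "1 \<le> \<rho>"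
  shows "det (B + outer x) \<le> \<rho> * det B"
proof -
  obtain e d where E: "eigen_system B e d" using eigen_system_exists[OF sym] .
  have ort: "e i \<bullet> e j = (if i = j then 1 else 0)" and eig: "B *v e i = d i *\<^sub>R e i" for i j
    using E by (auto simp: eigen_system_def)
  have d: "d i > 0" for i
  proof -
    have "e i \<noteq> 0" using ort[of i i] by auto
    from pos[OF this] show ?thesis by (simp add: eig ort)
  qed
  \<comment> \<open>The \<open>u i\<close> are orthonormal for the form \<open>B\<close>: in this
    basis \<open>B\<close> becomes the identity and the update becomes
    \<open>outer z\<close>.\<close>
  define u where "u i = (1 / sqrt (d i)) *\<^sub>R e i" for i
  define S where "S = (\<chi> i j. u j $ i)"
  define z where "z = (\<chi> i. x \<bullet> u i)"
  have conj: "transpose S ** (M ** S) = (\<chi> i j. u i \<bullet> (M *v u j))" for M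
    by (simp add: vec_eq_iff matrix_matrix_mult_def transpose_def S_def inner_vec_def matrix_vector_mult_def)
  have det_conj: "det (\<chi> i j. u i \<bullet> (M *v u j)) = (det S)\<^sup>2 * det M" for M
    unfolding conj[symmetric] by (simp add: det_mul power2_eq_square)
  have uBu: "u i \<bullet> (B *v u j) = (if i = j then 1 else 0)" for i j
    using d[of i] d[of j] by (auto simp: u_def matrix_vector_mult_scaleR eig ort)
  have 1: "(\<chi> i j. u i \<bullet> (B *v u j)) = mat 1"
    by (simp add: uBu mat_def vec_eq_iff)
  have 2: "(\<chi> i j. u i \<bullet> ((B + outer x) *v u j)) = mat 1 + outer z"
    by (simp add: vec_eq_iff matrix_vector_mult_add_rdistrib inner_add_right uBu mat_def outer_mult)
       (simp add: outer_def z_def inner_commute mult.commute)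
  have detS: "(det S)\<^sup>2 * det B = 1" using det_conj[of B] unfolding 1 by simp
  have "1 + z \<bullet> z \<le> \<rho>"
  proof (cases "z = 0")
    case False
    \<comment> \<open>The relative eigenvector that the update moves. Both
      \<open>x \<bullet> a\<close> and \<open>a \<bullet> (B *v a)\<close> equal
      \<open>z \<bullet> z\<close>, so \<open>le\<close> bounds its relative eigenvalue
      \<open>1 + z \<bullet> z\<close>.\<close>
    define a where "a = (\<Sum>i\<in>UNIV. (z $ i) *\<^sub>R u i)"
    have xa: "x \<bullet> a = z \<bullet> z"
      unfolding a_def by (simp add: inner_sum_right inner_vec_def[of z z]) (simp add: z_def)
    have "B *v a = (\<Sum>j\<in>UNIV. (z $ j) *\<^sub>R (B *v u j))"
      unfolding a_def by (simp add: linear_sum[OF matrix_vector_mul_linear] matrix_vector_mult_scaleR)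
    then have "a \<bullet> (B *v a) = (\<Sum>j\<in>UNIV. \<Sum>i\<in>UNIV. z $ j * (z $ i * (u i \<bullet> (B *v u j))))"
      unfolding a_def by (simp add: inner_sum_left inner_sum_right sum_distrib_left)
    also have "\<dots> = z \<bullet> z"
      by (simp add: uBu if_distrib[of "\<lambda>c. _ * c"] cong: if_cong) (simp add: inner_vec_def)
    finally have "z \<bullet> z + (z \<bullet> z)\<^sup>2 \<le> \<rho> * (z \<bullet> z)" using le[of a] xa by simp
    then have "(1 + z \<bullet> z) * (z \<bullet> z) \<le> \<rho> * (z \<bullet> z)" by (simp add: power2_eq_square algebra_simps)
    then show ?thesis using False by (simp add: mult_le_cancel_right)
  qed (simp add: \<rho>)
  then have "(det S)\<^sup>2 * det (B + outer x) \<le> \<rho> * ((det S)\<^sup>2 * det B)"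
    using det_conj[of "B + outer x"] unfolding 2 detS det_identity_plus_outer by simp
  moreover have "(det S)\<^sup>2 > 0" using detS by (cases "det S = 0") auto
  ultimately show ?thesis by (simp add: mult.left_commute)
qed

text \<open>After division by \<open>c\<close> all factors \<open>1 + d i / c\<close> of the
  determinant are at least 1, and at least \<open>k\<close> of them are at least
  \<open>1 + l / c\<close> for the \<open>k\<close>-th eigenvalue \<open>l\<close>; hence
  \<open>(1 + l / c) ^ k \<le> R\<close>.\<close>

lemma nth_eigenvalue_le_of_det:
  fixes A :: "real^'n^'n"
  assumes sym: "transpose A = A" and pos: "\<And>a. a \<bullet> (A *v a) \<ge> 0" and k: "k \<in> {1..CARD('n)}"
    and c: "c > 0" and R: "R > 0" and det: "det (A + c *\<^sub>R mat 1) \<le> R * c ^ CARD('n)"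
  shows "nth_eigenvalue k A \<le> R powr (1 / k) * c"
proof -
  obtain e d where E: "eigen_system A e d" using eigen_system_exists[OF sym] .
  have ort: "e i \<bullet> e j = (if i = j then 1 else 0)" and eig: "A *v e i = d i *\<^sub>R e i" for i j
    using E by (auto simp: eigen_system_def)
  have d: "d i \<ge> 0" for i using pos[of "e i"] by (simp add: eig ort)
  have "eigen_system (A + c *\<^sub>R mat 1) e (\<lambda>i. d i + c)"
    using E by (simp add: eigen_system_def matrix_vector_mult_add_rdistrib scaleR_add_left scaleR_matrix_vector_assoc[symmetric])
  then have det': "det (A + c *\<^sub>R mat 1) = (\<Prod>i\<in>UNIV. d i + c)" by (rule det_eigen_system)
  define l where "l = nth_eigenvalue k A"
  let ?J = "{j. l \<le> d j}"
  have J: "k \<le> card ?J" using nth_eigenvalue_iff[OF E k, of "\<lambda>y. l \<le> y"] by (auto simp: l_def)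
  have l: "l \<ge> 0" using nth_eigenvalue_iff[OF E k, of "\<lambda>y. 0 \<le> y"] d k by (simp add: l_def)
  have "1 + l / c \<ge> 1" using l c by simp
  then have "(1 + l / c) ^ k \<le> (1 + l / c) ^ card ?J" by (rule power_increasing[OF J])
  also have "\<dots> = (\<Prod>i\<in>?J. 1 + l / c)" by simp
  also have "\<dots> \<le> (\<Prod>i\<in>?J. 1 + d i / c)" using l c by (intro prod_mono) (auto intro: divide_right_mono)
  also have "\<dots> \<le> (\<Prod>i\<in>UNIV. 1 + d i / c)" using d c by (intro prod_mono2) auto
  also have "\<dots> = (\<Prod>i\<in>UNIV. (d i + c) / c)" using c by (simp add: add_divide_distrib add.commute)
  also have "\<dots> = (\<Prod>i\<in>UNIV. d i + c) / c ^ CARD('n)" by (simp add: prod_dividef)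
  also have "\<dots> \<le> R" using det det' c by (simp add: divide_le_eq)
  finally have "(1 + l / c) ^ k \<le> R" .
  moreover have "((1 + l / c) ^ k) powr (1 / k) = 1 + l / c"
    using k l c by (simp add: powr_realpow[symmetric] powr_powr add_pos_nonneg)
  ultimately have "1 + l / c \<le> R powr (1 / k)"
    using l c by (metis powr_mono2 zero_le_power add_nonneg_nonneg divide_nonneg_pos zero_le_one zero_le_divide_1_iff of_nat_0_le_iff)
  then have "l / c \<le> R powr (1 / k)" by simp
  then show ?thesis using c by (simp add: l_def divide_le_eq)
qed

section \<open>The uniform distribution on the Stiefel manifold\<close>

declare transpose_matrix_vector [simp del]

lemma inner_matrix_mult_left:
  fixes A :: "real^'b^'a" and B :: "real^'c^'b"
  shows "(A ** B) \<bullet> C = B \<bullet> (transpose A ** C)"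
proof -
  have "(A ** B) \<bullet> C = (\<Sum>i\<in>UNIV. \<Sum>j\<in>UNIV. \<Sum>k\<in>UNIV. A $ i $ k * B $ k $ j * C $ i $ j)"
    by (simp add: inner_vec_def matrix_matrix_mult_def sum_distrib_right)
  also have "\<dots> = (\<Sum>i\<in>UNIV. \<Sum>k\<in>UNIV. \<Sum>j\<in>UNIV. A $ i $ k * B $ k $ j * C $ i $ j)"
    by (intro sum.cong refl sum.swap)
  also have "\<dots> = (\<Sum>k\<in>UNIV. \<Sum>i\<in>UNIV. \<Sum>j\<in>UNIV. A $ i $ k * B $ k $ j * C $ i $ j)"
    by (rule sum.swap)
  also have "\<dots> = (\<Sum>k\<in>UNIV. \<Sum>j\<in>UNIV. \<Sum>i\<in>UNIV. A $ i $ k * B $ k $ j * C $ i $ j)"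
    by (intro sum.cong refl sum.swap)
  also have "\<dots> = B \<bullet> (transpose A ** C)"
    by (simp add: inner_vec_def matrix_matrix_mult_def transpose_def sum_distrib_left mult_ac)
  finally show ?thesis .
qed

lemma inner_matrix_vector_left:
  fixes A :: "real^'n^'m"
  shows "(A *v x) \<bullet> y = x \<bullet> (transpose A *v y)"
proof -
  have "(A *v x) \<bullet> y = (y v* A) \<bullet> x" unfolding dot_lmul_matrix by (rule inner_commute)
  then show ?thesis by (simp add: transpose_matrix_vector inner_commute)
qed

lemma Stiefel_inner:
  assumes "V \<in> Stiefel"
  shows "(V *v x) \<bullet> (V *v y) = x \<bullet> y"
  using assms by (simp add: inner_matrix_vector_left matrix_vector_mul_assoc Stiefel_def)

text \<open>The columns of the two frames are orthonormal families with the same index set, so some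
  orthogonal map carries one to the other.\<close>

lemma Stiefel_transitive:
  fixes V V' :: "real^'r^'d"
  assumes V: "V \<in> Stiefel" "V' \<in> Stiefel"
  shows "\<exists>Q. orthogonal_matrix Q \<and> Q ** V = V'"
proof -
  have "\<exists>f. orthogonal_transformation f \<and> (\<forall>i\<in>(UNIV :: 'r set). f (V *v axis i 1) = V' *v axis i 1)"
    by (rule orthonormal_families_transformation) (auto simp: Stiefel_inner[OF V(1)] Stiefel_inner[OF V(2)] inner_axis_axis)
  then obtain f where f: "orthogonal_transformation f" "\<And>i. f (V *v axis i 1) = V' *v axis i 1" by auto
  have "matrix f ** V = V'"
  proof -
    have "(matrix f ** V) *v axis i 1 = V' *v axis i 1" for i
      using f by (simp add: matrix_vector_mul_assoc[symmetric] matrix_works orthogonal_transformation_linear)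
    then show ?thesis
      by (simp add: matrix_vector_mult_basis column_def vec_eq_iff)
  qed
  then show ?thesis using f(1) orthogonal_transformation_matrix by blast
qed

lemma measurable_matrix_mult [measurable]:
  fixes A :: "'a \<Rightarrow> real^'b^'c" and B :: "'a \<Rightarrow> real^'e^'b"
  assumes [measurable]: "A \<in> borel_measurable M" "B \<in> borel_measurable M"
  shows "(\<lambda>x. A x ** B x) \<in> borel_measurable M"
  unfolding matrix_matrix_mult_def by (intro measurable_vec_lambdaI) measurable

lemma measurable_matrix_vector_mult [measurable]:
  fixes A :: "'a \<Rightarrow> real^'b^'c"
  assumes [measurable]: "A \<in> borel_measurable M" "B \<in> borel_measurable M"
  shows "(\<lambda>x. A x *v B x) \<in> borel_measurable M"
  unfolding matrix_vector_mult_def by (intro measurable_vec_lambdaI) measurable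

lemma measurable_transpose [measurable]:
  fixes A :: "'a \<Rightarrow> real^'b^'c"
  assumes [measurable]: "A \<in> borel_measurable M"
  shows "(\<lambda>x. transpose (A x)) \<in> borel_measurable M"
  unfolding transpose_def by (intro measurable_vec_lambdaI) measurable

text \<open>Left multiplication by an orthogonal matrix is an isometry of the Euclidean norm on
  matrices, and these maps act transitively on the Stiefel manifold.\<close>

lemma uniform_Stiefel_unique:
  fixes \<mu> \<nu> :: "(real^'r^'d) measure"
  assumes \<mu>: "uniform_Stiefel \<mu>" and \<nu>: "uniform_Stiefel \<nu>"
  shows "\<mu> = \<nu>"
proof (rule invariant_measure_unique[where S=Stiefel])
  fix x y :: "real^'r^'d" assume "x \<in> Stiefel" "y \<in> Stiefel"
  then obtain Q where Q: "orthogonal_matrix Q" "Q ** x = y" using Stiefel_transitive by blast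
  have "dist (Q ** a) (Q ** b) = dist a b" for a b :: "real^'r^'d"
  proof -
    have "(Q ** (a - b)) \<bullet> (Q ** (a - b)) = (a - b) \<bullet> (a - b)"
      using Q(1) by (simp add: inner_matrix_mult_left matrix_mul_assoc orthogonal_matrix_def)
    moreover have "Q ** (a - b) = Q ** a - Q ** b"
      by (simp add: vec_eq_iff matrix_matrix_mult_def right_diff_distrib sum_subtractf)
    ultimately show ?thesis by (simp add: dist_norm norm_eq_sqrt_inner)
  qed
  then show "\<exists>f. f x = y \<and> (\<forall>a b. dist (f a) (f b) = dist a b) \<and> distr \<mu> borel f = \<mu> \<and> distr \<nu> borel f = \<nu>"
    using Q \<mu> \<nu> by (intro exI[of _ "(**) Q"]) (auto simp: uniform_Stiefel_def)
qed (use \<mu> \<nu> in \<open>auto simp: uniform_Stiefel_def\<close>)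

text \<open>The projection onto the orthogonal complement of \<open>{V c | c \<bullet> b = 0}\<close>, and the frame
  obtained from \<open>V\<close> by replacing \<open>V b\<close> by the normalized projection of \<open>x\<close>.\<close>

definition compl_proj :: "real^'r \<Rightarrow> real^'r^'d \<Rightarrow> real^'d \<Rightarrow> real^'d" where
  "compl_proj b V x = x - V *v (transpose V *v x) + ((V *v b) \<bullet> x) *\<^sub>R (V *v b)"

definition replace_dir :: "real^'r \<Rightarrow> real^'r^'d \<Rightarrow> real^'d \<Rightarrow> real^'r^'d" where
  "replace_dir b V x = (\<chi> i j. V $ i $ j + (compl_proj b V x /\<^sub>R norm (compl_proj b V x) - V *v b) $ i * b $ j)"

lemma measurable_compl_proj [measurable]:
  assumes [measurable]: "V \<in> borel_measurable M" "X \<in> borel_measurable M"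
  shows "(\<lambda>x. compl_proj b (V x) (X x)) \<in> borel_measurable M"
  unfolding compl_proj_def by measurable

lemma measurable_replace_dir [measurable]:
  assumes [measurable]: "V \<in> borel_measurable M" "X \<in> borel_measurable M"
  shows "(\<lambda>x. replace_dir b (V x) (X x)) \<in> borel_measurable M"
  unfolding replace_dir_def by (intro measurable_vec_lambdaI) measurable

lemma replace_dir_mult:
  "replace_dir b V x *v c = V *v c + (b \<bullet> c) *\<^sub>R (compl_proj b V x /\<^sub>R norm (compl_proj b V x) - V *v b)"
proof -
  have "(\<chi> i j. V $ i $ j + w $ i * b $ j) *v c = V *v c + (b \<bullet> c) *\<^sub>R w" for w
    by (simp add: vec_eq_iff matrix_vector_mult_def inner_vec_def distrib_left distrib_right sum.distrib sum_distrib_left sum_distrib_right mult_ac)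
  then show ?thesis unfolding replace_dir_def .
qed

lemma linear_compl_proj: "linear (compl_proj b V)"
  unfolding compl_proj_def
  by (intro linearI) (simp_all add: matrix_vector_right_distrib matrix_vector_mult_scaleR inner_add_right algebra_simps)

lemma compl_proj_adjoint: "compl_proj b V x \<bullet> y = x \<bullet> compl_proj b V y"
proof -
  have *: "compl_proj b V x \<bullet> y = x \<bullet> y - (transpose V *v x) \<bullet> (transpose V *v y) + ((V *v b) \<bullet> x) * ((V *v b) \<bullet> y)" for x y
    by (simp add: compl_proj_def inner_diff_left inner_add_left inner_matrix_vector_left[of V "transpose V *v x"])
  show ?thesis
    unfolding inner_commute[of x] * by (simp only: inner_commute mult.commute)
qed

context
  fixes b :: "real^'r" and V :: "real^'r^'d"
  assumes b: "norm b = 1" and V: "V \<in> Stiefel"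
begin

lemma unit_inner_self: "b \<bullet> b = 1" using b by (simp add: dot_square_norm)

lemma transpose_compl_proj: "transpose V *v compl_proj b V x = ((V *v b) \<bullet> x) *\<^sub>R b"
proof -
  have "transpose V *v (V *v y) = y" for y
    using V by (simp add: matrix_vector_mul_assoc Stiefel_def)
  then show ?thesis
    by (simp add: compl_proj_def matrix_vector_right_distrib matrix_vector_mult_diff_distrib matrix_vector_mult_scaleR)
qed

lemma inner_compl_proj: "(V *v c) \<bullet> compl_proj b V x = (c \<bullet> b) * ((V *v b) \<bullet> x)"
  by (simp add: inner_matrix_vector_left transpose_compl_proj)

lemma compl_proj_idem: "compl_proj b V (compl_proj b V x) = compl_proj b V x"
  by (subst compl_proj_def) (simp add: transpose_compl_proj inner_compl_proj unit_inner_self matrix_vector_mult_scaleR)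

lemma norm_compl_proj_le: "norm (compl_proj b V x) \<le> norm x"
proof -
  have "(norm (compl_proj b V x))\<^sup>2 = x \<bullet> compl_proj b V x"
    by (simp add: power2_norm_eq_inner compl_proj_adjoint compl_proj_idem)
  also have "\<dots> \<le> norm x * norm (compl_proj b V x)" by (rule norm_cauchy_schwarz)
  finally show ?thesis
    by (cases "compl_proj b V x = 0") (auto simp: power2_eq_square)
qed

text \<open>The new direction \<open>?w\<close> is a unit vector orthogonal to all
  \<open>V c\<close> with \<open>c \<bullet> b = 0\<close>, so it can take the place of
  \<open>V b\<close>.\<close>

lemma replace_dir_Stiefel:
  assumes nz: "compl_proj b V x \<noteq> 0"
  shows "replace_dir b V x \<in> Stiefel"
proof -
  let ?w = "compl_proj b V x /\<^sub>R norm (compl_proj b V x)"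
  \<comment> \<open>The cosine of the angle between the old and the new direction; it cancels in the
    inner products of the new frame.\<close>
  define \<kappa> where "\<kappa> = ((V *v b) \<bullet> x) / norm (compl_proj b V x)"
  have w: "?w \<bullet> ?w = 1" using nz by (simp add: dot_square_norm power2_eq_square)
  have Vw: "(V *v c) \<bullet> ?w = (c \<bullet> b) * \<kappa>" for c
    by (simp add: inner_compl_proj \<kappa>_def divide_inverse mult_ac)
  have ws: "(V *v c) \<bullet> (?w - V *v b) = (c \<bullet> b) * (\<kappa> - 1)" for c
    unfolding inner_diff_right Vw Stiefel_inner[OF V] by (simp add: right_diff_distrib)
  have ss: "(?w - V *v b) \<bullet> (?w - V *v b) = 2 - 2 * \<kappa>"
    using w Vw[of b] by (simp only: inner_diff_left inner_diff_right Stiefel_inner[OF V] unit_inner_self inner_commute[of "V *v b" ?w])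
  have "(replace_dir b V x *v c) \<bullet> (replace_dir b V x *v c') = c \<bullet> c'" for c c'
    unfolding replace_dir_mult inner_add_left inner_add_right inner_scaleR_left inner_scaleR_right ws ss
      inner_commute[of "?w - V *v b" "V *v c'"] Stiefel_inner[OF V]
    by (simp add: inner_commute[of c b] inner_commute[of c' b] algebra_simps)
  then have *: "c \<bullet> ((transpose (replace_dir b V x) ** replace_dir b V x) *v c') = c \<bullet> c'" for c c'
    by (simp add: inner_matrix_vector_left matrix_vector_mul_assoc)
  then have "(transpose (replace_dir b V x) ** replace_dir b V x) *v c' = mat 1 *v c'" for c'
    using vector_eq_ldot by simp blast
  then have "transpose (replace_dir b V x) ** replace_dir b V x = mat 1"
    using matrix_eq by blast
  then show ?thesis by (simp add: Stiefel_def)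
qed

end

lemma orthogonal_matrix_inner:
  fixes Q :: "real^'n^'n"
  shows "orthogonal_matrix Q \<Longrightarrow> (Q *v x) \<bullet> (Q *v y) = x \<bullet> y"
  by (simp add: inner_matrix_vector_left matrix_vector_mul_assoc orthogonal_matrix_def)

lemma compl_proj_orthogonal:
  assumes "orthogonal_matrix Q"
  shows "compl_proj b (Q ** V) (Q *v x) = Q *v compl_proj b V x"
proof -
  have "transpose Q *v (Q *v x) = x"
    using assms by (simp add: matrix_vector_mul_assoc orthogonal_matrix_def)
  then have "transpose (Q ** V) *v (Q *v x) = transpose V *v x"
    by (simp add: matrix_transpose_mul matrix_vector_mul_assoc[symmetric])
  moreover have "((Q ** V) *v b) \<bullet> (Q *v x) = (V *v b) \<bullet> x"
    by (simp add: matrix_vector_mul_assoc[symmetric] orthogonal_matrix_inner[OF assms])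
  ultimately show ?thesis
    by (simp add: compl_proj_def matrix_vector_mul_assoc[symmetric] matrix_vector_right_distrib matrix_vector_mult_diff_distrib matrix_vector_mult_scaleR)
qed

lemma replace_dir_orthogonal:
  assumes Q: "orthogonal_matrix Q"
  shows "replace_dir b (Q ** V) (Q *v x) = Q ** replace_dir b V x"
proof -
  have n: "norm (Q *v y) = norm y" for y
    unfolding norm_eq_sqrt_inner orthogonal_matrix_inner[OF Q] ..
  have "replace_dir b (Q ** V) (Q *v x) *v c = (Q ** replace_dir b V x) *v c" for c
    unfolding replace_dir_mult matrix_vector_mul_assoc[symmetric] compl_proj_orthogonal[OF Q] n
      matrix_vector_right_distrib matrix_vector_mult_diff_distrib matrix_vector_mult_scaleR ..
  then show ?thesis using matrix_eq by blast
qed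

text \<open>The construction is equivariant and the weight \<open>w\<close> is invariant under
  rotations, so the weighted law of the new frame is rotation invariant, and uniqueness identifies
  it with \<open>\<mu>\<close>. Admitting a weight is what later separates the direction of the
  Gaussian vector from its radius.\<close>

lemma replace_dir_law:
  fixes \<mu> :: "(real^'r^'d) measure"
  assumes \<mu>: "uniform_Stiefel \<mu>" and b: "norm b = 1"
    and w [measurable]: "(\<lambda>(V, x). w V x) \<in> borel_measurable (borel \<Otimes>\<^sub>M borel)"
    and inv: "\<And>Q V x. orthogonal_matrix Q \<Longrightarrow> w (Q ** V) (Q *v x) = w V x"
    and one: "(\<integral>\<^sup>+V. (\<integral>\<^sup>+x. w V x \<partial>std_gauss) \<partial>\<mu>) = 1"
    and f [measurable]: "f \<in> borel_measurable borel"
  shows "(\<integral>\<^sup>+V. (\<integral>\<^sup>+x. w V x * f (replace_dir b V x) \<partial>std_gauss) \<partial>\<mu>) = (\<integral>\<^sup>+V. f V \<partial>\<mu>)"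
proof -
  interpret G: prob_space "std_gauss :: (real^'d) measure" by (rule prob_space_std_gauss)
  interpret M: prob_space \<mu> using \<mu> by (simp add: uniform_Stiefel_def)
  interpret MG: pair_sigma_finite \<mu> "std_gauss :: (real^'d) measure" ..
  have sets [measurable_cong]: "sets \<mu> = sets borel" using \<mu> by (simp add: uniform_Stiefel_def)
  have w' [measurable]: "(\<lambda>\<omega>. w (g \<omega>) (h \<omega>)) \<in> borel_measurable N"
    if "g \<in> borel_measurable N" "h \<in> borel_measurable N" for g h and N :: "'x measure"
    using measurable_compose[OF measurable_Pair[OF that] w] by simp
  define D where "D = density (\<mu> \<Otimes>\<^sub>M std_gauss) (\<lambda>(V, x). w V x)"
  define \<nu> where "\<nu> = distr D borel (\<lambda>(V, x). replace_dir b V x)"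
  have setsD [measurable_cong]: "sets D = sets (borel \<Otimes>\<^sub>M borel)"
    unfolding D_def sets_density by (intro sets_pair_measure_cong sets sets_std_gauss)
  have \<nu>: "(\<integral>\<^sup>+V. f V \<partial>\<nu>) = (\<integral>\<^sup>+V. (\<integral>\<^sup>+x. w V x * f (replace_dir b V x) \<partial>std_gauss) \<partial>\<mu>)"
    if [measurable]: "f \<in> borel_measurable borel" for f
    unfolding \<nu>_def D_def
    by (subst nn_integral_distr, measurable, subst nn_integral_density, measurable,
        subst G.nn_integral_fst[symmetric]) (auto simp: case_prod_beta)
  have pg: "std_gauss = distr std_gauss borel (\<lambda>x. Q *v x)" if "orthogonal_matrix Q" for Q :: "real^'d^'d"
    by (rule std_gauss_orthogonal_transformation[symmetric])
       (simp add: orthogonal_transformation_def orthogonal_matrix_inner[OF that])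
  have pm: "\<mu> = distr \<mu> borel (\<lambda>V. Q ** V)" if "orthogonal_matrix Q" for Q
    using \<mu> that by (simp add: uniform_Stiefel_def)
  have "uniform_Stiefel \<nu>"
    unfolding uniform_Stiefel_def
  proof (intro conjI allI impI)
    show "prob_space \<nu>"
    proof
      have "emeasure \<nu> (space \<nu>) = (\<integral>\<^sup>+V. 1 \<partial>\<nu>)" by simp
      also have "\<dots> = 1" by (subst \<nu>) (auto simp: one)
      finally show "emeasure \<nu> (space \<nu>) = 1" .
    qed
    show "sets \<nu> = sets borel" by (simp add: \<nu>_def)
    show "AE V in \<nu>. V \<in> Stiefel"
    proof -
      have S: "Stiefel \<in> sets (borel :: (real^'r^'d) measure)"
      proof -
        have "(\<lambda>V :: real^'r^'d. transpose V ** V) -` {mat 1} \<inter> space borel \<in> sets borel"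
          by measurable
        then show ?thesis by (simp add: Stiefel_def vimage_def)
      qed
      have "(\<integral>\<^sup>+V. indicator (- Stiefel) V \<partial>\<nu>) = (\<integral>\<^sup>+V. (\<integral>\<^sup>+x. w V x * indicator (- Stiefel) (replace_dir b V x) \<partial>std_gauss) \<partial>\<mu>)"
        using S by (intro \<nu>) auto
      also have "\<dots> = (\<integral>\<^sup>+V. 0 \<partial>\<mu>)"
      proof (rule nn_integral_cong_AE)
        have "AE V in \<mu>. V \<in> Stiefel" using \<mu> by (simp add: uniform_Stiefel_def)
        then show "AE V in \<mu>. (\<integral>\<^sup>+x. w V x * indicator (- Stiefel) (replace_dir b V x) \<partial>std_gauss) = 0"
        proof eventually_elim
          case (elim V)
          \<comment> \<open>The replacement fails only if the projection of \<open>x\<close>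
            vanishes, which forces \<open>x \<bullet> (V *v b) = 0\<close>; a normal variable has no
            atom at 0.\<close>
          have u: "(V *v b) \<bullet> (V *v b) = 1" using Stiefel_inner[OF elim, of b b] b by (simp add: dot_square_norm)
          have "(\<integral>\<^sup>+x. indicator {0} (x \<bullet> (V *v b)) \<partial>std_gauss) = (\<integral>\<^sup>+y. indicator {0::real} y \<partial>density lborel std_normal_density)"
            using nn_integral_std_gauss_orthonormal[of "{()}" "\<lambda>_. V *v b" "\<lambda>_. indicator {0}"] u by simp
          also have "\<dots> = 0"
            by (simp add: emeasure_density nn_integral_indicator_singleton)
          finally have "AE x in std_gauss. indicator {0} (x \<bullet> (V *v b)) = (0::ennreal)"
            by (subst (asm) nn_integral_0_iff_AE) auto
          then have "AE x in std_gauss. replace_dir b V x \<in> Stiefel"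
          proof eventually_elim
            case (elim x)
            have "x \<bullet> (V *v b) \<noteq> 0" using elim by (auto simp: indicator_def split: if_splits)
            then have "compl_proj b V x \<noteq> 0"
              using inner_compl_proj[OF b \<open>V \<in> Stiefel\<close>, of b x] unit_inner_self[OF b \<open>V \<in> Stiefel\<close>] by (auto simp: inner_commute)
            then show ?case by (rule replace_dir_Stiefel[OF b \<open>V \<in> Stiefel\<close>])
          qed
          then have "AE x in std_gauss. w V x * indicator (- Stiefel) (replace_dir b V x) = 0"
            by eventually_elim (simp add: indicator_def)
          then show ?case by (subst nn_integral_cong_AE) auto
        qed
      qed
      finally have "emeasure \<nu> (- Stiefel) = 0" using S by (simp add: \<nu>_def)
      then show ?thesis using S by (intro AE_I[of _ _ "- Stiefel"]) (auto simp: \<nu>_def)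
    qed
    fix Q :: "real^'d^'d" assume Q: "orthogonal_matrix Q"
    show "distr \<nu> borel ((**) Q) = \<nu>"
    proof (rule measure_eqI)
      fix A assume "A \<in> sets (distr \<nu> borel ((**) Q))"
      then have A [measurable]: "A \<in> sets borel" by simp
      have [measurable]: "(**) Q \<in> borel_measurable (borel :: (real^'r^'d) measure)" by measurable
      have [measurable_cong]: "sets \<nu> = sets borel" by (simp add: \<nu>_def)
      have "emeasure (distr \<nu> borel ((**) Q)) A = (\<integral>\<^sup>+V. indicator A V \<partial>distr \<nu> borel ((**) Q))" by simp
      also have "\<dots> = (\<integral>\<^sup>+V. indicator A (Q ** V) \<partial>\<nu>)"
        by (subst nn_integral_distr) auto
      also have "\<dots> = (\<integral>\<^sup>+V. (\<integral>\<^sup>+x. w V x * indicator A (Q ** replace_dir b V x) \<partial>std_gauss) \<partial>\<mu>)"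
        by (rule \<nu>) measurable
      also have "\<dots> = (\<integral>\<^sup>+V. (\<integral>\<^sup>+x. w (Q ** V) (Q *v x) * indicator A (replace_dir b (Q ** V) (Q *v x)) \<partial>std_gauss) \<partial>\<mu>)"
        by (simp only: inv[OF Q] replace_dir_orthogonal[OF Q])
      also have "\<dots> = (\<integral>\<^sup>+V. (\<integral>\<^sup>+x. w (Q ** V) x * indicator A (replace_dir b (Q ** V) x) \<partial>distr std_gauss borel (\<lambda>x. Q *v x)) \<partial>\<mu>)"
      proof (intro nn_integral_cong)
        fix V
        have "(\<lambda>x. w (Q ** V) x * indicator A (replace_dir b (Q ** V) x)) \<in> borel_measurable borel"
          by measurable
        moreover have "(\<lambda>x. Q *v x) \<in> std_gauss \<rightarrow>\<^sub>M borel" by measurable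
        ultimately show "(\<integral>\<^sup>+x. w (Q ** V) (Q *v x) * indicator A (replace_dir b (Q ** V) (Q *v x)) \<partial>std_gauss)
          = (\<integral>\<^sup>+x. w (Q ** V) x * indicator A (replace_dir b (Q ** V) x) \<partial>distr std_gauss borel (\<lambda>x. Q *v x))"
          by (simp add: nn_integral_distr)
      qed
      also have "\<dots> = (\<integral>\<^sup>+V. (\<integral>\<^sup>+x. w (Q ** V) x * indicator A (replace_dir b (Q ** V) x) \<partial>std_gauss) \<partial>\<mu>)"
        by (simp only: pg[OF Q, symmetric])
      also have "\<dots> = (\<integral>\<^sup>+V. (\<integral>\<^sup>+x. w V x * indicator A (replace_dir b V x) \<partial>std_gauss) \<partial>distr \<mu> borel (\<lambda>V. Q ** V))"
      proof -
        have "(\<lambda>V. \<integral>\<^sup>+x. w V x * indicator A (replace_dir b V x) \<partial>std_gauss) \<in> borel_measurable borel"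
          by measurable
        moreover have "(\<lambda>V. Q ** V) \<in> \<mu> \<rightarrow>\<^sub>M borel" by measurable
        ultimately show ?thesis by (simp add: nn_integral_distr)
      qed
      also have "\<dots> = (\<integral>\<^sup>+V. indicator A V \<partial>\<nu>)"
        unfolding pm[OF Q, symmetric] by (rule \<nu>[symmetric]) simp
      also have "\<dots> = emeasure \<nu> A" by (simp add: \<nu>_def)
      finally show "emeasure (distr \<nu> borel ((**) Q)) A = emeasure \<nu> A" .
    qed (simp add: \<nu>_def)
  qed
  then have "\<nu> = \<mu>" by (rule uniform_Stiefel_unique[OF _ \<mu>])
  with \<nu>[OF f] show ?thesis by simp
qed

section \<open>Exponential moments of squared overlaps with a uniform direction\<close>

lemma nn_integral_std_normal_exp_square:
  assumes t: "t < 1 / 2"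
  shows "(\<integral>\<^sup>+y. ennreal (exp (t * y\<^sup>2)) \<partial>density lborel std_normal_density) = ennreal (1 / sqrt (1 - 2 * t))"
proof -
  let ?s = "1 / sqrt (1 - 2 * t)"
  have s: "?s > 0" "?s\<^sup>2 = 1 / (1 - 2 * t)" using t by (simp_all add: power_divide)
  interpret N: prob_space "density lborel (normal_density 0 ?s)"
    using s(1) by (rule prob_space_normal_density)
  \<comment> \<open>The exponential factor lowers the precision from 1 to \<open>1 - 2 * t\<close>,
    leaving a multiple of the normal density with standard deviation \<open>?s\<close>.\<close>
  have eq: "std_normal_density y * exp (t * y\<^sup>2) = ?s * normal_density 0 ?s y" for y
  proof -
    have "exp (- y\<^sup>2 / 2) * exp (t * y\<^sup>2) = exp (- (y\<^sup>2 * (1 - 2 * t)) / 2)"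
      by (simp add: exp_add[symmetric] algebra_simps)
    moreover have "sqrt (2 * pi * ?s\<^sup>2) = sqrt (2 * pi) * ?s"
      using s(1) by (simp add: real_sqrt_mult)
    ultimately show ?thesis
      using s t by (simp add: std_normal_density_def normal_density_def)
  qed
  have "(\<integral>\<^sup>+y. ennreal (exp (t * y\<^sup>2)) \<partial>density lborel std_normal_density)
    = (\<integral>\<^sup>+y. ennreal ?s * ennreal (normal_density 0 ?s y) \<partial>lborel)"
    using s(1) by (subst nn_integral_density) (auto simp: eq simp flip: ennreal_mult'' intro!: nn_integral_cong)
  also have "\<dots> = ennreal ?s * emeasure (density lborel (normal_density 0 ?s)) UNIV"
    by (simp add: nn_integral_cmult emeasure_density)
  also have "\<dots> = ennreal ?s" using N.emeasure_space_1 by simp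
  finally show ?thesis .
qed

lemma nn_integral_std_normal_square:
  "(\<integral>\<^sup>+y. ennreal (y\<^sup>2) \<partial>density lborel std_normal_density) = 1"
proof -
  have "has_bochner_integral lborel (\<lambda>x. std_normal_density x * x\<^sup>2) 1"
    using std_normal_moment_even[of 1] by (simp add: fact_numeral)
  then have "(\<integral>\<^sup>+y. ennreal (std_normal_density y * y\<^sup>2) \<partial>lborel) = ennreal 1"
    by (subst nn_integral_eq_integral) (auto simp: has_bochner_integral_iff)
  then show ?thesis
    by (subst nn_integral_density) (auto simp: ennreal_mult')
qed

lemma nn_integral_std_gauss_inner_square:
  fixes a :: "'a::euclidean_space"
  assumes "norm a = 1"
  shows "(\<integral>\<^sup>+x. ennreal ((x \<bullet> a)\<^sup>2) \<partial>std_gauss) = 1"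
  using nn_integral_std_gauss_orthonormal[of "{()}" "\<lambda>_. a" "\<lambda>_ y. ennreal (y\<^sup>2)"] assms
  by (simp add: nn_integral_std_normal_square dot_square_norm)

text \<open>The expected squared norm is the rank \<open>d - r + 1\<close> of the projection: by
  Pythagoras it is a signed sum of squares of standard normals. The negative terms are kept on the
  other side because the integrals are extended nonnegative reals.\<close>

lemma nn_integral_compl_proj_square:
  fixes V :: "real^'r^'d"
  assumes V: "V \<in> Stiefel" and b: "norm b = 1"
  shows "(\<integral>\<^sup>+x. ennreal ((norm (compl_proj b V x))\<^sup>2) \<partial>std_gauss) + ennreal (CARD('r)) = ennreal (CARD('d) + 1)"
proof -
  have n1: "norm (V *v c) = norm c" for c
    using Stiefel_inner[OF V, of c c] by (simp add: norm_eq_sqrt_inner)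
  have eq: "(norm (compl_proj b V x))\<^sup>2 + (\<Sum>j\<in>UNIV. (x \<bullet> (V *v axis j 1))\<^sup>2) = (\<Sum>i\<in>UNIV. (x \<bullet> axis i 1)\<^sup>2) + (x \<bullet> (V *v b))\<^sup>2" for x
  proof -
    have "(norm (compl_proj b V x))\<^sup>2 = compl_proj b V x \<bullet> x"
      by (simp add: power2_norm_eq_inner compl_proj_adjoint compl_proj_idem[OF b V])
    also have "\<dots> = x \<bullet> x - (transpose V *v x) \<bullet> (transpose V *v x) + (x \<bullet> (V *v b))\<^sup>2"
      using inner_commute[of x "V *v b"]
      by (simp add: compl_proj_def inner_diff_left inner_add_left inner_matrix_vector_left[of V "transpose V *v x"] power2_eq_square)
    also have "(transpose V *v x) \<bullet> (transpose V *v x) = (\<Sum>j\<in>UNIV. (x \<bullet> (V *v axis j 1))\<^sup>2)"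
    proof -
      have "(transpose V *v x) $ j = x \<bullet> (V *v axis j 1)" for j
        using inner_matrix_vector_left[of V "axis j 1" x] by (simp add: inner_axis' inner_commute)
      then show ?thesis by (simp add: inner_vec_def power2_eq_square)
    qed
    finally show ?thesis
      by (simp add: inner_vec_def[of x x] inner_axis power2_eq_square)
  qed
  have "(\<integral>\<^sup>+x. ennreal ((norm (compl_proj b V x))\<^sup>2) \<partial>std_gauss) + ennreal (CARD('r))
    = (\<integral>\<^sup>+x. ennreal ((norm (compl_proj b V x))\<^sup>2) \<partial>std_gauss) + (\<Sum>j\<in>UNIV. (\<integral>\<^sup>+x. ennreal ((x \<bullet> (V *v axis j 1))\<^sup>2) \<partial>std_gauss))"
    by (simp add: nn_integral_std_gauss_inner_square n1 norm_axis_1 ennreal_of_nat_eq_real_of_nat)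
  also have "\<dots> = (\<integral>\<^sup>+x. ennreal ((norm (compl_proj b V x))\<^sup>2) + (\<Sum>j\<in>UNIV. ennreal ((x \<bullet> (V *v axis j 1))\<^sup>2)) \<partial>std_gauss)"
    by (simp add: nn_integral_add nn_integral_sum del: sum_ennreal)
  also have "\<dots> = (\<integral>\<^sup>+x. (\<Sum>i\<in>UNIV. ennreal ((x \<bullet> axis i 1)\<^sup>2)) + ennreal ((x \<bullet> (V *v b))\<^sup>2) \<partial>std_gauss)"
  proof (intro nn_integral_cong)
    fix x show "ennreal ((norm (compl_proj b V x))\<^sup>2) + (\<Sum>j\<in>UNIV. ennreal ((x \<bullet> (V *v axis j 1))\<^sup>2)) = (\<Sum>i\<in>UNIV. ennreal ((x \<bullet> axis i 1)\<^sup>2)) + ennreal ((x \<bullet> (V *v b))\<^sup>2)"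
      using arg_cong[OF eq[of x], of ennreal] by (simp add: sum_ennreal ennreal_plus sum_nonneg del: ennreal_plus flip: ennreal_plus)
  qed
  also have "\<dots> = (\<Sum>i\<in>UNIV. (\<integral>\<^sup>+x. ennreal ((x \<bullet> axis i 1)\<^sup>2) \<partial>(std_gauss :: (real^'d) measure))) + (\<integral>\<^sup>+x. ennreal ((x \<bullet> (V *v b))\<^sup>2) \<partial>(std_gauss :: (real^'d) measure))"
    by (simp add: nn_integral_add nn_integral_sum del: sum_ennreal)
  also have "\<dots> = ennreal (CARD('d) + 1)"
    by (simp add: nn_integral_std_gauss_inner_square n1 norm_axis_1 b ennreal_of_nat_eq_real_of_nat)
  finally show ?thesis .
qed

text \<open>Linearize the square: \<open>exp (t |y|\<^sup>2)\<close> is the Gaussian average of \<open>exp (sqrt (2 t) \<xi> \<bullet> y)\<close>.\<close>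

lemma nn_integral_exp_contraction_square_le:
  fixes v :: "'i \<Rightarrow> 'a::euclidean_space" and p :: "'a \<Rightarrow> 'a"
  assumes I: "finite I" and v: "\<And>i j. i \<in> I \<Longrightarrow> j \<in> I \<Longrightarrow> v i \<bullet> v j = (if i = j then 1 else 0)"
    and lin: "linear p" and adj: "\<And>x y. p x \<bullet> y = x \<bullet> p y" and contr: "\<And>x. norm (p x) \<le> norm x"
    and t: "0 \<le> t" "t < 1 / 2"
  shows "(\<integral>\<^sup>+x. ennreal (exp (t * (\<Sum>i\<in>I. (v i \<bullet> p x)\<^sup>2))) \<partial>std_gauss) \<le> ennreal ((1 / sqrt (1 - 2 * t)) ^ card I)"
proof -
  interpret G: prob_space "std_gauss :: 'a measure" by (rule prob_space_std_gauss)
  interpret GG: pair_sigma_finite "std_gauss :: 'a measure" "std_gauss :: 'a measure" ..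
  have [measurable]: "p \<in> borel_measurable borel"
    using lin by (rule borel_measurable_linear)
  define S where "S x = (\<Sum>i\<in>I. (v i \<bullet> x) *\<^sub>R v i)" for x
  have S: "S x \<bullet> S x = (\<Sum>i\<in>I. (v i \<bullet> x)\<^sup>2)" for x
    unfolding S_def using I
    by (simp add: inner_sum_left inner_sum_right v power2_eq_square if_distrib[of "\<lambda>c. _ * c"] sum.delta cong: sum.cong if_cong)
  have Sadj: "\<xi> \<bullet> S (p x) = x \<bullet> p (S \<xi>)" for \<xi> x
  proof -
    have "\<xi> \<bullet> S (p x) = S \<xi> \<bullet> p x"
      by (simp add: S_def inner_sum_left inner_sum_right inner_commute mult.commute)
    then show ?thesis using adj[of "S \<xi>" x] by (simp add: inner_commute)
  qed
  have [measurable]: "S \<in> borel_measurable borel" unfolding S_def by measurable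
  have sq: "((sqrt (2 * t) *\<^sub>R y) \<bullet> (sqrt (2 * t) *\<^sub>R y)) / 2 = t * (y \<bullet> y)" for y :: 'a
  proof -
    have "((sqrt (2 * t) *\<^sub>R y) \<bullet> (sqrt (2 * t) *\<^sub>R y)) / 2 = (sqrt (2 * t) * sqrt (2 * t)) * (y \<bullet> y) / 2"
      by (simp only: inner_scaleR_left inner_scaleR_right mult.assoc)
    then show ?thesis using t by (simp add: real_sqrt_mult_self del: real_sqrt_mult)
  qed
  have "(\<integral>\<^sup>+x. ennreal (exp (t * (\<Sum>i\<in>I. (v i \<bullet> p x)\<^sup>2))) \<partial>std_gauss)
    = (\<integral>\<^sup>+x. (\<integral>\<^sup>+\<xi>. ennreal (exp (\<xi> \<bullet> (sqrt (2 * t) *\<^sub>R S (p x)))) \<partial>std_gauss) \<partial>std_gauss)"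
    unfolding nn_integral_std_gauss_exp sq S ..
  also have "\<dots> = (\<integral>\<^sup>+\<xi>. (\<integral>\<^sup>+x. ennreal (exp (\<xi> \<bullet> (sqrt (2 * t) *\<^sub>R S (p x)))) \<partial>std_gauss) \<partial>std_gauss)"
    by (rule GG.Fubini') measurable
  also have "\<dots> = (\<integral>\<^sup>+\<xi>. (\<integral>\<^sup>+x. ennreal (exp (x \<bullet> (sqrt (2 * t) *\<^sub>R p (S \<xi>)))) \<partial>std_gauss) \<partial>std_gauss)"
    by (simp add: Sadj)
  also have "\<dots> = (\<integral>\<^sup>+\<xi>. ennreal (exp (t * (p (S \<xi>) \<bullet> p (S \<xi>)))) \<partial>std_gauss)"
    unfolding nn_integral_std_gauss_exp sq ..
  also have "\<dots> \<le> (\<integral>\<^sup>+\<xi>. ennreal (exp (t * (S \<xi> \<bullet> S \<xi>))) \<partial>std_gauss)"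
  proof (intro nn_integral_mono ennreal_leI)
    fix \<xi>
    have "p (S \<xi>) \<bullet> p (S \<xi>) \<le> S \<xi> \<bullet> S \<xi>"
      using contr[of "S \<xi>"] by (simp add: norm_le)
    then show "exp (t * (p (S \<xi>) \<bullet> p (S \<xi>))) \<le> exp (t * (S \<xi> \<bullet> S \<xi>))"
      using t by (simp add: mult_left_mono)
  qed
  also have "\<dots> = (\<integral>\<^sup>+\<xi>. (\<Prod>i\<in>I. ennreal (exp (t * (\<xi> \<bullet> v i)\<^sup>2))) \<partial>std_gauss)"
    using I by (simp add: S sum_distrib_left exp_sum prod_ennreal inner_commute)
  also have "\<dots> = (\<Prod>i\<in>I. ennreal (1 / sqrt (1 - 2 * t)))"
    using I v t by (subst nn_integral_std_gauss_orthonormal[where F="\<lambda>_ y. ennreal (exp (t * y\<^sup>2))"]) (auto simp: nn_integral_std_normal_exp_square)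
  also have "\<dots> = ennreal ((1 / sqrt (1 - 2 * t)) ^ card I)"
    using t by (simp add: ennreal_power)
  finally show ?thesis .
qed

text \<open>For \<open>V\<close> in \<open>Stiefel\<close> and a unit vector \<open>b\<close> this
  is the projection onto \<open>{V c | c \<bullet> b = 0}\<close>, the part of the spike that stays
  when direction \<open>b\<close> is removed.\<close>

definition outer_part :: "real^'r \<Rightarrow> real^'r^'d \<Rightarrow> real^'d^'d" where
  "outer_part b V = V ** transpose V - (\<chi> i j. (V *v b) $ i * (V *v b) $ j)"

lemma transpose_outer_part [simp]: "transpose (outer_part b V) = outer_part b V"
  by (simp add: outer_part_def vec_eq_iff matrix_matrix_mult_def transpose_def mult.commute)

lemma measurable_outer_part [measurable]:
  assumes [measurable]: "V \<in> borel_measurable M"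
  shows "(\<lambda>x. outer_part b (V x)) \<in> borel_measurable M"
proof -
  have [measurable]: "(\<lambda>x. \<chi> i j. (V x *v b) $ i * (V x *v b) $ j) \<in> borel_measurable M"
    by (intro measurable_vec_lambdaI) measurable
  show ?thesis unfolding outer_part_def by measurable
qed

text \<open>Only the component of the rows along \<open>b\<close> changes, and its contribution is
  exactly what \<open>outer_part\<close> subtracts. Vectors computed from the outer part are thus
  untouched when the direction is redrawn.\<close>

lemma outer_part_replace_dir:
  assumes b: "norm b = 1"
  shows "outer_part b (replace_dir b V x) = outer_part b V"
proof -
  have bb: "(\<Sum>k\<in>UNIV. b $ k * b $ k) = 1" using b by (simp add: norm_eq_sqrt_inner inner_vec_def)
  define w where "w = compl_proj b V x /\<^sub>R norm (compl_proj b V x) - V *v b"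
  have 1: "replace_dir b V x *v b = V *v b + w"
    using b by (simp add: replace_dir_mult w_def dot_square_norm)
  have 2: "replace_dir b V x $ i $ k = V $ i $ k + w $ i * b $ k" for i k
    by (simp add: replace_dir_def w_def)
  have 3: "(\<Sum>k\<in>UNIV. V $ i $ k * b $ k) = (V *v b) $ i" for i
    by (simp add: matrix_vector_mult_def)
  have "(\<Sum>k\<in>UNIV. (V $ i $ k + w $ i * b $ k) * (V $ j $ k + w $ j * b $ k))
    = (\<Sum>k\<in>UNIV. V $ i $ k * V $ j $ k) + w $ j * (\<Sum>k\<in>UNIV. V $ i $ k * b $ k) + w $ i * (\<Sum>k\<in>UNIV. V $ j $ k * b $ k)
      + w $ i * w $ j * (\<Sum>k\<in>UNIV. b $ k * b $ k)" for i j
    unfolding sum_distrib_left sum.distrib[symmetric] by (intro sum.cong refl) (simp add: algebra_simps)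
  then have 4: "(\<Sum>k\<in>UNIV. (V $ i $ k + w $ i * b $ k) * (V $ j $ k + w $ j * b $ k))
    = (\<Sum>k\<in>UNIV. V $ i $ k * V $ j $ k) + w $ j * (V *v b) $ i + w $ i * (V *v b) $ j + w $ i * w $ j" for i j
    unfolding 3 bb by simp
  show ?thesis
    unfolding outer_part_def 1
    by (simp only: vec_eq_iff matrix_matrix_mult_def transpose_def 2 4 vec_lambda_beta vector_minus_component vector_add_component) (simp add: algebra_simps)
qed

text \<open>A uniformly distributed direction is the direction of a Gaussian vector; its radius is
  independent of it, so it can be put in at its mean value \<open>CARD('d) + 1 - CARD('r)\<close> by Jensen's
  inequality, used in the tangent form \<open>exp (t m \<psi>) (1 + t (R\<^sup>2 - m) \<psi>) \<le> exp (t R\<^sup>2 \<psi>)\<close>.\<close>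

lemma uniform_Stiefel_exp_square_le:
  fixes \<mu> :: "(real^'r^'d) measure" and v :: "real^'d^'d \<Rightarrow> 'i \<Rightarrow> real^'d"
  assumes \<mu>: "uniform_Stiefel \<mu>" and b: "norm b = 1" and I: "finite I"
    and v: "\<And>C i j. transpose C = C \<Longrightarrow> i \<in> I \<Longrightarrow> j \<in> I \<Longrightarrow> v C i \<bullet> v C j = (if i = j then 1 else 0)"
    and meas [measurable]: "\<And>i. i \<in> I \<Longrightarrow> (\<lambda>C. v C i) \<in> borel_measurable borel"
    and t: "0 \<le> t" "t < 1 / 2" and rd: "CARD('r) \<le> CARD('d)"
  defines "m \<equiv> real (CARD('d) + 1 - CARD('r))"
  shows "(\<integral>\<^sup>+V. ennreal (exp (t * m * (\<Sum>i\<in>I. (v (outer_part b V) i \<bullet> (V *v b))\<^sup>2))) \<partial>\<mu>)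
    \<le> ennreal ((1 / sqrt (1 - 2 * t)) ^ card I)"
proof -
  interpret G: prob_space "std_gauss :: (real^'d) measure" by (rule prob_space_std_gauss)
  interpret M: prob_space \<mu> using \<mu> by (simp add: uniform_Stiefel_def)
  have sets [measurable_cong]: "sets \<mu> = sets borel" using \<mu> by (simp add: uniform_Stiefel_def)
  have m: "m > 0" using rd by (simp add: m_def)
  have St: "AE V in \<mu>. V \<in> Stiefel" using \<mu> by (simp add: uniform_Stiefel_def)
  have meas' [measurable]: "(\<lambda>x. v (g x) i) \<in> borel_measurable N" if "i \<in> I" "g \<in> borel_measurable N" for g i and N :: "'x measure"
    using measurable_compose[OF that(2) meas[OF that(1)]] .
  define \<psi> where "\<psi> V = (\<Sum>i\<in>I. (v (outer_part b V) i \<bullet> (V *v b))\<^sup>2)" for V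
  have \<psi>m [measurable]: "\<psi> \<in> borel_measurable borel" unfolding \<psi>_def by measurable
  have \<psi>0: "0 \<le> \<psi> V" for V by (simp add: \<psi>_def sum_nonneg)
  define R where "R V x = (norm (compl_proj b V x))\<^sup>2" for V :: "real^'r^'d" and x
  have [measurable]: "(\<lambda>\<omega>. R (g \<omega>) (h \<omega>)) \<in> borel_measurable N" if "g \<in> borel_measurable N" "h \<in> borel_measurable N" for g h and N :: "'x measure"
    using that unfolding R_def by measurable
  have R0: "R V x \<ge> 0" for V x by (simp add: R_def)
  let ?r = "replace_dir b"
  have law1: "(\<integral>\<^sup>+V. (\<integral>\<^sup>+x. f (?r V x) \<partial>std_gauss) \<partial>\<mu>) = (\<integral>\<^sup>+V. f V \<partial>\<mu>)" if "f \<in> borel_measurable borel" for f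
    using replace_dir_law[OF \<mu> b, of "\<lambda>_ _. 1" f] that G.emeasure_space_1 M.emeasure_space_1 by simp
  have ER: "(\<integral>\<^sup>+V. (\<integral>\<^sup>+x. ennreal (R V x) \<partial>std_gauss) \<partial>\<mu>) = ennreal m"
  proof -
    have "(\<integral>\<^sup>+V. (\<integral>\<^sup>+x. ennreal (R V x) \<partial>std_gauss) \<partial>\<mu>) = (\<integral>\<^sup>+V. ennreal m \<partial>\<mu>)"
    proof (rule nn_integral_cong_AE, use St in eventually_elim)
      case (elim V)
      have "(\<integral>\<^sup>+x. ennreal (R V x) \<partial>std_gauss) + ennreal (CARD('r)) = ennreal m + ennreal (CARD('r))"
        unfolding R_def nn_integral_compl_proj_square[OF elim b] using rd
        by (simp add: m_def flip: ennreal_plus)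
      then show ?case by (simp add: add.commute[of _ "ennreal (CARD('r))"] ennreal_add_left_cancel)
    qed
    then show ?thesis using M.emeasure_space_1 by simp
  qed
  \<comment> \<open>Weighting by \<open>R / m\<close> leaves the law of the new frame unchanged.
    This is the independence of radius and direction in the form in which it is needed.\<close>
  have law2: "(\<integral>\<^sup>+V. (\<integral>\<^sup>+x. ennreal (R V x) * f (?r V x) \<partial>std_gauss) \<partial>\<mu>) = ennreal m * (\<integral>\<^sup>+V. f V \<partial>\<mu>)"
    if [measurable]: "f \<in> borel_measurable borel" for f
  proof -
    have split: "ennreal (R V x / m) * y = ennreal (1 / m) * (ennreal (R V x) * y)" for V x y
      using m R0 by (simp add: mult.assoc[symmetric] ennreal_mult[symmetric])
    have "(\<integral>\<^sup>+V. (\<integral>\<^sup>+x. ennreal (R V x / m) * f (?r V x) \<partial>std_gauss) \<partial>\<mu>) = (\<integral>\<^sup>+V. f V \<partial>\<mu>)"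
    proof (rule replace_dir_law[OF \<mu> b])
      show "ennreal (R (Q ** V) (Q *v x) / m) = ennreal (R V x / m)" if "orthogonal_matrix Q" for Q :: "real^'d^'d" and V x
        unfolding R_def compl_proj_orthogonal[OF that] power2_norm_eq_inner orthogonal_matrix_inner[OF that] ..
      show "(\<integral>\<^sup>+V. (\<integral>\<^sup>+x. ennreal (R V x / m) \<partial>std_gauss) \<partial>\<mu>) = 1"
        using split[of _ _ 1] m by (simp add: nn_integral_cmult ER flip: ennreal_mult)
    qed measurable
    then have "ennreal m * (ennreal (1 / m) * (\<integral>\<^sup>+V. (\<integral>\<^sup>+x. ennreal (R V x) * f (?r V x) \<partial>std_gauss) \<partial>\<mu>)) = ennreal m * (\<integral>\<^sup>+V. f V \<partial>\<mu>)"
      by (simp add: split nn_integral_cmult)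
    then show ?thesis using m by (simp add: mult.assoc[symmetric] flip: ennreal_mult)
  qed
  define F where "F V = ennreal (exp (t * m * \<psi> V))" for V
  have [measurable]: "F \<in> borel_measurable borel" unfolding F_def by measurable
  have "(\<integral>\<^sup>+V. F V \<partial>\<mu>) + ennreal (t * m) * (\<integral>\<^sup>+V. F V * ennreal (\<psi> V) \<partial>\<mu>)
    = (\<integral>\<^sup>+V. (\<integral>\<^sup>+x. F (?r V x) + ennreal t * (ennreal (R V x) * (F (?r V x) * ennreal (\<psi> (?r V x)))) \<partial>std_gauss) \<partial>\<mu>)"
  proof -
    have "(\<integral>\<^sup>+V. (\<integral>\<^sup>+x. F (?r V x) + ennreal t * (ennreal (R V x) * (F (?r V x) * ennreal (\<psi> (?r V x)))) \<partial>std_gauss) \<partial>\<mu>)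
      = (\<integral>\<^sup>+V. (\<integral>\<^sup>+x. F (?r V x) \<partial>std_gauss) \<partial>\<mu>)
        + ennreal t * (\<integral>\<^sup>+V. (\<integral>\<^sup>+x. ennreal (R V x) * (F (?r V x) * ennreal (\<psi> (?r V x))) \<partial>std_gauss) \<partial>\<mu>)"
      by (simp add: nn_integral_add nn_integral_cmult)
    also have "(\<integral>\<^sup>+V. (\<integral>\<^sup>+x. F (?r V x) \<partial>std_gauss) \<partial>\<mu>) = (\<integral>\<^sup>+V. F V \<partial>\<mu>)"
      by (rule law1) measurable
    also have "(\<integral>\<^sup>+V. (\<integral>\<^sup>+x. ennreal (R V x) * (F (?r V x) * ennreal (\<psi> (?r V x))) \<partial>std_gauss) \<partial>\<mu>)
      = ennreal m * (\<integral>\<^sup>+V. F V * ennreal (\<psi> V) \<partial>\<mu>)"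
      by (rule law2) measurable
    finally show ?thesis using t m by (simp add: ennreal_mult mult.assoc)
  qed
  also have "\<dots> \<le> (\<integral>\<^sup>+V. (\<integral>\<^sup>+x. ennreal (exp (t * (\<Sum>i\<in>I. (v (outer_part b V) i \<bullet> compl_proj b V x)\<^sup>2)))
      + ennreal (t * m) * (F (?r V x) * ennreal (\<psi> (?r V x))) \<partial>std_gauss) \<partial>\<mu>)"
  proof (intro nn_integral_mono)
    fix V :: "real^'r^'d" and x
    let ?V = "?r V x"
    have Vb: "?V *v b = compl_proj b V x /\<^sub>R norm (compl_proj b V x)"
      using b by (simp add: replace_dir_mult dot_square_norm)
    \<comment> \<open>The factor \<open>R V x\<close> undoes the normalization of the new direction;
      both sides are 0 if the projection of \<open>x\<close> vanishes.\<close>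
    have R\<psi>: "R V x * \<psi> ?V = (\<Sum>i\<in>I. (v (outer_part b V) i \<bullet> compl_proj b V x)\<^sup>2)"
    proof (cases "compl_proj b V x = 0")
      case False
      then show ?thesis
        unfolding \<psi>_def outer_part_replace_dir[OF b] R_def Vb
        by (simp add: sum_distrib_left power_mult_distrib power_divide field_simps)
    qed (simp add: R_def)
    \<comment> \<open>The tangent inequality; afterwards the term with \<open>m\<close> is moved to
      the right so that only nonnegative terms are integrated.\<close>
    have "exp (t * m * \<psi> ?V) * (1 + t * (R V x - m) * \<psi> ?V) \<le> exp (t * m * \<psi> ?V) * exp (t * (R V x - m) * \<psi> ?V)"
      using exp_ge_add_one_self by (intro mult_left_mono) auto
    also have "\<dots> = exp (t * (R V x * \<psi> ?V))" by (simp add: exp_add[symmetric] algebra_simps)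
    finally have "exp (t * m * \<psi> ?V) + t * (R V x * (exp (t * m * \<psi> ?V) * \<psi> ?V))
      \<le> exp (t * (R V x * \<psi> ?V)) + t * m * (exp (t * m * \<psi> ?V) * \<psi> ?V)"
      by (simp add: algebra_simps)
    then have "ennreal (exp (t * m * \<psi> ?V) + t * (R V x * (exp (t * m * \<psi> ?V) * \<psi> ?V)))
      \<le> ennreal (exp (t * (R V x * \<psi> ?V)) + t * m * (exp (t * m * \<psi> ?V) * \<psi> ?V))"
      by (rule ennreal_leI)
    then show "F ?V + ennreal t * (ennreal (R V x) * (F ?V * ennreal (\<psi> ?V)))
      \<le> ennreal (exp (t * (\<Sum>i\<in>I. (v (outer_part b V) i \<bullet> compl_proj b V x)\<^sup>2))) + ennreal (t * m) * (F ?V * ennreal (\<psi> ?V))"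
      unfolding F_def R\<psi> using t m R0 \<psi>0 by (simp add: ennreal_mult ennreal_plus)
  qed
  also have "\<dots> = (\<integral>\<^sup>+V. (\<integral>\<^sup>+x. ennreal (exp (t * (\<Sum>i\<in>I. (v (outer_part b V) i \<bullet> compl_proj b V x)\<^sup>2))) \<partial>std_gauss) \<partial>\<mu>)
      + ennreal (t * m) * (\<integral>\<^sup>+V. F V * ennreal (\<psi> V) \<partial>\<mu>)"
  proof -
    have "(\<integral>\<^sup>+V. (\<integral>\<^sup>+x. F (?r V x) * ennreal (\<psi> (?r V x)) \<partial>std_gauss) \<partial>\<mu>) = (\<integral>\<^sup>+V. F V * ennreal (\<psi> V) \<partial>\<mu>)"
      by (rule law1) measurable
    then show ?thesis by (simp add: nn_integral_add nn_integral_cmult)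
  qed
  also have "\<dots> \<le> ennreal ((1 / sqrt (1 - 2 * t)) ^ card I) + ennreal (t * m) * (\<integral>\<^sup>+V. F V * ennreal (\<psi> V) \<partial>\<mu>)"
  proof (intro add_right_mono)
    have "(\<integral>\<^sup>+V. (\<integral>\<^sup>+x. ennreal (exp (t * (\<Sum>i\<in>I. (v (outer_part b V) i \<bullet> compl_proj b V x)\<^sup>2))) \<partial>std_gauss) \<partial>\<mu>)
      \<le> (\<integral>\<^sup>+V. ennreal ((1 / sqrt (1 - 2 * t)) ^ card I) \<partial>\<mu>)"
    proof (rule nn_integral_mono_AE, use St in eventually_elim)
      case (elim V)
      show ?case
        by (rule nn_integral_exp_contraction_square_le[OF I _ linear_compl_proj compl_proj_adjoint norm_compl_proj_le[OF b elim] t])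
           (use v[OF transpose_outer_part[of b V]] in auto)
    qed
    then show "(\<integral>\<^sup>+V. (\<integral>\<^sup>+x. ennreal (exp (t * (\<Sum>i\<in>I. (v (outer_part b V) i \<bullet> compl_proj b V x)\<^sup>2))) \<partial>std_gauss) \<partial>\<mu>)
      \<le> ennreal ((1 / sqrt (1 - 2 * t)) ^ card I)" using M.emeasure_space_1 by simp
  qed
  finally have le: "(\<integral>\<^sup>+V. F V \<partial>\<mu>) + ennreal (t * m) * (\<integral>\<^sup>+V. F V * ennreal (\<psi> V) \<partial>\<mu>)
    \<le> ennreal ((1 / sqrt (1 - 2 * t)) ^ card I) + ennreal (t * m) * (\<integral>\<^sup>+V. F V * ennreal (\<psi> V) \<partial>\<mu>)" .
  \<comment> \<open>The common summand must be finite to be cancelled;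
    \<open>\<psi> V \<le> 1\<close> is Bessel's inequality for the unit vector
    \<open>u\<close>.\<close>
  have "(\<integral>\<^sup>+V. F V * ennreal (\<psi> V) \<partial>\<mu>) \<le> (\<integral>\<^sup>+V. ennreal (exp (t * m) * 1) \<partial>\<mu>)"
  proof (rule nn_integral_mono_AE, use St in eventually_elim)
    case (elim V)
    define u where "u = V *v b"
    define y where "y = (\<Sum>i\<in>I. (v (outer_part b V) i \<bullet> u) *\<^sub>R v (outer_part b V) i)"
    have u: "u \<bullet> u = 1" unfolding u_def using Stiefel_inner[OF elim, of b b] b by (simp add: dot_square_norm)
    have yy: "y \<bullet> y = \<psi> V"
      unfolding y_def \<psi>_def u_def[symmetric] using I
      by (simp add: inner_sum_left inner_sum_right v[OF transpose_outer_part[of b V]] power2_eq_square if_distrib[of "\<lambda>c. _ * c"] sum.delta cong: sum.cong if_cong)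
    have yu: "y \<bullet> u = \<psi> V"
      unfolding y_def \<psi>_def u_def[symmetric] by (simp add: inner_sum_left power2_eq_square)
    have "0 \<le> (u - y) \<bullet> (u - y)" by simp
    then have "\<psi> V \<le> 1" by (simp add: inner_diff_left inner_diff_right inner_commute[of u y] yy yu u)
    moreover have "exp (t * m * \<psi> V) * \<psi> V \<le> exp (t * m) * 1"
      using \<open>\<psi> V \<le> 1\<close> \<psi>0 t m by (intro mult_mono) (auto intro: mult_left_le)
    ultimately show ?case by (simp add: F_def \<psi>0 ennreal_leI flip: ennreal_mult)
  qed
  also have "\<dots> < \<infinity>" using M.emeasure_space_1 by simp
  finally have "ennreal (t * m) * (\<integral>\<^sup>+V. F V * ennreal (\<psi> V) \<partial>\<mu>) < top"
    by (simp add: ennreal_mult_less_top)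
  with le have "(\<integral>\<^sup>+V. F V \<partial>\<mu>) \<le> ennreal ((1 / sqrt (1 - 2 * t)) ^ card I)"
    by (auto simp: ennreal_add_left_cancel_le add.commute)
  then show ?thesis by (simp add: F_def \<psi>_def)
qed

section \<open>Query algorithms\<close>

lemma run_stable: "j \<le> k \<Longrightarrow> 0 < j \<Longrightarrow> run alg M k j = run alg M j j"
proof (induction k)
  case (Suc k)
  then show ?case by (cases "j = Suc k") (auto simp: Let_def)
qed simp

text \<open>The query of round \<open>j\<close> as a function of the matrix alone, whatever the
  number of further rounds.\<close>

definition qry :: "(nat \<Rightarrow> 'd history \<Rightarrow> real^'d) \<Rightarrow> real^'d^'d \<Rightarrow> nat \<Rightarrow> real^'d" where
  "qry alg M j = query (run alg M j) j"

lemma query_run: "j \<in> {1..k} \<Longrightarrow> query (run alg M k) j = qry alg M j"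
  using run_stable[of j k alg M] by (simp add: query_def qry_def)

lemma qry_Suc: "qry alg M (Suc k) = alg k (run alg M k)"
  by (simp add: qry_def query_def Let_def)

lemma VVT_mult: "VVT h k *v x = (\<Sum>l=1..k. (query h l \<bullet> x) *\<^sub>R query h l)"
proof -
  have "(\<Sum>j\<in>UNIV. (\<Sum>l=1..k. query h l $ i * query h l $ j) * x $ j) = (\<Sum>l=1..k. (query h l \<bullet> x) * query h l $ i)" for i
  proof -
    have "(\<Sum>j\<in>UNIV. (\<Sum>l=1..k. query h l $ i * query h l $ j) * x $ j) = (\<Sum>j\<in>UNIV. \<Sum>l=1..k. query h l $ i * query h l $ j * x $ j)"
      by (simp add: sum_distrib_right)
    also have "\<dots> = (\<Sum>l=1..k. \<Sum>j\<in>UNIV. query h l $ i * query h l $ j * x $ j)" by (rule sum.swap)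
    also have "\<dots> = (\<Sum>l=1..k. (query h l \<bullet> x) * query h l $ i)"
      by (simp add: inner_vec_def sum_distrib_left sum_distrib_right mult_ac)
    finally show ?thesis .
  qed
  then show ?thesis by (simp add: vec_eq_iff VVT_def matrix_vector_mult_def)
qed

lemma transpose_VVT [simp]: "transpose (VVT h k) = VVT h k"
  by (simp add: VVT_def transpose_def vec_eq_iff mult.commute)

lemma measurable_VVT:
  assumes "(\<lambda>x. h x) \<in> M \<rightarrow>\<^sub>M history_space n" "k \<le> n"
  shows "(\<lambda>x. VVT (h x) k) \<in> borel_measurable M"
proof -
  have "(\<lambda>x. query (h x) l) \<in> borel_measurable M" if "l \<in> {1..k}" for l
  proof -
    have "(\<lambda>x. h x l) \<in> borel_measurable M"
      using measurable_compose[OF assms(1)[unfolded history_space_def] measurable_component_singleton[of l "{1..n}"]] that assms(2) by auto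
    moreover have "fst \<in> borel_measurable (borel :: ((real^'d) \<times> (real^'d)) measure)"
      by (simp add: borel_prod[symmetric])
    ultimately show ?thesis unfolding query_def by (rule measurable_compose)
  qed
  note [measurable] = this
  show ?thesis
    unfolding VVT_def by (intro measurable_vec_lambdaI borel_measurable_sum borel_measurable_times) measurable
qed

lemma measurable_run:
  assumes alg: "\<And>k. k < N \<Longrightarrow> alg k \<in> borel_measurable (history_space k)" and k: "k \<le> N"
  shows "(\<lambda>M. run alg M k) \<in> borel \<rightarrow>\<^sub>M history_space k"
  using k
proof (induction k)
  case 0
  show ?case by (auto simp: history_space_def space_PiM)
next
  case (Suc k)
  then have [measurable]: "(\<lambda>M. run alg M k) \<in> borel \<rightarrow>\<^sub>M history_space k" by simp
  have [measurable]: "(\<lambda>M. VVT (run alg M k) k) \<in> borel_measurable borel" by (rule measurable_VVT) auto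
  have [measurable]: "(\<lambda>M. alg k (run alg M k)) \<in> borel_measurable borel"
    using Suc.prems by (intro measurable_compose[OF _ alg]) auto
  have "(\<lambda>M. (run alg M k)(Suc k := (alg k (run alg M k), (mat 1 - VVT (run alg M k) k) *v (M *v alg k (run alg M k)))))
    \<in> borel \<rightarrow>\<^sub>M PiM {1..Suc k} (\<lambda>_. borel)"
  proof (rule measurable_fun_upd)
    show "{1..Suc k} = {1..k} \<union> {Suc k}" by auto
    show "(\<lambda>M. run alg M k) \<in> borel \<rightarrow>\<^sub>M PiM {1..k} (\<lambda>_. borel)"
      using Suc by (simp add: history_space_def)
    show "(\<lambda>M. (alg k (run alg M k), (mat 1 - VVT (run alg M k) k) *v (M *v alg k (run alg M k)))) \<in> borel_measurable borel"
      unfolding borel_prod[symmetric] by measurable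
  qed
  then show ?case by (simp only: history_space_def run.simps Let_def)
qed

lemma measurable_qry:
  assumes alg: "\<And>k. k < N \<Longrightarrow> alg k \<in> borel_measurable (history_space k)" and j: "j \<in> {1..N}"
    and g: "g \<in> borel_measurable M"
  shows "(\<lambda>x. qry alg (g x) j) \<in> borel_measurable M"
proof -
  obtain k where k: "j = Suc k" "k < N" using j by (cases j) auto
  have "(\<lambda>M. alg k (run alg M k)) \<in> borel_measurable borel"
    by (rule measurable_compose[OF measurable_run[OF alg] alg]) (use k in auto)
  then show ?thesis using g unfolding k(1) qry_Suc by (rule measurable_compose[rotated])
qed

locale querying =
  fixes N :: nat and alg :: "nat \<Rightarrow> ('d::finite) history \<Rightarrow> real^'d"
  assumes alg: "query_algorithm N alg"
begin

lemma alg_measurable: "k < N \<Longrightarrow> alg k \<in> borel_measurable (history_space k)"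
  using alg by (simp add: query_algorithm_def)

lemmas measurable_qry' = measurable_qry[OF alg_measurable]

lemma qry_orthonormal:
  assumes M: "transpose M = M" and ij: "i \<in> {1..N}" "j \<in> {1..N}"
  shows "qry alg M i \<bullet> qry alg M j = (if i = j then 1 else 0)"
proof -
  have n: "norm (qry alg M k) = 1" if "k \<in> {1..N}" for k
    using alg M that by (auto simp: query_algorithm_def query_run[symmetric])
  have o: "qry alg M l \<bullet> qry alg M k = 0" if "k \<in> {1..N}" "l \<in> {1..<k}" for k l
  proof -
    have "query (run alg M N) l \<bullet> query (run alg M N) k = 0"
      using alg M that by (simp add: query_algorithm_def)
    then show ?thesis using that by (simp add: query_run)
  qed
  consider "i = j" | "i < j" | "j < i" by linarith
  then show ?thesis
  proof cases
    case 1 then show ?thesis using n[OF ij(1)] by (simp add: dot_square_norm)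
  next
    case 2 then show ?thesis using o[OF ij(2), of i] ij by simp
  next
    case 3 then show ?thesis using o[OF ij(1), of j] ij by (simp add: inner_commute)
  qed
qed

text \<open>For symmetric \<open>M\<close> and \<open>k \<le> N\<close>, the projection onto the
  orthogonal complement of the first \<open>k\<close> queries.\<close>

definition resid :: "nat \<Rightarrow> real^'d^'d \<Rightarrow> real^'d^'d" where
  "resid k M = mat 1 - VVT (run alg M k) k"

lemma resid_mult: "resid k M *v x = x - (\<Sum>l=1..k. (qry alg M l \<bullet> x) *\<^sub>R qry alg M l)"
proof -
  have "(\<Sum>l=1..k. (query (run alg M k) l \<bullet> x) *\<^sub>R query (run alg M k) l) = (\<Sum>l=1..k. (qry alg M l \<bullet> x) *\<^sub>R qry alg M l)"
    by (intro sum.cong refl) (simp only: query_run)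
  then show ?thesis by (simp add: resid_def matrix_vector_mult_diff_rdistrib VVT_mult)
qed

lemma transpose_resid [simp]: "transpose (resid k M) = resid k M"
proof -
  have "VVT (run alg M k) k $ i $ j = VVT (run alg M k) k $ j $ i" for i j
    by (simp add: VVT_def mult.commute)
  then show ?thesis by (simp add: resid_def transpose_def vec_eq_iff mat_def)
qed

lemma resid_qry:
  assumes M: "transpose M = M" and k: "k \<le> N" and j: "j \<in> {1..N}"
  shows "resid k M *v qry alg M j = (if j \<le> k then 0 else qry alg M j)"
proof -
  have "(\<Sum>l=1..k. (qry alg M l \<bullet> qry alg M j) *\<^sub>R qry alg M l) = (\<Sum>l=1..k. (if l = j then qry alg M j else 0))"
    using k j by (intro sum.cong refl) (auto simp: qry_orthonormal[OF M])
  then show ?thesis using j by (simp add: resid_mult sum.delta)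
qed

lemma resid_resid:
  assumes M: "transpose M = M" and kl: "k \<le> l" "l \<le> N"
  shows "resid l M ** resid k M = resid l M" "resid k M ** resid l M = resid l M"
proof -
  have "resid k M *v (resid l M *v x) = resid l M *v x" for x
  proof -
    have "resid k M *v (resid l M *v x) = resid k M *v x - (\<Sum>i=1..l. (qry alg M i \<bullet> x) *\<^sub>R (resid k M *v qry alg M i))"
      by (simp add: resid_mult[of l] matrix_vector_mult_diff_distrib linear_sum[OF matrix_vector_mul_linear] matrix_vector_mult_scaleR)
    also have "(\<Sum>i=1..l. (qry alg M i \<bullet> x) *\<^sub>R (resid k M *v qry alg M i)) = (\<Sum>i\<in>{Suc k..l}. (qry alg M i \<bullet> x) *\<^sub>R qry alg M i)"
      using kl by (intro sum.mono_neutral_cong_right) (auto simp: resid_qry[OF M])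
    also have "resid k M *v x - \<dots> = resid l M *v x"
    proof -
      have "{1..l} = {1..k} \<union> {Suc k..l}" using kl by auto
      moreover have "(\<Sum>i\<in>{1..k} \<union> {Suc k..l}. (qry alg M i \<bullet> x) *\<^sub>R qry alg M i)
        = (\<Sum>i\<in>{1..k}. (qry alg M i \<bullet> x) *\<^sub>R qry alg M i) + (\<Sum>i\<in>{Suc k..l}. (qry alg M i \<bullet> x) *\<^sub>R qry alg M i)"
        by (rule sum.union_disjoint) auto
      ultimately show ?thesis by (simp add: resid_mult)
    qed
    finally show ?thesis .
  qed
  then have "(resid k M ** resid l M) *v x = resid l M *v x" for x
    by (simp only: matrix_vector_mul_assoc)
  then show *: "resid k M ** resid l M = resid l M"
    using matrix_eq by blast
  show "resid l M ** resid k M = resid l M"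
    using arg_cong[OF *, of transpose] by (simp add: matrix_transpose_mul)
qed

text \<open>The residual projection annihilates the first \<open>k\<close> queries, so the added
  term contributes nothing to their products with the matrix.\<close>

lemma run_resid_invariant:
  assumes M: "transpose M = M" and k: "k \<le> N" and j: "j \<le> k"
  shows "run alg (M + resid k M ** Z ** resid k M) j = run alg M j"
  using j
proof (induction j)
  case (Suc j)
  let ?M = "M + resid k M ** Z ** resid k M"
  have IH: "run alg ?M j = run alg M j" using Suc by simp
  have "resid k M *v alg j (run alg M j) = 0"
    using resid_qry[OF M k, of "Suc j"] Suc.prems k by (simp add: qry_Suc)
  then have "?M *v alg j (run alg M j) = M *v alg j (run alg M j)"
    by (simp add: matrix_vector_mult_add_rdistrib matrix_vector_mul_assoc[symmetric])
  then show ?case by (simp add: IH Let_def)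
qed simp

text \<open>The range extends to \<open>Suc k\<close>: the next query is a function of the first
  \<open>k\<close> rounds. This extra index makes the induction over the rounds possible.\<close>

lemma qry_resid_invariant:
  assumes M: "transpose M = M" and k: "k \<le> N" and j: "j \<in> {1..Suc k}"
  shows "qry alg (M + resid k M ** Z ** resid k M) j = qry alg M j"
  using j run_resid_invariant[OF M k, of "j - 1"] by (cases j) (auto simp: qry_Suc)

end

lemma sym_part_add: "sym_part (G + H) = sym_part G + sym_part H"
  by (simp add: sym_part_def transpose_def vec_eq_iff algebra_simps)

lemma transpose_sym_part [simp]: "transpose (sym_part G) = sym_part G"
  by (simp add: sym_part_def transpose_def vec_eq_iff add.commute)

lemma sym_part_conj: "transpose R = R \<Longrightarrow> sym_part (R ** Z ** R) = R ** sym_part Z ** R"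
proof -
  assume R: "transpose R = R"
  have "transpose (R ** Z ** R) = R ** transpose Z ** R"
    by (simp add: matrix_transpose_mul R matrix_mul_assoc)
  moreover have "A ** (c *\<^sub>R (X + Y)) ** B = c *\<^sub>R (A ** X ** B + A ** Y ** B)" for A B X Y :: "real^'a^'a" and c
    by (simp add: vec_eq_iff matrix_matrix_mult_def sum_distrib_left sum_distrib_right sum.distrib[symmetric] algebra_simps)
  ultimately show ?thesis
    by (simp add: sym_part_def)
qed

section \<open>Overlap of a direction with the queries\<close>

lemma inner_matrix_mult_right:
  fixes A :: "real^'b^'a" and B :: "real^'c^'b"
  shows "(A ** B) \<bullet> C = A \<bullet> (C ** transpose B)"
proof -
  have t: "transpose X \<bullet> transpose Y = X \<bullet> Y" for X Y :: "real^'m^'n"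
    by (simp add: inner_vec_def transpose_def) (rule sum.swap)
  have "(A ** B) \<bullet> C = transpose (A ** B) \<bullet> transpose C" by (rule t[symmetric])
  also have "\<dots> = transpose A \<bullet> (B ** transpose C)"
    by (simp only: matrix_transpose_mul inner_matrix_mult_left transpose_transpose)
  also have "\<dots> = transpose (transpose A) \<bullet> transpose (B ** transpose C)" by (rule t[symmetric])
  also have "\<dots> = A \<bullet> (C ** transpose B)"
    by (simp only: matrix_transpose_mul transpose_transpose)
  finally show ?thesis .
qed

lemma ortho_proj_conj:
  fixes R :: "real^'n^'n"
  assumes R: "transpose R = R" "R ** R = R"
  shows "ortho_proj (\<lambda>Z. R ** Z ** R)"
  unfolding ortho_proj_def
proof (intro conjI allI)
  show "linear (\<lambda>Z. R ** Z ** R)"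
    by (intro linearI) (simp_all add: vec_eq_iff matrix_matrix_mult_def sum_distrib_left sum_distrib_right sum.distrib[symmetric] algebra_simps)
  show "R ** (R ** Z ** R) ** R = R ** Z ** R" for Z
  proof -
    have "R ** (R ** Z ** R) ** R = (R ** R) ** Z ** (R ** R)" by (simp only: matrix_mul_assoc)
    then show ?thesis by (simp only: R)
  qed
  show "(R ** X ** R) \<bullet> Y = X \<bullet> (R ** Y ** R)" for X Y
  proof -
    have "(R ** X ** R) \<bullet> Y = (R ** X) \<bullet> (Y ** transpose R)" by (rule inner_matrix_mult_right)
    also have "\<dots> = X \<bullet> (transpose R ** (Y ** transpose R))" by (rule inner_matrix_mult_left)
    finally show ?thesis by (simp only: R matrix_mul_assoc)
  qed
qed

lemma conj_outer:
  fixes R :: "real^'n^'n"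
  assumes "transpose R = R"
  shows "R ** outer u ** R = outer (R *v u)"
proof -
  have "(R ** outer u ** R) *v x = outer (R *v u) *v x" for x
    by (simp add: matrix_vector_mul_assoc[symmetric] outer_mult inner_matrix_vector_left assms matrix_vector_mult_scaleR)
  then show ?thesis using matrix_eq by blast
qed

lemma outer_inner_outer: "outer u \<bullet> outer u = (u \<bullet> u)\<^sup>2"
  unfolding outer_def inner_vec_def
  by (simp add: power2_eq_square sum_product mult_ac)

context querying begin

text \<open>The observations determine everything about the noise except its compression to the
  orthogonal complement of the queries.\<close>

definition unseen :: "real^'d^'d \<Rightarrow> nat \<Rightarrow> real^'d^'d \<Rightarrow> real^'d^'d \<Rightarrow> real^'d^'d" where
  "unseen C k G Z = resid k (sym_part G + C) ** Z ** resid k (sym_part G + C)"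

lemma measurable_sym_part [measurable]:
  assumes [measurable]: "f \<in> borel_measurable M"
  shows "(\<lambda>x. sym_part (f x) :: real^'d^'d) \<in> borel_measurable M"
  unfolding sym_part_def by measurable

lemma measurable_resid:
  assumes k: "k \<le> N" and g: "g \<in> borel_measurable M"
  shows "(\<lambda>x. resid k (g x)) \<in> borel_measurable M"
proof -
  have "(\<lambda>x. run alg (g x) k) \<in> M \<rightarrow>\<^sub>M history_space k"
    by (rule measurable_compose[OF g measurable_run[OF alg_measurable k]])
  then have [measurable]: "(\<lambda>x. VVT (run alg (g x) k) k) \<in> borel_measurable M"
    by (rule measurable_VVT) simp
  show ?thesis unfolding resid_def by measurable
qed

lemma transpose_add_sym:
  "transpose C = C \<Longrightarrow> transpose (sym_part G + C) = sym_part G + (C :: real^'d^'d)"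
  by (simp add: transpose_plus)

lemma qry_unseen:
  assumes C: "transpose C = C" and k: "k \<le> N" and j: "j \<in> {1..Suc k}"
  shows "qry alg (sym_part (G + unseen C k G Z) + C) j = qry alg (sym_part G + C) j"
proof -
  let ?M = "sym_part G + C"
  have "sym_part (G + unseen C k G Z) + C = ?M + resid k ?M ** sym_part Z ** resid k ?M"
    by (simp add: unseen_def sym_part_add sym_part_conj)
  then show ?thesis by (simp only: qry_resid_invariant[OF transpose_add_sym[OF C] k j])
qed

lemma resid_unseen:
  assumes C: "transpose C = C" and k: "k \<le> N" and j: "j \<le> Suc k"
  shows "resid j (sym_part (G + unseen C k G Z) + C) = resid j (sym_part G + C)"
proof -
  have "resid j (sym_part (G + unseen C k G Z) + C) *v x = resid j (sym_part G + C) *v x" for x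
    unfolding resid_mult using j by (intro arg_cong2[where f="(-)"] refl sum.cong) (simp only: qry_unseen[OF C k] atLeastAtMost_iff, simp add: qry_unseen[OF C k])
  then show ?thesis using matrix_eq by blast
qed

text \<open>Before the first round everything is unseen. Each round shrinks the unseen space by a
  projection that is itself determined by what has been seen, as \<open>resampling_step\<close>
  requires.\<close>

lemma resampling_unseen:
  assumes C: "transpose C = C" and k: "k \<le> N"
  shows "resampling (unseen C k)"
  using k
proof (induction k)
  case 0
  have "resid 0 M = mat 1" for M
  proof -
    have "resid 0 M *v x = mat 1 *v x" for x by (simp add: resid_mult)
    then show ?thesis using matrix_eq by blast
  qed
  then have "unseen C 0 = (\<lambda>_ Z. Z)" by (simp add: unseen_def fun_eq_iff)
  moreover have "resampling (\<lambda>_ Z. Z :: real^'d^'d)"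
    by (rule resampling_const) (simp add: ortho_proj_def linear_ident)
  ultimately show ?case by simp
next
  case (Suc k)
  then have k: "k \<le> N" by simp
  have rr: "resid (Suc k) (sym_part G + C) ** resid (Suc k) (sym_part G + C) = resid (Suc k) (sym_part G + C)"
    "resid k (sym_part G + C) ** resid (Suc k) (sym_part G + C) = resid (Suc k) (sym_part G + C)"
    "resid (Suc k) (sym_part G + C) ** resid k (sym_part G + C) = resid (Suc k) (sym_part G + C)" for G
    using resid_resid[OF transpose_add_sym[OF C]] Suc.prems by auto
  show ?case
  proof (rule resampling_step[OF Suc.IH[OF k]])
    show "ortho_proj (unseen C (Suc k) x)" for x
      unfolding unseen_def by (rule ortho_proj_conj) (simp_all add: rr)
    have [measurable]: "(\<lambda>x. resid (Suc k) (sym_part (fst x) + C)) \<in> borel_measurable (borel \<Otimes>\<^sub>M borel)"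
      by (rule measurable_resid[OF Suc.prems]) measurable
    show "(\<lambda>(x, y). unseen C (Suc k) x y) \<in> borel \<Otimes>\<^sub>M borel \<rightarrow>\<^sub>M borel"
      unfolding unseen_def case_prod_beta by measurable
    show "unseen C k x (unseen C (Suc k) x y) = unseen C (Suc k) x y" for x y
    proof -
      have "unseen C k x (unseen C (Suc k) x y) = (resid k (sym_part x + C) ** resid (Suc k) (sym_part x + C)) ** y ** (resid (Suc k) (sym_part x + C) ** resid k (sym_part x + C))"
        by (simp only: unseen_def matrix_mul_assoc)
      then show ?thesis by (simp only: rr unseen_def)
    qed
    show "unseen C (Suc k) (x + unseen C k x z) = unseen C (Suc k) x" for x z
      unfolding unseen_def[of C "Suc k"] resid_unseen[OF C k order_refl] ..
  qed
qed

definition overlap :: "real^'d \<Rightarrow> real^'d^'d \<Rightarrow> nat \<Rightarrow> real" where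
  "overlap u M k = (\<Sum>i=1..k. (qry alg M i \<bullet> u)\<^sup>2)"

lemma overlap_nonneg: "0 \<le> overlap u M k"
  by (simp add: overlap_def sum_nonneg)

lemma measurable_overlap:
  assumes k: "k \<le> N" and [measurable]: "g \<in> borel_measurable M" "u \<in> borel_measurable M"
  shows "(\<lambda>x. overlap (u x) (g x) k) \<in> borel_measurable M"
proof -
  have [measurable]: "(\<lambda>x. qry alg (g x) i) \<in> borel_measurable M" if "i \<in> {1..k}" for i
    using that k by (intro measurable_qry' \<open>g \<in> borel_measurable M\<close>) auto
  show ?thesis unfolding overlap_def by measurable
qed

lemma resid_inner:
  assumes M: "transpose M = M" and k: "k \<le> N" and u: "norm u = 1"
  shows "(resid k M *v u) \<bullet> (resid k M *v u) = 1 - overlap u M k"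
proof -
  have "(resid k M *v u) \<bullet> (resid k M *v u) = u \<bullet> (resid k M *v u)"
    using resid_resid(1)[OF M order_refl k] by (simp add: inner_matrix_vector_left matrix_vector_mul_assoc)
  also have "\<dots> = 1 - overlap u M k"
    using u by (simp add: resid_mult inner_diff_right inner_sum_right overlap_def power2_eq_square inner_commute dot_square_norm)
  finally show ?thesis .
qed

text \<open>Change of measure: the law of the history with spike \<open>\<beta> u u\<^sup>T\<close> has likelihood ratio
  \<open>exp (G \<bullet> D - |D|\<^sup>2 / 2)\<close> with \<open>|D|\<^sup>2 \<le> 2 \<beta>\<^sup>2 overlap\<close> against the law without spike; its
  \<open>p\<close>-th moment is controlled by the same formula for the spike \<open>p \<beta> u u\<^sup>T\<close>, and Young's
  inequality with exponent \<open>p\<close> decouples it from the next query.\<close>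

lemma overlap_exp_moment_fixed:
  fixes u :: "real^'d" and C :: "real^'d^'d" and p a s \<beta> B :: real
  assumes C: "transpose C = C" and u: "norm u = 1" and k: "Suc k \<le> N"
    and p: "p > 1" and s: "(p - 1) * \<beta>\<^sup>2 \<le> s" and B: "B > 0"
  shows "(\<integral>\<^sup>+G. ennreal (exp (a * overlap u (sym_part (G + \<beta> *\<^sub>R outer u) + C) (Suc k)
        - s * overlap u (sym_part (G + \<beta> *\<^sub>R outer u) + C) k)) \<partial>std_gauss)
    \<le> ennreal (B powr (1 - 1 / p)) * (ennreal (1 / p) + ennreal ((1 - 1 / p) / B) *
      (\<integral>\<^sup>+G. ennreal (exp (a / (1 - 1 / p) * overlap u (sym_part G + C) (Suc k))) \<partial>std_gauss))"
proof -
  interpret G: prob_space "std_gauss :: (real^'d^'d) measure" by (rule prob_space_std_gauss)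
  have kN: "k \<le> N" using k by simp
  define \<Phi> where "\<Phi> j G = overlap u (sym_part G + C) j" for j G
  have [measurable]: "\<Phi> k \<in> borel_measurable borel" "\<Phi> (Suc k) \<in> borel_measurable borel"
    unfolding \<Phi>_def by (intro measurable_overlap k kN; measurable)+
  have \<Phi>inv: "\<Phi> j (G + unseen C k G Z) = \<Phi> j G" if "j \<le> Suc k" for j G Z
    unfolding \<Phi>_def overlap_def using that by (intro sum.cong refl) (simp add: qry_unseen[OF C kN])
  have res: "resampling (unseen C k)" by (rule resampling_unseen[OF C kN])
  define b where "b = \<beta> *\<^sub>R outer u"
  \<comment> \<open>The squared norm of the seen part of the shift \<open>b\<close>.\<close>
  define q where "q G = b \<bullet> b - unseen C k G b \<bullet> unseen C k G b" for G
  have unsb: "unseen C k G b = \<beta> *\<^sub>R outer (resid k (sym_part G + C) *v u)" for G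
  proof -
    have "linear (unseen C k G)" using res by (simp add: resampling_def ortho_proj_def)
    then have "unseen C k G b = \<beta> *\<^sub>R unseen C k G (outer u)" unfolding b_def by (rule linear_cmul)
    then show ?thesis by (simp add: unseen_def conj_outer)
  qed
  have q: "0 \<le> q G" "q G \<le> 2 * \<beta>\<^sup>2 * \<Phi> k G" for G
  proof -
    \<comment> \<open>The unseen part of \<open>outer u\<close> is the outer square of the residual
      of \<open>u\<close>, whose squared norm is \<open>1 - \<Phi> k G\<close>.\<close>
    have "q G = \<beta>\<^sup>2 * (1 - (1 - \<Phi> k G)\<^sup>2)"
      using u unfolding q_def unsb unfolding b_def inner_scaleR_left inner_scaleR_right outer_inner_outer
        resid_inner[OF transpose_add_sym[OF C] kN u] \<Phi>_def
      by (simp add: dot_square_norm power2_eq_square algebra_simps)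
    moreover have "0 \<le> \<Phi> k G" by (simp add: \<Phi>_def overlap_nonneg)
    moreover have "\<Phi> k G \<le> 1"
    proof -
      have "0 \<le> (resid k (sym_part G + C) *v u) \<bullet> (resid k (sym_part G + C) *v u)" by simp
      then show ?thesis unfolding resid_inner[OF transpose_add_sym[OF C] kN u] \<Phi>_def by simp
    qed
    moreover have "1 - (1 - x)\<^sup>2 \<le> 2 * x" for x :: real by (simp add: power2_eq_square algebra_simps)
    moreover have "0 \<le> 1 - (1 - x)\<^sup>2" if "0 \<le> x" "x \<le> 1" for x :: real
      using that power_le_one[of "1 - x" 2] by simp
    ultimately show "0 \<le> q G" "q G \<le> 2 * \<beta>\<^sup>2 * \<Phi> k G"
      by (simp_all add: mult.commute[of 2] mult.assoc mult_left_mono)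
  qed
  define L where "L G = G \<bullet> (b - unseen C k G b)" for G
  define Y where "Y G = exp (a / (1 - 1 / p) * \<Phi> (Suc k) G)" for G
  have [measurable]: "(\<lambda>G. unseen C k G b) \<in> borel_measurable borel"
  proof -
    have [measurable]: "(\<lambda>x. resid k (sym_part x + C)) \<in> borel_measurable borel"
      by (rule measurable_resid[OF kN]) measurable
    show ?thesis unfolding unseen_def by measurable
  qed
  have [measurable]: "q \<in> borel_measurable borel" "L \<in> borel_measurable borel" "Y \<in> borel_measurable borel"
    unfolding q_def L_def Y_def by measurable
  \<comment> \<open>The shift formula for the constant 1 and the spike \<open>p *\<^sub>R b\<close>:
    a likelihood ratio integrates to one.\<close>
  have one: "(\<integral>\<^sup>+G. ennreal (exp (p * L G - p\<^sup>2 * q G / 2)) \<partial>std_gauss) = 1"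
  proof -
    have lin: "linear (unseen C k G)" for G using res by (simp add: resampling_def ortho_proj_def)
    have "1 = (\<integral>\<^sup>+G. 1 * ennreal (exp (G \<bullet> (p *\<^sub>R b - unseen C k G (p *\<^sub>R b)) - ((p *\<^sub>R b) \<bullet> (p *\<^sub>R b) - unseen C k G (p *\<^sub>R b) \<bullet> unseen C k G (p *\<^sub>R b)) / 2)) \<partial>std_gauss)"
      using resampling_shift[OF res, of "\<lambda>_. 1" "p *\<^sub>R b"] G.emeasure_space_1 by simp
    also have "\<dots> = (\<integral>\<^sup>+G. ennreal (exp (p * L G - p\<^sup>2 * q G / 2)) \<partial>std_gauss)"
      unfolding linear_cmul[OF lin] L_def q_def
      by (intro nn_integral_cong) (simp add: power2_eq_square inner_diff_right algebra_simps)
    finally show ?thesis by simp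
  qed
  have "(\<integral>\<^sup>+G. ennreal (exp (a * \<Phi> (Suc k) (G + b) - s * \<Phi> k (G + b))) \<partial>std_gauss)
    = (\<integral>\<^sup>+G. ennreal (exp (a * \<Phi> (Suc k) G - s * \<Phi> k G)) * ennreal (exp (L G - q G / 2)) \<partial>std_gauss)"
    unfolding L_def q_def
    by (rule resampling_shift[OF res]) (measurable, simp add: \<Phi>inv)
  also have "\<dots> \<le> (\<integral>\<^sup>+G. ennreal (B powr (1 - 1 / p)) * (ennreal (1 / p) * ennreal (exp (p * L G - p\<^sup>2 * q G / 2)) + ennreal ((1 - 1 / p) / B) * ennreal (Y G)) \<partial>std_gauss)"
  proof (intro nn_integral_mono)
    fix G
    define \<theta> where "\<theta> = 1 - 1 / p"
    have \<theta>: "0 < \<theta>" "1 / p + \<theta> = 1" using p by (simp_all add: \<theta>_def field_simps)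
    \<comment> \<open>The likelihood ratio together with the discount \<open>s * \<Phi> k G\<close>,
      raised to the power \<open>p\<close>. Young's inequality is then applied to \<open>x\<close>
      and \<open>Y G / B\<close>, with \<open>B\<close> a free scale.\<close>
    define x where "x = exp (p * (L G - q G / 2 - s * \<Phi> k G))"
    have "exp (a * \<Phi> (Suc k) G - s * \<Phi> k G) * exp (L G - q G / 2) = x powr (1 / p) * Y G powr \<theta>"
      using p \<theta>(1) unfolding x_def Y_def \<theta>_def[symmetric]
      by (simp add: powr_def exp_add[symmetric])
    also have "\<dots> = B powr \<theta> * (x powr (1 / p) * (Y G / B) powr \<theta>)"
      using B by (simp add: powr_divide Y_def)
    also have "\<dots> \<le> B powr \<theta> * (1 / p * x + \<theta> * (Y G / B))"
      using B p \<theta> by (intro mult_left_mono Youngs_inequality_0) (auto simp: x_def Y_def)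
    also have "\<dots> \<le> B powr \<theta> * (1 / p * exp (p * L G - p\<^sup>2 * q G / 2) + \<theta> / B * Y G)"
    proof -
      \<comment> \<open>Passing from \<open>p * q G / 2\<close> to
        \<open>p\<^sup>2 * q G / 2\<close> costs \<open>p * (p - 1) * q G / 2\<close>; the discount
        with rate \<open>s\<close> pays for it.\<close>
      have "(p - 1) * q G / 2 \<le> (p - 1) * (2 * \<beta>\<^sup>2 * \<Phi> k G) / 2"
        using p q(2)[of G] by (intro divide_right_mono mult_left_mono) auto
      also have "\<dots> = ((p - 1) * \<beta>\<^sup>2) * \<Phi> k G" by simp
      also have "\<dots> \<le> s * \<Phi> k G" using s overlap_nonneg by (intro mult_right_mono) (auto simp: \<Phi>_def)
      finally have "p * ((p - 1) * q G / 2) \<le> p * (s * \<Phi> k G)" using p by (intro mult_left_mono) auto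
      then have "p * (L G - q G / 2 - s * \<Phi> k G) \<le> p * L G - p\<^sup>2 * q G / 2"
        by (simp add: power2_eq_square algebra_simps)
      then have "x \<le> exp (p * L G - p\<^sup>2 * q G / 2)" by (simp add: x_def)
      then show ?thesis using B p by (intro mult_left_mono add_mono) auto
    qed
    finally have "ennreal (exp (a * \<Phi> (Suc k) G - s * \<Phi> k G) * exp (L G - q G / 2))
      \<le> ennreal (B powr \<theta> * (1 / p * exp (p * L G - p\<^sup>2 * q G / 2) + \<theta> / B * Y G))" by (rule ennreal_leI)
    then show "ennreal (exp (a * \<Phi> (Suc k) G - s * \<Phi> k G)) * ennreal (exp (L G - q G / 2))
      \<le> ennreal (B powr (1 - 1 / p)) * (ennreal (1 / p) * ennreal (exp (p * L G - p\<^sup>2 * q G / 2)) + ennreal ((1 - 1 / p) / B) * ennreal (Y G))"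
      using p B \<theta> unfolding \<theta>_def[symmetric] by (simp add: Y_def flip: ennreal_mult ennreal_plus)
  qed
  also have "\<dots> = ennreal (B powr (1 - 1 / p)) * (ennreal (1 / p) + ennreal ((1 - 1 / p) / B) * (\<integral>\<^sup>+G. ennreal (Y G) \<partial>std_gauss))"
    by (simp add: nn_integral_cmult nn_integral_add one)
  finally show ?thesis by (simp add: \<Phi>_def Y_def b_def)
qed

end

text \<open>On symmetric matrices \<open>sym_part\<close> is multiplication by
  \<open>sqrt (2 / d)\<close>, so a spike of strength \<open>lam\<close> is a shift of
  \<open>G\<close> by \<open>lam * sqrt (d / 2)\<close> times \<open>outer u\<close>.\<close>

lemma sym_part_scale_outer:
  fixes u :: "real^'d"
  shows "sym_part ((lam * sqrt (real CARD('d) / 2)) *\<^sub>R outer u) = lam *\<^sub>R outer u"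
proof -
  have "sqrt (2 * real CARD('d)) = 2 * sqrt (real CARD('d) / 2)"
    by (rule real_sqrt_unique) (simp_all add: power_mult_distrib)
  then have 1: "1 / sqrt (2 * real CARD('d)) * (2 * (lam * sqrt (real CARD('d) / 2))) = lam"
    by simp
  have "sym_part (c *\<^sub>R outer u) = (1 / sqrt (2 * real CARD('d)) * (2 * c)) *\<^sub>R outer u" for c
    by (simp add: sym_part_def transpose_scaleR scaleR_2[symmetric])
  then show ?thesis using 1 by metis
qed

lemma outer_part_eq: "outer_part b V = V ** transpose V - outer (V *v b)"
  by (simp add: outer_part_def outer_def)

section \<open>One round in the spiked model\<close>

context querying begin

definition spiked :: "real \<Rightarrow> real^'r^'d \<Rightarrow> real^'d^'d \<Rightarrow> real^'d^'d" where
  "spiked lam V A = A + lam *\<^sub>R (V ** transpose V)"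

abbreviation spike_overlap :: "real \<Rightarrow> real^'r^'d \<Rightarrow> real^'d^'d \<Rightarrow> real^'r \<Rightarrow> nat \<Rightarrow> real" where
  "spike_overlap lam V G b \<equiv> overlap (V *v b) (spiked lam V (sym_part G))"

lemma measurable_spiked [measurable]:
  assumes [measurable]: "f \<in> borel_measurable M" "g \<in> borel_measurable M"
  shows "(\<lambda>x. spiked lam (f x) (g x)) \<in> borel_measurable M"
  unfolding spiked_def by measurable

text \<open>The fixed-direction bound with Young exponent \<open>lam\<close>, averaged over the
  frame. The values of \<open>a\<close> and \<open>s\<close> are forced by
  \<open>a / (1 - 1 / lam) = t * m\<close> and
  \<open>s = (lam - 1) * \<beta>\<^sup>2\<close>.\<close>

lemma overlap_exp_moment:
  fixes \<mu> :: "(real^'r^'d) measure"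
  assumes \<mu>: "uniform_Stiefel \<mu>" and b: "norm b = 1" and lam: "lam > 1" and k: "Suc k \<le> N"
    and rd: "CARD('r) \<le> CARD('d)"
  defines "a \<equiv> (lam - 1) * real (CARD('d) + 1 - CARD('r)) / (2 * lam\<^sup>2)"
    and "s \<equiv> (lam - 1) * lam\<^sup>2 * real CARD('d) / 2"
  shows "(\<integral>\<^sup>+V. (\<integral>\<^sup>+G. ennreal (exp (a * spike_overlap lam V G b (Suc k)
      - s * spike_overlap lam V G b k)) \<partial>std_gauss) \<partial>\<mu>) \<le> ennreal (exp (real (Suc k) / (2 * lam)))"
proof -
  interpret G: prob_space "std_gauss :: (real^'d^'d) measure" by (rule prob_space_std_gauss)
  interpret M: prob_space \<mu> using \<mu> by (simp add: uniform_Stiefel_def)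
  interpret GM: pair_sigma_finite "std_gauss :: (real^'d^'d) measure" \<mu> ..
  have sets [measurable_cong]: "sets \<mu> = sets borel" using \<mu> by (simp add: uniform_Stiefel_def)
  have St: "AE V in \<mu>. V \<in> Stiefel" using \<mu> by (simp add: uniform_Stiefel_def)
  define \<beta> where "\<beta> = lam * sqrt (real CARD('d) / 2)"
  define m where "m = real (CARD('d) + 1 - CARD('r))"
  define \<theta> where "\<theta> = 1 - 1 / lam"
  \<comment> \<open>Chosen to make \<open>1 - 2 * t\<close> equal to
    \<open>\<theta>\<close>.\<close>
  define t where "t = 1 / (2 * lam)"
  \<comment> \<open>The bound on the moment of \<open>Y\<close>. With this scale the two terms of
    Young's inequality add up to \<open>1 / lam + \<theta> = 1\<close>, and
    \<open>B powr \<theta>\<close> remains.\<close>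
  define B where "B = (1 / sqrt \<theta>) ^ Suc k"
  have \<theta>: "0 < \<theta>" "\<theta> < 1" "1 / lam + \<theta> = 1" using lam by (simp_all add: \<theta>_def)
  have t: "0 \<le> t" "t < 1 / 2" "1 - 2 * t = \<theta>" using lam by (simp_all add: t_def \<theta>_def)
  have B: "B > 0" using \<theta> by (simp add: B_def)
  have at: "a / (1 - 1 / lam) = t * m"
    using lam by (simp add: a_def m_def t_def divide_simps power2_eq_square)
  define C where "C V = lam *\<^sub>R outer_part b V" for V :: "real^'r^'d"
  have tC: "transpose (C V) = C V" for V
    by (simp add: C_def transpose_scaleR)
  have [measurable]: "C \<in> borel_measurable borel" unfolding C_def by measurable
  have eq: "sym_part (G + \<beta> *\<^sub>R outer (V *v b)) + C V = spiked lam V (sym_part G)" for G V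
    by (simp add: sym_part_add \<beta>_def sym_part_scale_outer C_def outer_part_eq spiked_def scaleR_diff_right)
  define Y where "Y V G = ennreal (exp (t * m * overlap (V *v b) (sym_part G + C V) (Suc k)))" for V :: "real^'r^'d" and G
  have Ym [measurable]: "(\<lambda>x. Y (f x) (g x)) \<in> borel_measurable L" if [measurable]: "f \<in> borel_measurable L" "g \<in> borel_measurable L" for f g and L :: "'x measure"
  proof -
    have [measurable]: "(\<lambda>x. overlap (f x *v b) (sym_part (g x) + C (f x)) (Suc k)) \<in> borel_measurable L"
      by (rule measurable_overlap[OF k]) measurable
    show ?thesis unfolding Y_def by measurable
  qed
  have "(\<integral>\<^sup>+V. (\<integral>\<^sup>+G. ennreal (exp (a * spike_overlap lam V G b (Suc k)
      - s * spike_overlap lam V G b k)) \<partial>std_gauss) \<partial>\<mu>)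
    \<le> (\<integral>\<^sup>+V. ennreal (B powr \<theta>) * (ennreal (1 / lam) + ennreal (\<theta> / B) * (\<integral>\<^sup>+G. Y V G \<partial>std_gauss)) \<partial>\<mu>)"
  proof (rule nn_integral_mono_AE, use St in eventually_elim)
    case (elim V)
    have u: "norm (V *v b) = 1" using Stiefel_inner[OF elim, of b b] b by (simp add: norm_eq_sqrt_inner)
    have "(lam - 1) * \<beta>\<^sup>2 \<le> s" by (simp add: \<beta>_def s_def power_mult_distrib)
    from overlap_exp_moment_fixed[OF tC[of V] u k lam this B, of a] show ?case
      unfolding eq at Y_def \<theta>_def .
  qed
  also have "\<dots> = ennreal (B powr \<theta>) * (ennreal (1 / lam) + ennreal (\<theta> / B) * (\<integral>\<^sup>+V. (\<integral>\<^sup>+G. Y V G \<partial>std_gauss) \<partial>\<mu>))"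
    using M.emeasure_space_1 by (simp add: nn_integral_cmult nn_integral_add)
  \<comment> \<open>Once \<open>G\<close> is fixed, the queries depend on \<open>V\<close> only
    through \<open>outer_part b V\<close>, so the moment bound for a uniform direction
    applies.\<close>
  also have "(\<integral>\<^sup>+V. (\<integral>\<^sup>+G. Y V G \<partial>std_gauss) \<partial>\<mu>) = (\<integral>\<^sup>+G. (\<integral>\<^sup>+V. Y V G \<partial>\<mu>) \<partial>std_gauss)"
    by (rule GM.Fubini') measurable
  also have "\<dots> \<le> (\<integral>\<^sup>+G. ennreal B \<partial>(std_gauss :: (real^'d^'d) measure))"
  proof (intro nn_integral_mono)
    fix G :: "real^'d^'d"
    have "(\<integral>\<^sup>+V. ennreal (exp (t * m * (\<Sum>i\<in>{1..Suc k}. (qry alg (sym_part G + lam *\<^sub>R outer_part b V) i \<bullet> (V *v b))\<^sup>2))) \<partial>\<mu>)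
      \<le> ennreal ((1 / sqrt (1 - 2 * t)) ^ card {1..Suc k})"
      unfolding m_def
    proof (rule uniform_Stiefel_exp_square_le[where v="\<lambda>C. qry alg (sym_part G + lam *\<^sub>R C)", OF \<mu> b _ _ _ t(1,2) rd])
      show "qry alg (sym_part G + lam *\<^sub>R C) i \<bullet> qry alg (sym_part G + lam *\<^sub>R C) j = (if i = j then 1 else 0)"
        if "transpose C = C" "i \<in> {1..Suc k}" "j \<in> {1..Suc k}" for C i j
      proof (rule qry_orthonormal)
        show "transpose (sym_part G + lam *\<^sub>R C) = sym_part G + lam *\<^sub>R C"
          using that(1) by (intro transpose_add_sym) (simp add: transpose_scaleR)
      qed (use that k in auto)
      show "(\<lambda>C. qry alg (sym_part G + lam *\<^sub>R C) i) \<in> borel_measurable borel" if "i \<in> {1..Suc k}" for i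
        using that k by (intro measurable_qry') auto
    qed simp
    then show "(\<integral>\<^sup>+V. Y V G \<partial>\<mu>) \<le> ennreal B"
      unfolding t(3) by (simp add: Y_def overlap_def C_def B_def)
  qed
  also have "\<dots> = ennreal B" using G.emeasure_space_1 by simp
  finally have "(\<integral>\<^sup>+V. (\<integral>\<^sup>+G. ennreal (exp (a * spike_overlap lam V G b (Suc k)
      - s * spike_overlap lam V G b k)) \<partial>std_gauss) \<partial>\<mu>)
    \<le> ennreal (B powr \<theta>) * (ennreal (1 / lam) + ennreal (\<theta> / B) * ennreal B)"
    by (simp add: mult_left_mono add_left_mono)
  also have "\<dots> = ennreal (B powr \<theta>)"
    using B \<theta> lam by (simp flip: ennreal_mult ennreal_plus)
  also have "\<dots> \<le> ennreal (exp (real (Suc k) / (2 * lam)))"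
  proof (rule ennreal_leI)
    \<comment> \<open>Gives \<open>- \<theta> * ln \<theta> \<le> 1 - \<theta> = 1 / lam\<close>, so
      \<open>B powr \<theta>\<close> stays moderate even when \<open>\<theta>\<close> is close to
      0.\<close>
    have "- ln \<theta> \<le> 1 / \<theta> - 1"
      using ln_le_minus_one[of "1 / \<theta>"] \<theta> by (simp add: ln_div)
    then have "\<theta> * (- ln \<theta>) \<le> \<theta> * (1 / \<theta> - 1)" using \<theta> by (intro mult_left_mono) auto
    also have "\<dots> = 1 / lam" using \<theta> by (simp add: right_diff_distrib)
    finally have "(real k + 1) / 2 * (\<theta> * (- ln \<theta>)) \<le> (real k + 1) / 2 * (1 / lam)"
      by (intro mult_left_mono) auto
    moreover have "ln B = (real k + 1) / 2 * (- ln \<theta>)"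
      using \<theta> by (simp add: B_def ln_mult ln_realpow ln_div ln_sqrt field_simps)
    ultimately have "\<theta> * ln B \<le> (real k + 1) / (2 * lam)" by (simp add: mult_ac)
    then show "B powr \<theta> \<le> exp (real (Suc k) / (2 * lam))"
      using B by (simp add: powr_def add.commute)
  qed
  finally show ?thesis .
qed

text \<open>Markov's inequality for the exponential moment. The factor \<open>lam ^ 5\<close> is an
  upper bound for \<open>s / a = lam ^ 4 * d / m\<close>, using \<open>dm\<close>.\<close>

lemma overlap_growth_tail:
  fixes \<mu> :: "(real^'r^'d) measure"
  assumes \<mu>: "uniform_Stiefel \<mu>" and b: "norm b = 1" and lam: "lam > 1" and k: "Suc k \<le> N"
    and rd: "CARD('r) \<le> CARD('d)" and dm: "real CARD('d) \<le> lam * real (CARD('d) + 1 - CARD('r))"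
  defines "a \<equiv> (lam - 1) * real (CARD('d) + 1 - CARD('r)) / (2 * lam\<^sup>2)"
  shows "(\<integral>\<^sup>+V. (\<integral>\<^sup>+G. indicator {lam ^ 5 * spike_overlap lam V G b k + c <..}
      (spike_overlap lam V G b (Suc k)) \<partial>std_gauss) \<partial>\<mu>)
    \<le> ennreal (exp (real (Suc k) / (2 * lam) - a * c))"
proof -
  define s where "s = (lam - 1) * lam\<^sup>2 * real CARD('d) / 2"
  have sets [measurable_cong]: "sets \<mu> = sets borel" using \<mu> by (simp add: uniform_Stiefel_def)
  interpret G: prob_space "std_gauss :: (real^'d^'d) measure" by (rule prob_space_std_gauss)
  have [measurable]: "(\<lambda>x. overlap (f x *v b) (spiked lam (f x) (sym_part (g x))) j) \<in> borel_measurable L"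
    if "j \<le> Suc k" and [measurable]: "f \<in> borel_measurable L" "g \<in> borel_measurable L" for f :: "'x \<Rightarrow> real^'r^'d" and g j and L :: "'x measure"
    using that k by (intro measurable_overlap) (auto, measurable)
  have a: "a > 0" using lam rd by (simp add: a_def)
  have sa: "s \<le> a * lam ^ 5"
  proof -
    have "(lam - 1) * lam\<^sup>2 * real CARD('d) / 2 \<le> (lam - 1) * lam\<^sup>2 * (lam * real (CARD('d) + 1 - CARD('r))) / 2"
      using lam dm by (intro divide_right_mono mult_left_mono) auto
    also have "\<dots> = a * lam ^ 5" using lam by (simp add: a_def field_simps eval_nat_numeral)
    finally show ?thesis by (simp add: s_def)
  qed
  let ?f = "\<lambda>V G. ennreal (exp (a * spike_overlap lam V G b (Suc k)
      - s * spike_overlap lam V G b k))"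
  have "(\<integral>\<^sup>+V. (\<integral>\<^sup>+G. indicator {lam ^ 5 * spike_overlap lam V G b k + c <..}
      (spike_overlap lam V G b (Suc k)) \<partial>std_gauss) \<partial>\<mu>)
    \<le> (\<integral>\<^sup>+V. (\<integral>\<^sup>+G. ennreal (exp (- a * c)) * ?f V G \<partial>std_gauss) \<partial>\<mu>)"
  proof (intro nn_integral_mono)
    fix V :: "real^'r^'d" and G :: "real^'d^'d"
    let ?x = "spike_overlap lam V G b k" and ?y = "spike_overlap lam V G b (Suc k)"
    show "indicator {lam ^ 5 * ?x + c <..} ?y \<le> ennreal (exp (- a * c)) * ?f V G"
    proof (cases "?y > lam ^ 5 * ?x + c")
      case True
      then have "a * (lam ^ 5 * ?x + c) \<le> a * ?y" using a by (intro mult_left_mono) auto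
      moreover have "s * ?x \<le> (a * lam ^ 5) * ?x" using sa overlap_nonneg by (rule mult_right_mono)
      ultimately have "0 \<le> - a * c + (a * ?y - s * ?x)" by (simp add: algebra_simps)
      then have "1 \<le> exp (- a * c) * exp (a * ?y - s * ?x)" by (simp add: exp_add[symmetric])
      then show ?thesis using True by (simp flip: ennreal_mult)
    qed simp
  qed
  also have "\<dots> = ennreal (exp (- a * c)) * (\<integral>\<^sup>+V. (\<integral>\<^sup>+G. ?f V G \<partial>std_gauss) \<partial>\<mu>)"
    by (simp add: nn_integral_cmult)
  also have "\<dots> \<le> ennreal (exp (- a * c)) * ennreal (exp (real (Suc k) / (2 * lam)))"
    using overlap_exp_moment[OF \<mu> b lam k rd] by (intro mult_left_mono) (simp_all add: a_def s_def)
  also have "\<dots> = ennreal (exp (real (Suc k) / (2 * lam) - a * c))"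
    by (simp add: exp_add[symmetric] exp_diff exp_minus field_simps flip: ennreal_mult)
  finally show ?thesis .
qed

end

text \<open>Passage to the concrete model: independence makes the joint law a product, and the law
  of \<open>W\<close> is that of \<open>sym_part\<close> under \<open>std_gauss\<close>.\<close>

lemma nn_integral_indep_GOE:
  fixes W :: "'w \<Rightarrow> real^('d::{finite,linorder})^('d::_)" and U :: "'w \<Rightarrow> real^'r^('d::_)"
  assumes \<Omega>: "prob_space \<Omega>" and W: "is_GOE \<Omega> W" and ind: "indep_rv \<Omega> borel W borel U"
    and f [measurable]: "f \<in> borel_measurable (borel \<Otimes>\<^sub>M borel)"
  shows "(\<integral>\<^sup>+\<omega>. f (U \<omega>, W \<omega>) \<partial>\<Omega>) = (\<integral>\<^sup>+V. (\<integral>\<^sup>+G. f (V, sym_part G) \<partial>std_gauss) \<partial>distr \<Omega> borel U)"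
proof -
  interpret prob_space \<Omega> by fact
  have [measurable]: "W \<in> borel_measurable \<Omega>" "U \<in> borel_measurable \<Omega>"
    using ind by (auto simp: indep_rv_def)
  have ms [measurable]: "(\<lambda>G. sym_part G :: ((real, 'd) vec, 'd) vec) \<in> borel_measurable borel"
    unfolding sym_part_def by measurable
  have law: "distr \<Omega> borel W = distr std_gauss borel sym_part"
    by (rule is_GOE_law_unique[OF \<Omega> W prob_space_std_gauss is_GOE_sym_part])
  have seq: "sets (distr \<Omega> borel U \<Otimes>\<^sub>M distr \<Omega> borel W) = sets (borel \<Otimes>\<^sub>M borel)"
    by (intro sets_pair_measure_cong sets_distr)
  have "distr \<Omega> borel U \<Otimes>\<^sub>M distr \<Omega> borel W = distr \<Omega> (borel \<Otimes>\<^sub>M borel) (\<lambda>\<omega>. (U \<omega>, W \<omega>))"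
  proof (rule pair_measure_eqI)
    show "sigma_finite_measure (distr \<Omega> borel U)" "sigma_finite_measure (distr \<Omega> borel W)"
      by (intro prob_space_imp_sigma_finite prob_space_distr; measurable)+
    show "sets (distr \<Omega> borel U \<Otimes>\<^sub>M distr \<Omega> borel W) = sets (distr \<Omega> (borel \<Otimes>\<^sub>M borel) (\<lambda>\<omega>. (U \<omega>, W \<omega>)))"
      unfolding sets_distr by (rule seq)
    fix A B assume "A \<in> sets (distr \<Omega> borel U)" "B \<in> sets (distr \<Omega> borel W)"
    then have AB [measurable]: "A \<in> sets borel" "B \<in> sets borel" by auto
    have "indep_set {W -` A \<inter> space \<Omega> | A. A \<in> sets borel} {U -` B \<inter> space \<Omega> | B. B \<in> sets borel}"
      using ind by (simp add: indep_rv_def)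
    then have "prob ((W -` B \<inter> space \<Omega>) \<inter> (U -` A \<inter> space \<Omega>)) = prob (W -` B \<inter> space \<Omega>) * prob (U -` A \<inter> space \<Omega>)"
      by (rule indep_setD) (use AB in auto)
    moreover have "(\<lambda>\<omega>. (U \<omega>, W \<omega>)) -` (A \<times> B) \<inter> space \<Omega> = (W -` B \<inter> space \<Omega>) \<inter> (U -` A \<inter> space \<Omega>)" by auto
    ultimately show "emeasure (distr \<Omega> borel U) A * emeasure (distr \<Omega> borel W) B = emeasure (distr \<Omega> (borel \<Otimes>\<^sub>M borel) (\<lambda>\<omega>. (U \<omega>, W \<omega>))) (A \<times> B)"
      by (simp add: emeasure_distr emeasure_eq_measure mult.commute flip: ennreal_mult)
  qed
  then have "(\<integral>\<^sup>+\<omega>. f (U \<omega>, W \<omega>) \<partial>\<Omega>) = (\<integral>\<^sup>+x. f x \<partial>(distr \<Omega> borel U \<Otimes>\<^sub>M distr \<Omega> borel W))"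
    by (simp add: nn_integral_distr)
  also have "\<dots> = (\<integral>\<^sup>+V. (\<integral>\<^sup>+A. f (V, A) \<partial>distr \<Omega> borel W) \<partial>distr \<Omega> borel U)"
  proof -
    interpret D: prob_space "distr \<Omega> borel W" by (intro prob_space_distr) measurable
    show ?thesis by (rule D.nn_integral_fst[symmetric]) (simp only: f measurable_cong_sets[OF seq refl])
  qed
  also have "\<dots> = (\<integral>\<^sup>+V. (\<integral>\<^sup>+G. f (V, sym_part G) \<partial>std_gauss) \<partial>distr \<Omega> borel U)"
    unfolding law by (intro nn_integral_cong nn_integral_distr) measurable
  finally show ?thesis .
qed

section \<open>From directions to eigenvalues\<close>

lemma inner_matrix_vector_right:
  fixes A :: "real^'n^'m"
  shows "y \<bullet> (A *v x) = (transpose A *v y) \<bullet> x"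
  unfolding transpose_matrix_vector dot_lmul_matrix ..

text \<open>Adding \<open>\<kappa>\<close> times the identity turns the additive error
  \<open>\<kappa> * (\<rho> - 1)\<close> into pure multiplicative growth by \<open>\<rho>\<close>.
  The determinant starts at \<open>\<kappa> ^ CARD('n)\<close> and gains at most a factor
  \<open>\<rho>\<close> per update.\<close>

lemma nth_eigenvalue_rank_one_growth:
  fixes A :: "nat \<Rightarrow> real^'n^'n"
  assumes A0: "A 0 = 0" and AS: "\<And>k. k < K \<Longrightarrow> A (Suc k) = A k + outer (y k)"
    and le: "\<And>k x. k < K \<Longrightarrow> x \<bullet> (A k *v x) + (y k \<bullet> x)\<^sup>2 \<le> \<rho> * (x \<bullet> (A k *v x)) + \<kappa> * (\<rho> - 1) * (x \<bullet> x)"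
    and \<rho>: "\<rho> > 1" and \<kappa>: "\<kappa> > 0" and i: "i \<in> {1..CARD('n)}"
  shows "nth_eigenvalue i (A K) \<le> (\<rho> ^ K) powr (1 / i) * \<kappa>"
proof -
  have inv: "transpose (A k) = A k \<and> (\<forall>x. 0 \<le> x \<bullet> (A k *v x)) \<and> det (A k + \<kappa> *\<^sub>R mat 1) \<le> \<rho> ^ k * \<kappa> ^ CARD('n)"
    if "k \<le> K" for k
    using that
  proof (induction k)
    case 0
    have "det (0 + \<kappa> *\<^sub>R mat 1 :: real^'n^'n) = \<kappa> ^ CARD('n)"
      by (subst det_diagonal) (auto simp: mat_def)
    moreover have "transpose (0 :: real^'n^'n) = 0" by (simp add: transpose_def vec_eq_iff)
    moreover have "(0 :: real^'n^'n) *v x = 0" for x by (simp add: matrix_vector_mult_def vec_eq_iff)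
    ultimately show ?case by (simp add: A0)
  next
    case (Suc k)
    then have IH: "transpose (A k) = A k" "\<And>x. 0 \<le> x \<bullet> (A k *v x)" "det (A k + \<kappa> *\<^sub>R mat 1) \<le> \<rho> ^ k * \<kappa> ^ CARD('n)"
      by auto
    have quad: "x \<bullet> ((A k + \<kappa> *\<^sub>R mat 1) *v x) = x \<bullet> (A k *v x) + \<kappa> * (x \<bullet> x)" for x
      by (simp add: matrix_vector_mult_add_rdistrib inner_add_right scaleR_matrix_vector_assoc[symmetric])
    have "det ((A k + \<kappa> *\<^sub>R mat 1) + outer (y k)) \<le> \<rho> * det (A k + \<kappa> *\<^sub>R mat 1)"
    proof (rule det_add_outer_le)
      show "transpose (A k + \<kappa> *\<^sub>R mat 1) = A k + \<kappa> *\<^sub>R mat 1" by (simp add: transpose_plus transpose_scaleR IH)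
      show "0 < x \<bullet> ((A k + \<kappa> *\<^sub>R mat 1) *v x)" if "x \<noteq> 0" for x
        unfolding quad using IH(2)[of x] \<kappa> that by (intro add_nonneg_pos) auto
      show "x \<bullet> ((A k + \<kappa> *\<^sub>R mat 1) *v x) + (y k \<bullet> x)\<^sup>2 \<le> \<rho> * (x \<bullet> ((A k + \<kappa> *\<^sub>R mat 1) *v x))" for x
        unfolding quad using le[of k x] Suc.prems by (simp add: algebra_simps)
      show "1 \<le> \<rho>" using \<rho> by simp
    qed
    also have "\<dots> \<le> \<rho> * (\<rho> ^ k * \<kappa> ^ CARD('n))" using IH(3) \<rho> by (intro mult_left_mono) auto
    finally have "det (A (Suc k) + \<kappa> *\<^sub>R mat 1) \<le> \<rho> ^ Suc k * \<kappa> ^ CARD('n)"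
      using AS[of k] Suc.prems by (simp add: add_ac mult.assoc)
    moreover have "0 \<le> x \<bullet> (A (Suc k) *v x)" for x
      using AS[of k] Suc.prems IH(2)[of x]
      by (simp add: matrix_vector_mult_add_rdistrib inner_add_right outer_mult inner_commute)
    ultimately show ?case using AS[of k] Suc.prems IH(1) by (simp add: transpose_plus)
  qed
  show ?thesis
    using inv[of K] \<rho> by (intro nth_eigenvalue_le_of_det i \<kappa>) auto
qed

text \<open>Each difference of squares is a product of inner products with \<open>x - a\<close> and
  \<open>x + a\<close>; Cauchy-Schwarz and Bessel bound the sum, and
  \<open>norm (x + a) \<le> 2\<close>.\<close>

lemma sum_squares_lipschitz:
  fixes w :: "'i \<Rightarrow> 'a::real_inner"
  assumes bessel: "\<And>x. (\<Sum>i\<in>I. (w i \<bullet> x)\<^sup>2) \<le> x \<bullet> x" and "norm x \<le> 1" "norm a \<le> 1"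
  shows "\<bar>(\<Sum>i\<in>I. (w i \<bullet> x)\<^sup>2) - (\<Sum>i\<in>I. (w i \<bullet> a)\<^sup>2)\<bar> \<le> 2 * norm (x - a)"
proof -
  have "(\<Sum>i\<in>I. (w i \<bullet> x)\<^sup>2) - (\<Sum>i\<in>I. (w i \<bullet> a)\<^sup>2) = (\<Sum>i\<in>I. (w i \<bullet> (x - a)) * (w i \<bullet> (x + a)))"
    by (simp add: sum_subtractf[symmetric] inner_diff_right inner_add_right power2_eq_square algebra_simps)
  moreover have "(\<Sum>i\<in>I. (w i \<bullet> (x - a)) * (w i \<bullet> (x + a)))\<^sup>2 \<le> (norm (x - a) * norm (x + a))\<^sup>2"
  proof -
    have "(\<Sum>i\<in>I. (w i \<bullet> (x - a)) * (w i \<bullet> (x + a)))\<^sup>2 \<le> (\<Sum>i\<in>I. (w i \<bullet> (x - a))\<^sup>2) * (\<Sum>i\<in>I. (w i \<bullet> (x + a))\<^sup>2)"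
      by (rule Cauchy_Schwarz_ineq_sum)
    also have "\<dots> \<le> ((x - a) \<bullet> (x - a)) * ((x + a) \<bullet> (x + a))"
      by (intro mult_mono bessel) (auto intro: sum_nonneg)
    finally show ?thesis by (simp add: power_mult_distrib power2_norm_eq_inner)
  qed
  then have "\<bar>\<Sum>i\<in>I. (w i \<bullet> (x - a)) * (w i \<bullet> (x + a))\<bar> \<le> norm (x - a) * norm (x + a)"
    by (metis abs_le_square_iff abs_of_nonneg mult_nonneg_nonneg norm_ge_zero)
  moreover have "norm (x - a) * norm (x + a) \<le> norm (x - a) * 2"
    using norm_triangle_ineq[of x a] assms(2,3) by (intro mult_left_mono) auto
  ultimately show ?thesis by simp
qed

text \<open>A grid in the cube, easy to count. Its points need not be unit vectors, which is why
  later estimates carry a factor \<open>a \<bullet> a\<close>.\<close>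

definition cube_grid :: "nat \<Rightarrow> (real^'r) set" where
  "cube_grid n = (\<lambda>f. \<chi> i. of_int (f i) / real n) ` (UNIV \<rightarrow>\<^sub>E {- int n..int n})"

lemma finite_cube_grid [simp]: "finite (cube_grid n :: (real^'r) set)"
  unfolding cube_grid_def by (intro finite_imageI finite_PiE) auto

lemma card_cube_grid_le: "card (cube_grid n :: (real^'r) set) \<le> (2 * n + 1) ^ CARD('r)"
proof -
  have "card (cube_grid n :: (real^'r) set) \<le> card ((UNIV :: 'r set) \<rightarrow>\<^sub>E {- int n..int n})"
    unfolding cube_grid_def by (intro card_image_le finite_PiE) auto
  also have "\<dots> = card {- int n..int n} ^ CARD('r)" by (simp add: card_PiE)
  also have "card {- int n..int n} = 2 * n + 1" by simp
  finally show ?thesis .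
qed

text \<open>Coordinates are rounded towards 0, so the norm does not increase and the approximating
  point stays in the unit ball.\<close>

lemma cube_grid_approx:
  fixes x :: "real^'r"
  assumes n: "n > 0" and x: "norm x \<le> 1"
  obtains a where "a \<in> cube_grid n" "norm a \<le> norm x" "norm (x - a) \<le> real CARD('r) / real n"
proof -
  define f where "f i = (if x $ i \<ge> 0 then \<lfloor>x $ i * n\<rfloor> else - \<lfloor>- (x $ i) * n\<rfloor>)" for i
  define a :: "real^'r" where "a = (\<chi> i. of_int (f i) / real n)"
  have comp: "\<bar>of_int (f i)\<bar> \<le> \<bar>x $ i\<bar> * n" "\<bar>x $ i * n - of_int (f i)\<bar> \<le> 1" for i
  proof -
    have 1: "0 \<le> real_of_int \<lfloor>y * real n\<rfloor>" "real_of_int \<lfloor>y * real n\<rfloor> \<le> y * n" "y * n - 1 < real_of_int \<lfloor>y * real n\<rfloor>" if "y \<ge> 0" for y :: real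
    proof -
      have "0 \<le> y * real n" using that by simp
      then show "0 \<le> real_of_int \<lfloor>y * real n\<rfloor>" "real_of_int \<lfloor>y * real n\<rfloor> \<le> y * n" "y * n - 1 < real_of_int \<lfloor>y * real n\<rfloor>"
        by simp_all
    qed
    show "\<bar>of_int (f i)\<bar> \<le> \<bar>x $ i\<bar> * n" "\<bar>x $ i * n - of_int (f i)\<bar> \<le> 1"
    proof (atomize(full), cases "x $ i \<ge> 0")
      case True
      define z where "z = real_of_int \<lfloor>x $ i * n\<rfloor>"
      have "0 \<le> z" "z \<le> x $ i * n" "x $ i * n - 1 < z" using 1[OF True] by (simp_all only: z_def)
      moreover have "of_int (f i) = z" "\<bar>x $ i\<bar> * n = x $ i * n" using True by (simp_all add: f_def z_def)
      ultimately show "\<bar>of_int (f i)\<bar> \<le> \<bar>x $ i\<bar> * n \<and> \<bar>x $ i * n - of_int (f i)\<bar> \<le> 1"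
        by linarith
    next
      case False
      define z where "z = real_of_int \<lfloor>- (x $ i) * n\<rfloor>"
      have "0 \<le> - (x $ i)" using False by simp
      from 1[OF this] have "0 \<le> z" "z \<le> - (x $ i) * n" "- (x $ i) * n - 1 < z" by (simp_all only: z_def)
      moreover have "of_int (f i) = - z" "\<bar>x $ i\<bar> * n = - (x $ i) * n" "x $ i * n = - (- (x $ i) * n)"
        using False by (simp_all add: f_def z_def)
      ultimately show "\<bar>of_int (f i)\<bar> \<le> \<bar>x $ i\<bar> * n \<and> \<bar>x $ i * n - of_int (f i)\<bar> \<le> 1"
        by linarith
    qed
  qed
  have "f i \<in> {- int n..int n}" for i
  proof -
    have "\<bar>x $ i\<bar> * real n \<le> 1 * real n" using component_le_norm_cart[of x i] x by (intro mult_right_mono) auto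
    then have "\<bar>of_int (f i)\<bar> \<le> (of_int (int n) :: real)" using comp(1)[of i] by simp
    then have "\<bar>f i\<bar> \<le> int n" by linarith
    then show ?thesis by auto
  qed
  then have "a \<in> cube_grid n"
    unfolding a_def cube_grid_def by (intro imageI) auto
  moreover have "norm a \<le> norm x"
    using comp(1) n by (intro norm_le_componentwise_cart) (simp add: a_def divide_le_eq)
  moreover have "norm (x - a) \<le> real CARD('r) / real n"
  proof -
    have "norm (x - a) \<le> (\<Sum>i\<in>UNIV. \<bar>(x - a) $ i\<bar>)" by (rule norm_le_l1_cart)
    also have "\<dots> \<le> (\<Sum>i\<in>(UNIV :: 'r set). 1 / real n)"
    proof (intro sum_mono)
      fix i
      have "(x - a) $ i = (x $ i * n - of_int (f i)) / n" using n by (simp add: a_def field_simps)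
      then show "\<bar>(x - a) $ i\<bar> \<le> 1 / real n" using comp(2)[of i] n by (simp add: divide_right_mono)
    qed
    finally show ?thesis by simp
  qed
  ultimately show ?thesis by (rule that)
qed

section \<open>Eigenvalues of the query projection compressed to the spike\<close>

context querying begin

definition gram :: "real^'r^'d \<Rightarrow> 'd history \<Rightarrow> nat \<Rightarrow> real^'r^'r" where
  "gram V h k = transpose V ** VVT h k ** V"

lemma transpose_gram: "transpose (gram V h k) = gram V h k"
  by (simp add: gram_def matrix_transpose_mul matrix_mul_assoc)

lemma gram_mult:
  assumes "k \<le> N"
  shows "gram V (run alg M N) k *v x = (\<Sum>l=1..k. ((transpose V *v qry alg M l) \<bullet> x) *\<^sub>R (transpose V *v qry alg M l))"
proof -
  have "VVT (run alg M N) k *v y = (\<Sum>l=1..k. (qry alg M l \<bullet> y) *\<^sub>R qry alg M l)" for y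
    unfolding VVT_mult using assms by (intro sum.cong refl) (simp add: query_run)
  then have "gram V (run alg M N) k *v x = transpose V *v (\<Sum>l=1..k. (qry alg M l \<bullet> (V *v x)) *\<^sub>R qry alg M l)"
    by (simp add: gram_def matrix_vector_mul_assoc[symmetric])
  then show ?thesis
    by (simp add: linear_sum[OF matrix_vector_mul_linear] matrix_vector_mult_scaleR inner_matrix_vector_right)
qed

lemma gram_inner:
  assumes "k \<le> N"
  shows "x \<bullet> (gram V (run alg M N) k *v x) = overlap (V *v x) M k"
  by (simp add: gram_mult[OF assms] inner_sum_right overlap_def power2_eq_square inner_matrix_vector_right inner_commute)

lemma overlap_bessel:
  assumes M: "transpose M = M" and k: "k \<le> N"
  shows "overlap u M k \<le> u \<bullet> u"
proof -
  have "0 \<le> (resid k M *v u) \<bullet> (resid k M *v u)" by simp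
  also have "\<dots> = u \<bullet> (resid k M *v u)"
    using resid_resid(1)[OF M order_refl k] by (simp add: inner_matrix_vector_left matrix_vector_mul_assoc)
  also have "\<dots> = u \<bullet> u - overlap u M k"
    by (simp add: resid_mult inner_diff_right inner_sum_right overlap_def power2_eq_square inner_commute)
  finally show ?thesis by simp
qed

lemma overlap_scale: "overlap (c *\<^sub>R u) M k = c\<^sup>2 * overlap u M k"
  by (simp add: overlap_def power_mult_distrib sum_distrib_left)

text \<open>Bessel's inequality for the queries and isometry of \<open>V\<close>. This settles the
  case in which the claimed bound is at least 1.\<close>

lemma nth_eigenvalue_gram_le_one:
  fixes V :: "real^'r^'d"
  assumes V: "V \<in> Stiefel" and M: "transpose M = M" and k: "k \<le> N" and i: "i \<in> {1..CARD('r)}"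
  shows "nth_eigenvalue i (gram V (run alg M N) k) \<le> 1"
proof (rule ccontr)
  assume "\<not> ?thesis"
  then obtain T \<epsilon> where T: "i \<le> dim T" "\<epsilon> > 0" "\<And>x. x \<in> T \<Longrightarrow> (1 + \<epsilon>) * (x \<bullet> x) \<le> x \<bullet> (gram V (run alg M N) k *v x)"
    using nth_eigenvalue_greater_iff[OF transpose_gram i, of 1 V "run alg M N" k] by auto
  have "dim T \<noteq> 0"
  proof
    assume "dim T = 0"
    with T(1) have "i \<le> 0" by (simp only:)
    with i show False by simp
  qed
  then have "\<not> T \<subseteq> {0}" by simp
  then obtain x where x: "x \<in> T" "x \<noteq> 0" by auto
  have "x \<bullet> (gram V (run alg M N) k *v x) \<le> x \<bullet> x"
    unfolding gram_inner[OF k] using overlap_bessel[OF M k, of "V *v x"] Stiefel_inner[OF V] by simp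
  moreover have "\<epsilon> * (x \<bullet> x) > 0" using T(2) x(2) by simp
  ultimately show False using T(3)[OF x(1)] by (simp add: distrib_right)
qed

text \<open>Moving from a grid point to a unit vector costs \<open>2 * \<epsilon>\<close> on the
  left and \<open>2 * \<epsilon> * \<rho>\<close> on the right, with
  \<open>\<epsilon> = r / n\<close>; homogeneity extends the growth bound to all vectors. The shift
  \<open>\<kappa>\<close> is this total error divided by \<open>\<rho> - 1\<close>.\<close>

lemma nth_eigenvalue_gram_le:
  fixes V :: "real^'r^'d"
  assumes V: "V \<in> Stiefel" and M: "transpose M = M" and K: "K \<le> N" and i: "i \<in> {1..CARD('r)}"
    and \<rho>: "\<rho> > 1" and c: "c \<ge> 0" and n: "n > 0"
    and growth: "\<And>k a. k < K \<Longrightarrow> a \<in> cube_grid n \<Longrightarrow> overlap (V *v a) M (Suc k) \<le> \<rho> * overlap (V *v a) M k + c * (a \<bullet> a)"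
  shows "nth_eigenvalue i (gram V (run alg M N) K)
    \<le> (\<rho> ^ K) powr (1 / i) * ((c + 2 * (CARD('r) / n) * (1 + \<rho>)) / (\<rho> - 1))"
proof -
  let ?\<epsilon> = "real CARD('r) / real n"
  define w where "w l = transpose V *v qry alg M l" for l
  have ov: "overlap (V *v x) M k = (\<Sum>l=1..k. (w l \<bullet> x)\<^sup>2)" for x k
    by (simp add: overlap_def w_def inner_matrix_vector_right)
  have bes: "overlap (V *v x) M k \<le> x \<bullet> x" if "k \<le> N" for x k
    using overlap_bessel[OF M that, of "V *v x"] Stiefel_inner[OF V] by simp
  have lip: "\<bar>overlap (V *v x) M k - overlap (V *v a) M k\<bar> \<le> 2 * norm (x - a)" if "k \<le> N" "norm x \<le> 1" "norm a \<le> 1" for x a k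
    unfolding ov by (rule sum_squares_lipschitz[OF _ that(2,3)]) (use bes[OF that(1)] in \<open>simp add: ov\<close>)
  have unit: "overlap (V *v x) M (Suc k) \<le> \<rho> * overlap (V *v x) M k + (c + 2 * ?\<epsilon> * (1 + \<rho>))" if k: "k < K" and x: "norm x = 1" for k x
  proof -
    obtain a where a: "a \<in> cube_grid n" "norm a \<le> norm x" "norm (x - a) \<le> ?\<epsilon>"
      using cube_grid_approx[OF n, of x] x by auto
    have "overlap (V *v x) M (Suc k) \<le> overlap (V *v a) M (Suc k) + 2 * ?\<epsilon>"
      using lip[of "Suc k" x a] k K x a by simp
    also have "overlap (V *v a) M (Suc k) \<le> \<rho> * overlap (V *v a) M k + c * (a \<bullet> a)" by (rule growth[OF k a(1)])
    also have "\<rho> * overlap (V *v a) M k \<le> \<rho> * (overlap (V *v x) M k + 2 * ?\<epsilon>)"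
      using lip[of k x a] k K x a \<rho> by (intro mult_left_mono) auto
    also have "c * (a \<bullet> a) \<le> c * 1"
      using a(2) x c by (intro mult_left_mono) (auto simp: dot_square_norm power_le_one)
    finally have F: "overlap (V *v x) M (Suc k) \<le> \<rho> * (overlap (V *v x) M k + 2 * ?\<epsilon>) + c * 1 + 2 * ?\<epsilon>" by simp
    have *: "\<rho> * (y + 2 * e) + c * 1 + 2 * e = \<rho> * y + (c + 2 * e * (1 + \<rho>))" for y e
      by (simp add: algebra_simps)
    show ?thesis using F unfolding * .
  qed
  have all: "overlap (V *v x) M (Suc k) \<le> \<rho> * overlap (V *v x) M k + (c + 2 * ?\<epsilon> * (1 + \<rho>)) * (x \<bullet> x)" if k: "k < K" for k x
  proof (cases "x = 0")
    case False
    define b where "b = x /\<^sub>R norm x"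
    have b: "norm b = 1" "x = norm x *\<^sub>R b" using False by (simp_all add: b_def)
    have xx: "overlap (V *v x) M j = (norm x)\<^sup>2 * overlap (V *v b) M j" for j
      by (subst b(2)) (simp add: matrix_vector_mult_scaleR overlap_scale)
    have "(norm x)\<^sup>2 * overlap (V *v b) M (Suc k) \<le> (norm x)\<^sup>2 * (\<rho> * overlap (V *v b) M k + (c + 2 * ?\<epsilon> * (1 + \<rho>)))"
      using unit[OF k b(1)] by (intro mult_left_mono) auto
    then show ?thesis unfolding xx dot_square_norm by (simp add: algebra_simps)
  qed (simp add: overlap_def)
  show ?thesis
  proof (rule nth_eigenvalue_rank_one_growth[where y="\<lambda>k. w (Suc k)", OF _ _ _ \<rho> _ i])
    show "gram V (run alg M N) 0 = 0"
    proof -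
      have "gram V (run alg M N) 0 *v x = 0 *v x" for x by (simp add: gram_mult)
      then show ?thesis using matrix_eq by blast
    qed
    show "gram V (run alg M N) (Suc k) = gram V (run alg M N) k + outer (w (Suc k))" if "k < K" for k
    proof -
      have "gram V (run alg M N) (Suc k) *v x = (gram V (run alg M N) k + outer (w (Suc k))) *v x" for x
        using that K by (simp add: gram_mult matrix_vector_mult_add_rdistrib outer_mult w_def)
      then show ?thesis using matrix_eq by blast
    qed
    show "x \<bullet> (gram V (run alg M N) k *v x) + (w (Suc k) \<bullet> x)\<^sup>2 \<le> \<rho> * (x \<bullet> (gram V (run alg M N) k *v x)) +
       (c + 2 * ?\<epsilon> * (1 + \<rho>)) / (\<rho> - 1) * (\<rho> - 1) * (x \<bullet> x)" if "k < K" for k x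
    proof -
      have "overlap (V *v x) M k + (w (Suc k) \<bullet> x)\<^sup>2 = overlap (V *v x) M (Suc k)" by (simp add: ov)
      then show ?thesis using all[OF that, of x] gram_inner[of k x V M] that K \<rho> by simp
    qed
    show "0 < (c + 2 * ?\<epsilon> * (1 + \<rho>)) / (\<rho> - 1)"
      using \<rho> c n by (intro divide_pos_pos add_nonneg_pos mult_pos_pos) auto
  qed
qed

end

text \<open>With \<open>c = (K / (2 lam) + \<Lambda>) / \<alpha>\<close> and \<open>\<epsilon> = 1 / d\<close>, the constant of the previous bound is at
  most the one of the theorem; \<open>K \<le> r' lam powr (4 K / r') / (4 ln lam)\<close> trades the linear growth of
  \<open>c\<close> in \<open>K\<close> for four of the nine powers of \<open>lam powr (K / r')\<close>.\<close>

lemma threshold_bound: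
  fixes lam d r m \<delta> g \<alpha> :: real and K r' :: nat
  assumes lam: "lam > 1" and g: "g = (lam - 1)\<^sup>2 / (lam\<^sup>2 + 1)" and d: "d \<ge> 1" and r: "1 \<le> r"
    and r': "1 \<le> r'" "real r' \<le> r" and m: "m > 0" "d \<le> lam * m" and \<delta>: "0 < \<delta>" "\<delta> < 1"
    and \<alpha>: "\<alpha> = (lam - 1) * m / (2 * lam\<^sup>2)"
  defines "L \<equiv> r * ln (3 * d\<^sup>2) + ln d + ln (1 / \<delta>)"
  shows "((lam ^ 5) ^ K) powr (1 / r') * (((real K / (2 * lam) + L) / \<alpha> + 2 * (1 / d) * (1 + lam ^ 5)) / (lam ^ 5 - 1))
    \<le> 26 * r * lam powr (9 * real K / real r') * ln (20 * d\<^sup>2) * ln (exp 1 / \<delta>) / (d * g\<^sup>2)"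
proof -
  define E where "E = lam powr (4 * real K / r')"
  define T where "T = ln (20 * d\<^sup>2)"
  define D where "D = ln (exp 1 / \<delta>)"
  have E: "E \<ge> 1" unfolding E_def using lam by (intro ge_one_powr_ge_zero) auto
  have d2: "d\<^sup>2 \<ge> 1" using d by (simp add: one_le_power)
  have "exp 1 \<le> (3::real)" by (rule exp_le)
  then have T1: "T \<ge> 1"
    using d2 unfolding T_def by (subst ln_ge_iff) auto
  have T2: "ln (3 * d\<^sup>2) \<le> T" "ln d \<le> T" 
  proof -
    show "ln (3 * d\<^sup>2) \<le> T" unfolding T_def using d2 by (subst ln_le_cancel_iff) auto
    have "d * 1 \<le> d * (20 * d)" using d by (intro mult_left_mono) auto
    then show "ln d \<le> T" unfolding T_def using d d2 by (subst ln_le_cancel_iff) (auto simp: power2_eq_square)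
  qed
  have D: "D \<ge> 1" "ln (1 / \<delta>) \<le> D" "D = 1 + ln (1 / \<delta>)"
    using \<delta> by (auto simp: D_def ln_div)
  have l0: "ln (3 * d\<^sup>2) \<ge> 0" "ln d \<ge> 0" "ln (1 / \<delta>) \<ge> 0" using d d2 \<delta> by (auto simp: ln_div intro!: ln_ge_zero) (use d2 in linarith)
  have L0: "L \<ge> 0" unfolding L_def using l0 r by simp
  \<comment> \<open>A product of factors that are all at least 1, dominating every term of
    \<open>L\<close>.\<close>
  define X where "X = r * E * T * D"
  have rX: "r * E \<le> X"
  proof -
    have "r * E * 1 * 1 \<le> r * E * T * D" using r E T1 D by (intro mult_mono) auto
    then show ?thesis by (simp add: X_def)
  qed
  have X1: "1 \<le> X" using rX mult_mono[of 1 r 1 E] r E by simp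
  have LX: "L \<le> 3 * X"
  proof -
    have "r * ln (3 * d\<^sup>2) \<le> X"
    proof -
      have "r * 1 * ln (3 * d\<^sup>2) * 1 \<le> r * E * T * D" using r E T1 T2 D l0 by (intro mult_mono) auto
      then show ?thesis by (simp add: X_def)
    qed
    moreover have "ln d \<le> X"
    proof -
      have "1 * 1 * ln d * 1 \<le> r * E * T * D" using r E T1 T2 D l0 by (intro mult_mono) auto
      then show ?thesis by (simp add: X_def)
    qed
    moreover have "ln (1 / \<delta>) \<le> X"
    proof -
      have "1 * 1 * 1 * ln (1 / \<delta>) \<le> r * E * T * D" using r E T1 T2 D l0 by (intro mult_mono) auto
      then show ?thesis by (simp add: X_def)
    qed
    ultimately show ?thesis by (simp add: L_def)
  qed
  have l1: "lam - 1 > 0" using lam by simp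
  have g0: "g > 0" unfolding g using l1 by (intro divide_pos_pos) (auto intro: add_nonneg_pos)
  have g1: "g \<le> 1"
  proof -
    have "(lam - 1)\<^sup>2 \<le> lam\<^sup>2 + 1" using lam by (simp add: power2_eq_square algebra_simps)
    moreover have "0 < lam\<^sup>2 + 1" by (rule add_nonneg_pos) auto
    ultimately show ?thesis unfolding g by simp
  qed
  have gl: "g \<le> (lam - 1)\<^sup>2 / 2"
  proof -
    have "1 \<le> lam\<^sup>2" using lam by (simp add: one_le_power)
    then show ?thesis unfolding g by (intro frac_le) auto
  qed
  have lsq: "lam - 1 \<le> lam\<^sup>2 + 1"
  proof -
    have "lam * 1 \<le> lam * lam" using lam by (intro mult_left_mono) auto
    then show ?thesis by (simp add: power2_eq_square)
  qed
  \<comment> \<open>The term linear in \<open>K\<close> brings the denominator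
    \<open>(lam - 1) ^ 3\<close>, one power more than the term with \<open>L\<close>.\<close>
  have gl3: "g\<^sup>2 \<le> (lam - 1) ^ 3"
  proof -
    note lsq
    also have "lam\<^sup>2 + 1 \<le> (lam\<^sup>2 + 1)\<^sup>2" by (rule self_le_power) auto
    finally have "(lam - 1) ^ 3 * (lam - 1) \<le> (lam - 1) ^ 3 * (lam\<^sup>2 + 1)\<^sup>2"
      using l1 by (intro mult_left_mono) auto
    then have "(lam - 1) ^ 4 \<le> (lam - 1) ^ 3 * (lam\<^sup>2 + 1)\<^sup>2" by (simp add: eval_nat_numeral mult_ac)
    moreover have "g\<^sup>2 = (lam - 1) ^ 4 / (lam\<^sup>2 + 1)\<^sup>2"
      unfolding g by (simp add: power_divide flip: power_mult)
    moreover have "(lam\<^sup>2 + 1)\<^sup>2 > 0" by (intro zero_less_power) (auto intro: add_nonneg_pos)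
    ultimately show ?thesis by (simp add: divide_le_eq)
  qed
  have gl4: "g \<le> lam - 1"
  proof -
    have "(lam - 1) * (lam - 1) \<le> (lam - 1) * (lam\<^sup>2 + 1)" using l1 lsq by (intro mult_left_mono) auto
    moreover have "lam\<^sup>2 + 1 > 0" by (auto intro: add_nonneg_pos)
    ultimately show ?thesis unfolding g by (simp add: divide_le_eq power2_eq_square)
  qed
  have \<rho>: "lam ^ 5 - 1 \<ge> (lam - 1) * lam ^ 3" "lam ^ 5 - 1 \<ge> lam - 1"
  proof -
    have e: "lam ^ 5 - 1 = (lam - 1) * (lam ^ 4 + lam ^ 3 + lam\<^sup>2 + lam + 1)"
      by (simp add: eval_nat_numeral algebra_simps)
    have "lam ^ 3 \<le> lam ^ 4 + lam ^ 3 + lam\<^sup>2 + lam + 1" "1 \<le> lam ^ 4 + lam ^ 3 + lam\<^sup>2 + lam + 1"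
      using lam by auto
    then show "lam ^ 5 - 1 \<ge> (lam - 1) * lam ^ 3" "lam ^ 5 - 1 \<ge> lam - 1"
      unfolding e using l1 by (metis mult_left_mono less_imp_le, metis mult_left_mono less_imp_le mult.right_neutral)
  qed
  have \<rho>0: "lam ^ 5 - 1 > 0" using \<rho>(2) l1 by simp
  \<comment> \<open>From \<open>y \<le> exp y\<close> at \<open>y = 4 * K * ln lam / r'\<close>,
    combined with \<open>lam - 1 \<le> lam * ln lam\<close>.\<close>
  have KE: "real K / (2 * lam) \<le> r * E / (8 * (lam - 1))"
  proof -
    have ll: "lam - 1 \<le> lam * ln lam"
    proof -
      have "ln (1 / lam) \<le> 1 / lam - 1" using lam by (intro ln_le_minus_one) auto
      then have "1 - 1 / lam \<le> ln lam" using lam by (simp add: ln_div)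
      then have "lam * (1 - 1 / lam) \<le> lam * ln lam" using lam by (intro mult_left_mono) auto
      then show ?thesis using lam by (simp add: right_diff_distrib)
    qed
    have "4 * real K / r' * ln lam \<le> E"
    proof -
      have "4 * real K / r' * ln lam \<le> exp (4 * real K / r' * ln lam)"
        using exp_ge_add_one_self[of "4 * real K / r' * ln lam"] by linarith
      also have "\<dots> = E" using lam by (simp only: E_def powr_def) simp
      finally show ?thesis .
    qed
    then have "4 * real K * ln lam \<le> r' * E" using r' by (simp add: divide_le_eq mult.commute field_simps)
    also have "\<dots> \<le> r * E" using r' E by (intro mult_right_mono) auto
    finally have "4 * real K * ln lam * lam \<le> r * E * lam" using lam by (intro mult_right_mono) auto
    moreover have "4 * real K * (lam - 1) \<le> 4 * real K * (lam * ln lam)" using ll by (intro mult_left_mono) auto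
    ultimately have "4 * real K * (lam - 1) \<le> r * E * lam" by (simp add: mult_ac)
    then have "2 * (4 * real K * (lam - 1)) \<le> 2 * (r * E * lam)" by (rule mult_left_mono) simp
    then have "real K * (8 * (lam - 1)) / ((2 * lam) * (8 * (lam - 1))) \<le> r * E * (2 * lam) / ((2 * lam) * (8 * (lam - 1)))"
      using lam l1 by (intro divide_right_mono) (simp_all add: mult_ac)
    moreover have "real K * (8 * (lam - 1)) / ((2 * lam) * (8 * (lam - 1))) = real K / (2 * lam)"
      using l1 by (intro nonzero_mult_divide_mult_cancel_right) simp
    moreover have "r * E * (2 * lam) / ((2 * lam) * (8 * (lam - 1))) = r * E / (8 * (lam - 1))"
      using lam by simp
    ultimately show ?thesis by simp
  qed
  have \<alpha>0: "\<alpha> > 0" unfolding \<alpha> using l1 m lam by simp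
  have da: "1 / \<alpha> \<le> 2 * lam ^ 3 / ((lam - 1) * d)"
  proof -
    have "(lam - 1) * d \<le> (lam - 1) * (lam * m)" using m l1 by (intro mult_left_mono) auto
    then have "2 * lam ^ 3 / ((lam - 1) * (lam * m)) \<le> 2 * lam ^ 3 / ((lam - 1) * d)"
      using l1 lam d m by (intro divide_left_mono) auto
    moreover have "2 * lam ^ 3 / ((lam - 1) * (lam * m)) = 1 / \<alpha>"
      unfolding \<alpha> using l1 lam m by (simp add: field_simps eval_nat_numeral)
    ultimately show ?thesis by simp
  qed
  have main: "((real K / (2 * lam) + L) / \<alpha> + 2 * (1 / d) * (1 + lam ^ 5)) / (lam ^ 5 - 1) \<le> 26 * X / (d * g\<^sup>2)"
  proof -
    let ?S = "real K / (2 * lam) + L"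
    have S0: "?S \<ge> 0" using L0 lam by simp
    have "?S / \<alpha> / (lam ^ 5 - 1) \<le> ?S * (2 * lam ^ 3 / ((lam - 1) * d)) / ((lam - 1) * lam ^ 3)"
    proof (intro frac_le)
      show "?S / \<alpha> \<le> ?S * (2 * lam ^ 3 / ((lam - 1) * d))"
        using mult_left_mono[OF da S0] by simp
    qed (use S0 l1 lam d \<rho> in auto)
    also have "\<dots> = ?S * 2 / (lam - 1)\<^sup>2 / d"
    proof -
      have gen: "s * (2 * v / (u * d)) / (u * v) = s * 2 / u\<^sup>2 / d" if "u \<noteq> 0" "v \<noteq> 0" for s u v
        using that d by (simp add: field_simps power2_eq_square)
      show ?thesis by (rule gen) (use l1 lam in auto)
    qed
    also have "?S * 2 / (lam - 1)\<^sup>2 \<le> (r * E / (8 * (lam - 1)) + L) * 2 / (lam - 1)\<^sup>2"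
      using KE l1 by (intro divide_right_mono mult_right_mono add_right_mono) auto
    also have "\<dots> = r * E / 4 / (lam - 1) ^ 3 + L / ((lam - 1)\<^sup>2 / 2)"
    proof -
      have gen: "(s / (8 * u) + L) * 2 / u\<^sup>2 = s / 4 / u ^ 3 + L / (u\<^sup>2 / 2)" if "u \<noteq> 0" for s u
        using that by (simp add: field_simps eval_nat_numeral)
      show ?thesis by (rule gen) (use l1 in auto)
    qed
    also have "\<dots> \<le> r * E / 4 / g\<^sup>2 + L / g"
      using gl3 gl g0 r E L0 l1 by (intro add_mono divide_left_mono) auto
    also have "L / g \<le> L / g\<^sup>2"
      using g0 g1 L0 by (intro divide_left_mono) (auto simp: power2_eq_square mult_left_le)
    also have "r * E / 4 / g\<^sup>2 + L / g\<^sup>2 \<le> X / g\<^sup>2 + 3 * X / g\<^sup>2"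
      using rX LX X1 by (intro add_mono divide_right_mono) auto
    finally have 1: "?S / \<alpha> / (lam ^ 5 - 1) \<le> (4 * X / g\<^sup>2) / d"
      using d by (simp add: divide_right_mono)
    have "2 * (1 + lam ^ 5) / (lam ^ 5 - 1) = 2 + 4 / (lam ^ 5 - 1)"
      using \<rho>0 by (simp add: field_simps)
    also have "4 / (lam ^ 5 - 1) \<le> 4 / g"
      using \<rho>(2) gl4 g0 \<rho>0 by (intro divide_left_mono) auto
    also have "2 + 4 / g \<le> 6 / g" using g0 g1 by (simp add: field_simps)
    also have "\<dots> \<le> 6 * X / g\<^sup>2"
      using g0 g1 X1 by (intro frac_le) (auto simp: power2_eq_square mult_left_le)
    finally have "2 * (1 + lam ^ 5) / (lam ^ 5 - 1) / d \<le> (6 * X / g\<^sup>2) / d"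
      using d by (intro divide_right_mono) auto
    then have 2: "2 * (1 / d) * (1 + lam ^ 5) / (lam ^ 5 - 1) \<le> (6 * X / g\<^sup>2) / d" by (simp add: field_simps)
    have "(?S / \<alpha> + 2 * (1 / d) * (1 + lam ^ 5)) / (lam ^ 5 - 1) \<le> (4 * X / g\<^sup>2) / d + (6 * X / g\<^sup>2) / d"
    proof -
      have "(x + y) / z \<le> x' + y'" if "x / z \<le> x'" "y / z \<le> y'" for x y z x' y' :: real
        using that by (simp add: add_divide_distrib)
      from this[OF 1 2] show ?thesis .
    qed
    also have "\<dots> = 10 * X / (d * g\<^sup>2)"
    proof -
      have "(4 * x / y) / d + (6 * x / y) / d = 10 * x / (d * y)" for x y
        by (simp add: divide_inverse algebra_simps)
      then show ?thesis .
    qed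
    \<comment> \<open>The estimates above add up to the constant 10.\<close>
    also have "\<dots> \<le> 26 * X / (d * g\<^sup>2)" using X1 d g0 by (intro divide_right_mono) auto
    finally show ?thesis .
  qed
  have pw: "((lam ^ 5) ^ K) powr (1 / r') = lam powr (5 * real K / r')"
  proof -
    have "(lam ^ 5) ^ K = lam powr real (5 * K)"
      using lam powr_realpow[of lam "5 * K"] by (simp add: power_mult)
    then show ?thesis by (simp add: powr_powr)
  qed
  have "lam powr (5 * real K / r') * (((real K / (2 * lam) + L) / \<alpha> + 2 * (1 / d) * (1 + lam ^ 5)) / (lam ^ 5 - 1))
    \<le> lam powr (5 * real K / r') * (26 * X / (d * g\<^sup>2))"
    using main by (intro mult_left_mono) auto
  also have "\<dots> = 26 * r * (lam powr (5 * real K / r') * E) * T * D / (d * g\<^sup>2)" by (simp add: X_def)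
  also have "lam powr (5 * real K / r') * E = lam powr (9 * real K / r')"
    unfolding E_def powr_add[symmetric] by (simp add: add_divide_distrib[symmetric])
  finally show ?thesis unfolding pw T_def D_def .
qed

section \<open>The union bound and conditional laws\<close>

context querying begin

text \<open>Union bound over at most \<open>d\<close> rounds and \<open>(3 * d\<^sup>2) ^ r\<close>
  grid points. \<open>L\<close> is chosen so that this number times \<open>exp (- L)\<close> is
  \<open>\<delta>\<close>, and the additive term of round \<open>k\<close> cancels the exponential
  moment down to \<open>exp (- L)\<close>.\<close>

lemma overlap_growth_whp:
  fixes \<mu> :: "(real^'r^'d) measure"
  assumes \<mu>: "uniform_Stiefel \<mu>" and lam: "lam > 1"
    and rd: "CARD('r) \<le> CARD('d)" and dm: "real CARD('d) \<le> lam * real (CARD('d) + 1 - CARD('r))"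
    and \<delta>: "0 < \<delta>"
  defines "\<alpha> \<equiv> (lam - 1) * real (CARD('d) + 1 - CARD('r)) / (2 * lam\<^sup>2)"
    and "L \<equiv> real CARD('r) * ln (3 * (real CARD('d))\<^sup>2) + ln (real CARD('d)) + ln (1 / \<delta>)"
  shows "(\<integral>\<^sup>+V. (\<integral>\<^sup>+G. of_bool (\<exists>k<N. \<exists>a\<in>cube_grid (CARD('d)\<^sup>2).
      lam ^ 5 * spike_overlap lam V G a k + (real (Suc k) / (2 * lam) + L) / \<alpha> * (a \<bullet> a)
        < spike_overlap lam V G a (Suc k)) \<partial>std_gauss) \<partial>\<mu>) \<le> ennreal \<delta>"
proof -
  have sets [measurable_cong]: "sets \<mu> = sets borel" using \<mu> by (simp add: uniform_Stiefel_def)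
  interpret G: prob_space "std_gauss :: (real^'d^'d) measure" by (rule prob_space_std_gauss)
  let ?d = "real CARD('d)"
  define Gr where "Gr = (cube_grid (CARD('d)\<^sup>2) :: (real^'r) set)"
  have d1: "?d \<ge> 1" using one_le_card_finite[where 'a='d] by linarith
  have N: "N \<le> CARD('d)" using alg by (simp add: query_algorithm_def)
  have \<alpha>: "\<alpha> > 0" using lam rd by (simp add: \<alpha>_def)
  define B where "B k a V G \<longleftrightarrow> lam ^ 5 * spike_overlap lam V G a k + (real (Suc k) / (2 * lam) + L) / \<alpha> * (a \<bullet> a)
        < spike_overlap lam V G a (Suc k)" for k and a :: "real^'r" and V and G :: "real^'d^'d"
  have om [measurable]: "(\<lambda>x. overlap (f x *v b) (spiked lam (f x) (sym_part (g x))) j) \<in> borel_measurable M"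
    if "j \<le> N" and [measurable]: "f \<in> borel_measurable M" "g \<in> borel_measurable M" for f :: "'x \<Rightarrow> real^'r^'d" and g j b and M :: "'x measure"
    using that by (intro measurable_overlap) (auto, measurable)
  have each: "(\<integral>\<^sup>+V. (\<integral>\<^sup>+G. of_bool (B k a V G) \<partial>std_gauss) \<partial>\<mu>) \<le> ennreal (exp (- L))" if k: "k < N" for k a
  proof (cases "a = 0")
    case True
    then show ?thesis by (simp add: B_def overlap_def)
  next
    case False
    \<comment> \<open>Both sides of the growth inequality scale with the squared norm of
      \<open>a\<close>, so a nonzero grid point may be normalized.\<close>
    define b where "b = a /\<^sub>R norm a"
    have b: "norm b = 1" "a = norm a *\<^sub>R b" using False by (simp_all add: b_def)
    have ov: "overlap (V *v a) M j = (norm a)\<^sup>2 * overlap (V *v b) M j" for V :: "real^'r^'d" and M j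
      by (subst b(2)) (simp add: matrix_vector_mult_scaleR overlap_scale)
    have Beq: "B k a V G \<longleftrightarrow> lam ^ 5 * spike_overlap lam V G b k + (real (Suc k) / (2 * lam) + L) / \<alpha>
        < spike_overlap lam V G b (Suc k)" for V G
    proof -
      have "B k a V G \<longleftrightarrow> (norm a)\<^sup>2 * (lam ^ 5 * spike_overlap lam V G b k + (real (Suc k) / (2 * lam) + L) / \<alpha>)
        < (norm a)\<^sup>2 * spike_overlap lam V G b (Suc k)"
        unfolding B_def ov dot_square_norm by (simp only: distrib_left mult_ac)
      then show ?thesis using False by simp
    qed
    have "of_bool (B k a V G) = (indicator {lam ^ 5 * spike_overlap lam V G b k + (real (Suc k) / (2 * lam) + L) / \<alpha> <..}
      (spike_overlap lam V G b (Suc k)) :: ennreal)" for V G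
      unfolding Beq by (simp add: indicator_def)
    then have "(\<integral>\<^sup>+V. (\<integral>\<^sup>+G. of_bool (B k a V G) \<partial>std_gauss) \<partial>\<mu>)
      \<le> ennreal (exp (real (Suc k) / (2 * lam) - \<alpha> * ((real (Suc k) / (2 * lam) + L) / \<alpha>)))"
      using overlap_growth_tail[OF \<mu> b(1) lam _ rd dm, of k "(real (Suc k) / (2 * lam) + L) / \<alpha>"] k
      unfolding \<alpha>_def[symmetric] by simp
    also have "real (Suc k) / (2 * lam) - \<alpha> * ((real (Suc k) / (2 * lam) + L) / \<alpha>) = - L" using \<alpha> by simp
    finally show ?thesis .
  qed
  have "(\<integral>\<^sup>+V. (\<integral>\<^sup>+G. of_bool (\<exists>k<N. \<exists>a\<in>Gr. B k a V G) \<partial>std_gauss) \<partial>\<mu>)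
    \<le> (\<integral>\<^sup>+V. (\<integral>\<^sup>+G. (\<Sum>k<N. \<Sum>a\<in>Gr. of_bool (B k a V G)) \<partial>std_gauss) \<partial>\<mu>)"
  proof (intro nn_integral_mono)
    fix V G
    show "of_bool (\<exists>k<N. \<exists>a\<in>Gr. B k a V G) \<le> (\<Sum>k<N. \<Sum>a\<in>Gr. of_bool (B k a V G) :: ennreal)"
    proof (cases "\<exists>k<N. \<exists>a\<in>Gr. B k a V G")
      case True
      then obtain k a where ka: "k < N" "a \<in> Gr" "B k a V G" by auto
      have "(1::ennreal) = of_bool (B k a V G)" using ka by simp
      also have "\<dots> \<le> (\<Sum>a\<in>Gr. of_bool (B k a V G))"
        using ka by (intro member_le_sum) (auto simp: Gr_def)
      also have "\<dots> \<le> (\<Sum>k<N. \<Sum>a\<in>Gr. of_bool (B k a V G))"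
        using ka by (intro member_le_sum[where f="\<lambda>k. \<Sum>a\<in>Gr. of_bool (B k a V G)"]) auto
      finally show ?thesis using True by simp
    qed simp
  qed
  also have "\<dots> = (\<Sum>k<N. \<Sum>a\<in>Gr. (\<integral>\<^sup>+V. (\<integral>\<^sup>+G. of_bool (B k a V G) \<partial>std_gauss) \<partial>\<mu>))"
  proof -
    have Bm [measurable]: "(\<lambda>x. of_bool (B k a (f x) (g x)) :: ennreal) \<in> borel_measurable M"
      if "k < N" and [measurable]: "f \<in> borel_measurable M" "g \<in> borel_measurable M" for f g k a and M :: "'x measure"
    proof -
      have [measurable]: "(\<lambda>x. overlap (f x *v a) (spiked lam (f x) (sym_part (g x))) k) \<in> borel_measurable M"
        "(\<lambda>x. overlap (f x *v a) (spiked lam (f x) (sym_part (g x))) (Suc k)) \<in> borel_measurable M"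
        using that by (auto intro!: om)
      show ?thesis unfolding B_def of_bool_def by measurable
    qed
    define I where "I k a V = (\<integral>\<^sup>+G. of_bool (B k a V G) \<partial>std_gauss)" for k a V
    have Im: "I k a \<in> borel_measurable \<mu>" if "k < N" for k a
      unfolding I_def using that by (intro G.borel_measurable_nn_integral) (auto simp: case_prod_beta intro!: Bm)
    have "(\<integral>\<^sup>+G. (\<Sum>k<N. \<Sum>a\<in>Gr. of_bool (B k a V G)) \<partial>std_gauss) = (\<Sum>k<N. \<Sum>a\<in>Gr. I k a V)" for V
    proof (subst nn_integral_sum)
      show "(\<lambda>G. \<Sum>a\<in>Gr. of_bool (B k a V G) :: ennreal) \<in> borel_measurable std_gauss" if "k \<in> {..<N}" for k
        using that by (intro borel_measurable_sum Bm) auto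
      show "(\<Sum>k<N. \<integral>\<^sup>+G. (\<Sum>a\<in>Gr. of_bool (B k a V G)) \<partial>std_gauss) = (\<Sum>k<N. \<Sum>a\<in>Gr. I k a V)"
        unfolding I_def by (intro sum.cong refl nn_integral_sum Bm) auto
    qed
    moreover have "(\<integral>\<^sup>+V. (\<Sum>k<N. \<Sum>a\<in>Gr. I k a V) \<partial>\<mu>) = (\<Sum>k<N. \<Sum>a\<in>Gr. (\<integral>\<^sup>+V. I k a V \<partial>\<mu>))"
    proof (subst nn_integral_sum)
      show "(\<lambda>V. \<Sum>a\<in>Gr. I k a V) \<in> borel_measurable \<mu>" if "k \<in> {..<N}" for k
        using that by (intro borel_measurable_sum Im) auto
      show "(\<Sum>k<N. \<integral>\<^sup>+V. (\<Sum>a\<in>Gr. I k a V) \<partial>\<mu>) = (\<Sum>k<N. \<Sum>a\<in>Gr. (\<integral>\<^sup>+V. I k a V \<partial>\<mu>))"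
        by (intro sum.cong refl nn_integral_sum Im) auto
    qed
    ultimately show ?thesis by (simp only: I_def)
  qed
  also have "\<dots> \<le> (\<Sum>k<N. \<Sum>a\<in>Gr. ennreal (exp (- L)))"
    by (intro sum_mono each) simp
  also have "\<dots> = ennreal (real N * (real (card Gr) * exp (- L)))"
    by (simp add: ennreal_of_nat_eq_real_of_nat flip: ennreal_mult)
  also have "\<dots> \<le> ennreal (?d * ((3 * ?d\<^sup>2) ^ CARD('r) * exp (- L)))"
  proof (intro ennreal_leI mult_mono)
    have "card Gr \<le> (2 * CARD('d)\<^sup>2 + 1) ^ CARD('r)" unfolding Gr_def by (rule card_cube_grid_le)
    then have "real (card Gr) \<le> real ((2 * CARD('d)\<^sup>2 + 1) ^ CARD('r))" by (rule of_nat_mono)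
    also have "\<dots> = (2 * ?d\<^sup>2 + 1) ^ CARD('r)" by (simp add: add.commute)
    also have "\<dots> \<le> (3 * ?d\<^sup>2) ^ CARD('r)"
      using d1 one_le_power[OF d1, of 2] by (intro power_mono) auto
    finally show "real (card Gr) \<le> (3 * ?d\<^sup>2) ^ CARD('r)" .
  qed (use N in auto)
  also have "?d * ((3 * ?d\<^sup>2) ^ CARD('r) * exp (- L)) = \<delta>"
  proof -
    have p: "3 * ?d\<^sup>2 > 0" "?d > 0" using d1 by auto
    have "exp (real CARD('r) * ln (3 * ?d\<^sup>2)) = (3 * ?d\<^sup>2) ^ CARD('r)"
      using p by (subst exp_of_nat_mult) simp
    then have "exp L = (3 * ?d\<^sup>2) ^ CARD('r) * ?d * (1 / \<delta>)"
      unfolding L_def exp_add using p \<delta> by simp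
    then show ?thesis using p \<delta> by (simp add: exp_minus field_simps)
  qed
  finally show ?thesis unfolding B_def Gr_def .
qed

end

text \<open>The conditional law is specified on rectangles, but the event of interest couples the
  frame with the history. Both sides are measures of \<open>S\<close> under laws on the product
  space, and rectangles are an intersection-stable generator.\<close>

lemma conditional_law_expectation:
  fixes X :: "'w \<Rightarrow> 'a" and Y :: "'w \<Rightarrow> 'b"
  assumes \<Omega>: "prob_space \<Omega>" and X [measurable]: "X \<in> \<Omega> \<rightarrow>\<^sub>M MX" and Y [measurable]: "Y \<in> \<Omega> \<rightarrow>\<^sub>M MY"
    and P: "conditional_law \<Omega> MX X MY Y P" and S: "S \<in> sets (MX \<Otimes>\<^sub>M MY)"
  shows "prob_space.expectation \<Omega> (\<lambda>\<omega>. measure (P (X \<omega>)) (Pair (X \<omega>) -` S)) = measure \<Omega> {\<omega> \<in> space \<Omega>. (X \<omega>, Y \<omega>) \<in> S}"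
proof -
  interpret prob_space \<Omega> by fact
  have Pm: "P \<in> MX \<rightarrow>\<^sub>M prob_algebra MY"
    and rect: "\<And>A B. A \<in> sets MX \<Longrightarrow> B \<in> sets MY \<Longrightarrow> measure \<Omega> {\<omega> \<in> space \<Omega>. X \<omega> \<in> A \<and> Y \<omega> \<in> B} =
        (\<integral>\<omega>. indicator A (X \<omega>) * measure (P (X \<omega>)) B \<partial>\<Omega>)"
    using P by (auto simp: conditional_law_def)
  have Ps [measurable]: "P \<in> MX \<rightarrow>\<^sub>M subprob_algebra MY" using Pm by (rule measurable_prob_algebraD)
  have Xs: "X \<omega> \<in> space MX" if "\<omega> \<in> space \<Omega>" for \<omega> using measurable_space[OF X that] .
  have PP: "prob_space (P x)" "sets (P x) = sets MY" if "x \<in> space MX" for x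
    using measurable_space[OF Pm that] by (auto simp: space_prob_algebra)
  \<comment> \<open>The kernel that keeps \<open>x\<close> as first component; bound to the law of
    \<open>X\<close> it gives the candidate joint law \<open>\<nu>\<close>.\<close>
  define \<kappa> where "\<kappa> x = distr (P x) (MX \<Otimes>\<^sub>M MY) (Pair x)" for x
  have \<kappa> [measurable]: "\<kappa> \<in> MX \<rightarrow>\<^sub>M subprob_algebra (MX \<Otimes>\<^sub>M MY)"
    unfolding \<kappa>_def by (rule measurable_distr2[where M=MY]) measurable
  define \<nu> where "\<nu> = distr \<Omega> MX X \<bind> \<kappa>"
  have ne: "space (distr \<Omega> MX X) \<noteq> {}" using not_empty Xs by auto
  have em\<kappa>: "emeasure (\<kappa> x) S' = emeasure (P x) (Pair x -` S')" if "x \<in> space MX" "S' \<in> sets (MX \<Otimes>\<^sub>M MY)" for x S'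
  proof -
    have "Pair x \<in> P x \<rightarrow>\<^sub>M MX \<Otimes>\<^sub>M MY"
      using that(1) measurable_Pair1'[of x MX MY] by (simp add: measurable_cong_sets[OF PP(2)[OF that(1)] refl])
    moreover have "Pair x -` S' \<inter> space (P x) = Pair x -` S'"
      using sets.sets_into_space[OF that(2)] sets_eq_imp_space_eq[OF PP(2)[OF that(1)]] by (auto simp: space_pair_measure)
    ultimately show ?thesis unfolding \<kappa>_def using that by (simp add: emeasure_distr)
  qed
  have em\<nu>: "emeasure \<nu> S' = (\<integral>\<^sup>+\<omega>. emeasure (P (X \<omega>)) (Pair (X \<omega>) -` S') \<partial>\<Omega>)" if S': "S' \<in> sets (MX \<Otimes>\<^sub>M MY)" for S'
  proof -
    have "emeasure \<nu> S' = (\<integral>\<^sup>+x. emeasure (\<kappa> x) S' \<partial>distr \<Omega> MX X)"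
      unfolding \<nu>_def by (rule emeasure_bind[OF ne _ S']) simp
    also have "\<dots> = (\<integral>\<^sup>+\<omega>. emeasure (\<kappa> (X \<omega>)) S' \<partial>\<Omega>)"
      using measurable_emeasure_kernel[OF \<kappa> S'] by (simp add: nn_integral_distr)
    also have "\<dots> = (\<integral>\<^sup>+\<omega>. emeasure (P (X \<omega>)) (Pair (X \<omega>) -` S') \<partial>\<Omega>)"
      by (intro nn_integral_cong em\<kappa> Xs S')
    finally show ?thesis .
  qed
  have em\<nu>': "emeasure \<nu> S' = ennreal (\<integral>\<omega>. measure (P (X \<omega>)) (Pair (X \<omega>) -` S') \<partial>\<Omega>)" if S': "S' \<in> sets (MX \<Otimes>\<^sub>M MY)" for S'
  proof -
    have meq: "ennreal (measure (P (X \<omega>)) Z) = emeasure (P (X \<omega>)) Z" if "\<omega> \<in> space \<Omega>" for \<omega> Z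
    proof -
      interpret p: prob_space "P (X \<omega>)" using PP Xs that by blast
      show ?thesis by (simp add: p.emeasure_eq_measure)
    qed
    have m1: "(\<lambda>\<omega>. emeasure (P (X \<omega>)) (Pair (X \<omega>) -` S')) \<in> borel_measurable \<Omega>"
    proof (subst measurable_cong)
      show "emeasure (P (X \<omega>)) (Pair (X \<omega>) -` S') = emeasure (\<kappa> (X \<omega>)) S'" if "\<omega> \<in> space \<Omega>" for \<omega>
        using em\<kappa>[OF Xs[OF that] S'] by simp
      show "(\<lambda>\<omega>. emeasure (\<kappa> (X \<omega>)) S') \<in> borel_measurable \<Omega>"
        by (rule measurable_compose[OF X measurable_emeasure_kernel[OF \<kappa> S']])
    qed
    then have "(\<lambda>\<omega>. measure (P (X \<omega>)) (Pair (X \<omega>) -` S')) \<in> borel_measurable \<Omega>"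
      unfolding measure_def by (rule measurable_compose[OF _ borel_measurable_enn2real[OF measurable_ident_sets[OF refl]]])
    then have "ennreal (\<integral>\<omega>. measure (P (X \<omega>)) (Pair (X \<omega>) -` S') \<partial>\<Omega>) = (\<integral>\<^sup>+\<omega>. ennreal (measure (P (X \<omega>)) (Pair (X \<omega>) -` S')) \<partial>\<Omega>)"
    proof (intro nn_integral_eq_integral[symmetric] integrable_const_bound[where B=1])
      show "AE \<omega> in \<Omega>. norm (measure (P (X \<omega>)) (Pair (X \<omega>) -` S')) \<le> 1"
        using PP(1)[OF Xs] by (intro AE_I2) (simp add: prob_space.prob_le_1)
    qed auto
    also have "\<dots> = emeasure \<nu> S'" unfolding em\<nu>[OF S'] by (intro nn_integral_cong meq)
    finally show ?thesis ..
  qed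
  have "distr \<Omega> (MX \<Otimes>\<^sub>M MY) (\<lambda>\<omega>. (X \<omega>, Y \<omega>)) = \<nu>"
  proof (rule measure_eqI_generator_eq[OF Int_stable_pair_measure_generator, where A="\<lambda>_. space MX \<times> space MY"])
    show "{a \<times> b |a b. a \<in> sets MX \<and> b \<in> sets MY} \<subseteq> Pow (space MX \<times> space MY)"
      by (rule pair_measure_closed)
    show "sets (distr \<Omega> (MX \<Otimes>\<^sub>M MY) (\<lambda>\<omega>. (X \<omega>, Y \<omega>))) = sigma_sets (space MX \<times> space MY) {a \<times> b |a b. a \<in> sets MX \<and> b \<in> sets MY}"
      by (simp add: sets_pair_measure)
    have "sets \<nu> = sets (MX \<Otimes>\<^sub>M MY)"
      unfolding \<nu>_def by (rule sets_bind[OF _ ne]) (simp add: \<kappa>_def)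
    then show "sets \<nu> = sigma_sets (space MX \<times> space MY) {a \<times> b |a b. a \<in> sets MX \<and> b \<in> sets MY}"
      by (simp add: sets_pair_measure)
    fix C assume "C \<in> {a \<times> b |a b. a \<in> sets MX \<and> b \<in> sets MY}"
    then obtain A B where C: "C = A \<times> B" and AB [measurable]: "A \<in> sets MX" "B \<in> sets MY" by auto
    have Cs: "C \<in> sets (MX \<Otimes>\<^sub>M MY)" unfolding C by measurable
    have "emeasure (distr \<Omega> (MX \<Otimes>\<^sub>M MY) (\<lambda>\<omega>. (X \<omega>, Y \<omega>))) C = ennreal (measure \<Omega> {\<omega> \<in> space \<Omega>. X \<omega> \<in> A \<and> Y \<omega> \<in> B})"
      using Cs by (simp add: emeasure_distr emeasure_eq_measure C vimage_def Int_def conj_commute)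
    also have "\<dots> = ennreal (\<integral>\<omega>. measure (P (X \<omega>)) (Pair (X \<omega>) -` C) \<partial>\<Omega>)"
      unfolding rect[OF AB] C by (intro arg_cong[where f=ennreal] Bochner_Integration.integral_cong refl) (auto simp: indicator_def)
    also have "\<dots> = emeasure \<nu> C" by (rule em\<nu>'[OF Cs, symmetric])
    finally show "emeasure (distr \<Omega> (MX \<Otimes>\<^sub>M MY) (\<lambda>\<omega>. (X \<omega>, Y \<omega>))) C = emeasure \<nu> C" .
  qed (auto simp: emeasure_distr emeasure_eq_measure)
  then have "emeasure (distr \<Omega> (MX \<Otimes>\<^sub>M MY) (\<lambda>\<omega>. (X \<omega>, Y \<omega>))) S = ennreal (\<integral>\<omega>. measure (P (X \<omega>)) (Pair (X \<omega>) -` S) \<partial>\<Omega>)"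
    using em\<nu>'[OF S] by simp
  moreover have "emeasure (distr \<Omega> (MX \<Otimes>\<^sub>M MY) (\<lambda>\<omega>. (X \<omega>, Y \<omega>))) S = ennreal (measure \<Omega> {\<omega> \<in> space \<Omega>. (X \<omega>, Y \<omega>) \<in> S})"
    using S by (simp add: emeasure_distr emeasure_eq_measure vimage_def Int_def conj_commute)
  ultimately show ?thesis by (simp add: Bochner_Integration.integral_nonneg)
qed

theorem theorem3p3:
  fixes \<Omega> :: "'w measure"
    and W M :: "'w \<Rightarrow> real^('d::{finite,linorder})^('d::_)"
    and U :: "'w \<Rightarrow> real^'r^('d::_)"
    and lam g \<delta> :: real
    and N r' :: nat
    and alg :: "nat \<Rightarrow> 'd history \<Rightarrow> real^('d::_)"
    and P :: "real^'r^('d::_) \<Rightarrow> 'd history measure"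
  assumes "prob_space \<Omega>"
    and "lam > 1"
    and "g = (lam - 1)\<^sup>2 / (lam\<^sup>2 + 1)"
    and "is_GOE \<Omega> W"
    and "uniform_Stiefel (distr \<Omega> borel U)"
    and "indep_rv \<Omega> borel W borel U"
    and "\<And>\<omega>. M \<omega> = W \<omega> + lam *\<^sub>R (U \<omega> ** transpose (U \<omega>))"
    and "query_algorithm N alg"
    and "conditional_law \<Omega> borel U (history_space N) (\<lambda>\<omega>. run alg (M \<omega>) N) P"
    and "real CARD('d) \<ge> g powr (-1/2)"
    and "0 < \<delta>" "\<delta> < 1"
    and "r' \<in> {1..CARD('r)}"
  shows "prob_space.expectation \<Omega> (\<lambda>\<omega>.
           measure (P (U \<omega>)) {h \<in> space (history_space N). \<forall>k\<in>{1..N}.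
             nth_eigenvalue r' (transpose (U \<omega>) ** VVT h k ** U \<omega>) \<le>
               26 * real CARD('r) * lam powr (9 * real k / real r') *
                 ln (20 * (real CARD('d))\<^sup>2) * ln (exp 1 / \<delta>) / (real CARD('d) * g\<^sup>2)})
         \<ge> 1 - \<delta>"
proof -
  interpret prob_space \<Omega> by fact
  interpret querying N alg by standard fact
  note gdef = assms(3) and lam = assms(2)
  let ?d = "real CARD('d)" and ?r = "real CARD('r)"
  define \<mu> where "\<mu> = distr \<Omega> borel U"
  have \<mu>: "uniform_Stiefel \<mu>" using assms(5) by (simp add: \<mu>_def)
  have W [measurable]: "W \<in> borel_measurable \<Omega>" and U [measurable]: "U \<in> borel_measurable \<Omega>"
    using assms(6) by (auto simp: indep_rv_def)
  have M: "M \<omega> = spiked lam (U \<omega>) (W \<omega>)" for \<omega> by (simp add: assms(7) spiked_def)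
  have Mm: "M \<in> borel_measurable \<Omega>" unfolding M by measurable
  define R where "R k = 26 * ?r * lam powr (9 * real k / real r') * ln (20 * ?d\<^sup>2) * ln (exp 1 / \<delta>) / (?d * g\<^sup>2)" for k
  have Y: "(\<lambda>\<omega>. run alg (M \<omega>) N) \<in> \<Omega> \<rightarrow>\<^sub>M history_space N"
    by (rule measurable_compose[OF Mm measurable_run[OF alg_measurable order_refl]])
  \<comment> \<open>The event as a set of pairs of a frame and a history; its section at
    \<open>U \<omega>\<close> is the event in the statement.\<close>
  define S :: "(((real, 'r) vec, 'd) vec \<times> 'd history) set" where "S = {x \<in> space (borel \<Otimes>\<^sub>M history_space N). \<forall>k\<in>{1..N}. nth_eigenvalue r' (gram (fst x) (snd x) k) \<le> R k}"
  have S: "S \<in> sets (borel \<Otimes>\<^sub>M history_space N)"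
  proof -
    have "(\<lambda>x :: ((real, 'r) vec, 'd) vec \<times> 'd history. nth_eigenvalue r' (gram (fst x) (snd x) k)) \<in> borel_measurable (borel \<Otimes>\<^sub>M history_space N)"
      if "k \<in> {1..N}" for k
    proof (rule borel_measurable_nth_eigenvalue)
      show "transpose (gram (fst x) (snd x) k) = gram (fst x) (snd x) k"
        for x :: "((real, 'r) vec, 'd) vec \<times> 'd history" by (rule transpose_gram)
      show "r' \<in> {1..CARD('r)}" by fact
      have [measurable]: "(\<lambda>x :: ((real, 'r) vec, 'd) vec \<times> 'd history. VVT (snd x) k) \<in> borel_measurable (borel \<Otimes>\<^sub>M history_space N)"
        using that by (intro measurable_VVT[where n=N]) auto
      show "(\<lambda>x :: ((real, 'r) vec, 'd) vec \<times> 'd history. gram (fst x) (snd x) k) \<in> borel_measurable (borel \<Otimes>\<^sub>M history_space N)"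
        unfolding gram_def by measurable
    qed
    note [measurable] = this
    show ?thesis unfolding S_def by measurable
  qed
  have sec: "Pair (U \<omega>) -` S = {h \<in> space (history_space N). \<forall>k\<in>{1..N}.
             nth_eigenvalue r' (transpose (U \<omega>) ** VVT h k ** U \<omega>) \<le> R k}" for \<omega>
    by (auto simp: S_def gram_def space_pair_measure)
  have good: "measure \<Omega> {\<omega> \<in> space \<Omega>. (U \<omega>, run alg (M \<omega>) N) \<in> S} \<ge> 1 - \<delta>"
  proof -
    have St: "AE \<omega> in \<Omega>. U \<omega> \<in> Stiefel"
    proof -
      have "AE V in \<mu>. V \<in> Stiefel" using \<mu> by (simp add: uniform_Stiefel_def)
      then show ?thesis unfolding \<mu>_def by (rule AE_distrD[OF U])
    qed
    have Ws: "AE \<omega> in \<Omega>. transpose (W \<omega>) = W \<omega>" using assms(4) by (simp add: is_GOE_def)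
    have Msym: "transpose (M \<omega>) = M \<omega>" if "transpose (W \<omega>) = W \<omega>" for \<omega>
    proof -
      have "transpose (A + lam *\<^sub>R (B ** transpose B)) = transpose A + lam *\<^sub>R (B ** transpose B)"
        for A :: "((real, 'd) vec, 'd) vec" and B :: "((real, 'r) vec, 'd) vec"
        by (simp add: transpose_def vec_eq_iff matrix_matrix_mult_def mult.commute)
      then show ?thesis using that by (simp add: assms(7))
    qed
    have run_space: "run alg (M \<omega>) N \<in> space (history_space N)" if "\<omega> \<in> space \<Omega>" for \<omega>
      using measurable_space[OF Y that] .
    show ?thesis
    \<comment> \<open>If every threshold is at least 1, the event is almost sure. Otherwise a single
      threshold below 1 already forces \<open>d\<close> to be large compared with
      \<open>r\<close>.\<close>
    proof (cases "\<forall>k. 1 \<le> R k")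
      case True
      have "AE \<omega> in \<Omega>. (U \<omega>, run alg (M \<omega>) N) \<in> S"
        using St Ws AE_space
      proof eventually_elim
        case (elim \<omega>)
        have "nth_eigenvalue r' (gram (U \<omega>) (run alg (M \<omega>) N) k) \<le> R k" if "k \<in> {1..N}" for k
          using nth_eigenvalue_gram_le_one[OF elim(1) Msym[OF elim(2)] _ assms(13), of k] that True[rule_format, of k] by auto
        then show ?case using run_space[OF elim(3)] by (simp add: S_def space_pair_measure)
      qed
      then have "measure \<Omega> {\<omega> \<in> space \<Omega>. (U \<omega>, run alg (M \<omega>) N) \<in> S} = 1"
        by (intro prob_Collect_eq_1[THEN iffD2]) (use measurable_sets[OF measurable_Pair[OF U Y] S] in \<open>auto simp: vimage_def Int_def conj_commute\<close>)
      then show ?thesis using assms(11) by simp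
    next
      case False
      then obtain k0 where k0: "R k0 < 1" by (auto simp: not_le)
      have d1: "?d \<ge> 1" using one_le_card_finite[where 'a='d] by linarith
      have r1: "?r \<ge> 1" using one_le_card_finite[where 'a='r] by linarith
      have g0: "g > 0" unfolding gdef using lam by (intro divide_pos_pos) (auto intro: add_nonneg_pos)
      \<comment> \<open>All factors of \<open>R k0\<close> other than
        \<open>r / (d * g\<^sup>2)\<close> are at least 1.\<close>
      have rd: "?r / ?d \<le> g\<^sup>2"
      proof -
        have "?d * g\<^sup>2 > 0" using d1 g0 by simp
        have p: "lam powr (9 * real k0 / real r') \<ge> 1" using lam by (intro ge_one_powr_ge_zero) auto
        have "exp 1 \<le> 20 * ?d\<^sup>2" using exp_le one_le_power[OF d1, of 2] by linarith
        moreover have "0 < 20 * ?d\<^sup>2" using d1 by simp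
        ultimately have T: "ln (20 * ?d\<^sup>2) \<ge> 1" by (simp add: ln_ge_iff)
        have D: "ln (exp 1 / \<delta>) \<ge> 1" using assms(11,12) by (simp add: ln_div)
        have gen: "x \<le> 26 * x * p * t * e" if "1 \<le> x" "1 \<le> p" "1 \<le> t" "1 \<le> e" for x p t e :: real
        proof -
          have "x * 1 * 1 * 1 \<le> (26 * x) * p * t * e" using that by (intro mult_mono mult_nonneg_nonneg) auto
          then show ?thesis by simp
        qed
        have "?r \<le> 26 * ?r * lam powr (9 * real k0 / real r') * ln (20 * ?d\<^sup>2) * ln (exp 1 / \<delta>)"
          by (rule gen[OF r1 p T D])
        also have "\<dots> < ?d * g\<^sup>2" using k0 \<open>?d * g\<^sup>2 > 0\<close> by (simp add: R_def)
        finally show ?thesis using d1 by (simp add: divide_le_eq mult.commute)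
      qed
      have gl: "g\<^sup>2 \<le> 1 - 1 / lam"
      proof -
        have pos: "lam\<^sup>2 + 1 > 0" by (rule add_nonneg_pos) auto
        have "(lam - 1)\<^sup>2 \<le> lam\<^sup>2 + 1" using lam by (simp add: power2_eq_square algebra_simps)
        then have "g \<le> 1" unfolding gdef using pos by simp
        then have "g\<^sup>2 \<le> g" using g0 by (simp add: power2_eq_square mult_left_le)
        also have "(lam - 1) * lam \<le> lam\<^sup>2 + 1" using lam by (simp add: power2_eq_square algebra_simps)
        then have "(lam - 1) * ((lam - 1) * lam) \<le> (lam - 1) * (lam\<^sup>2 + 1)" using lam by (intro mult_left_mono) auto
        then have "g \<le> (lam - 1) / lam"
          unfolding gdef using pos lam by (intro mult_imp_div_pos_le pos) (simp add: field_simps power2_eq_square)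
        finally show ?thesis using lam by (simp add: diff_divide_distrib)
      qed
      \<comment> \<open>This yields \<open>r \<le> d\<close> as well as
        \<open>d \<le> lam * m\<close>, the two dimension conditions of the probabilistic
        estimate.\<close>
      have rd': "?r \<le> ?d * (1 - 1 / lam)"
      proof -
        have "?r / ?d \<le> 1 - 1 / lam" using rd gl by linarith
        then show ?thesis using d1 by (simp add: divide_le_eq mult.commute)
      qed
      also have "\<dots> \<le> ?d" using lam d1 by (simp add: mult_left_le)
      finally have rdn: "CARD('r) \<le> CARD('d)" by simp
      define m where "m = real (CARD('d) + 1 - CARD('r))"
      have m: "m = ?d + 1 - ?r" using rdn by (simp add: m_def of_nat_diff)
      have "?d * (1 / lam) \<le> m" using rd' unfolding m by (simp add: right_diff_distrib)
      then have dm: "?d \<le> lam * m" using lam by (simp add: divide_le_eq mult.commute)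
      define L where "L = ?r * ln (3 * ?d\<^sup>2) + ln ?d + ln (1 / \<delta>)"
      define \<alpha> where "\<alpha> = (lam - 1) * m / (2 * lam\<^sup>2)"
      have L0: "L \<ge> 0"
      proof -
        have "3 * ?d\<^sup>2 \<ge> 1" using one_le_power[OF d1, of 2] by linarith
        then show ?thesis unfolding L_def using d1 r1 assms(11,12)
          by (intro add_nonneg_nonneg mult_nonneg_nonneg ln_ge_zero) auto
      qed
      have \<alpha>: "\<alpha> > 0" unfolding \<alpha>_def m_def using lam rdn by simp
      define Bad where "Bad x \<longleftrightarrow> (\<exists>k<N. \<exists>a\<in>cube_grid (CARD('d)\<^sup>2).
        lam ^ 5 * overlap (fst x *v a) (spiked lam (fst x) (snd x)) k + (real (Suc k) / (2 * lam) + L) / \<alpha> * (a \<bullet> a)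
        < overlap (fst x *v a) (spiked lam (fst x) (snd x)) (Suc k))" for x :: "((real, 'r) vec, 'd) vec \<times> ((real, 'd) vec, 'd) vec"
      have Badm: "Measurable.pred (borel \<Otimes>\<^sub>M borel) Bad"
      proof -
        have om: "(\<lambda>x. overlap (fst x *v a) (spiked lam (fst x) (snd x)) k) \<in> borel_measurable (borel \<Otimes>\<^sub>M borel)"
          if "k \<le> N" for a :: "(real, 'r) vec" and k
          using that by (intro measurable_overlap) (auto, measurable)
        have "Measurable.pred (borel \<Otimes>\<^sub>M borel) (\<lambda>x :: ((real, 'r) vec, 'd) vec \<times> ((real, 'd) vec, 'd) vec. \<exists>k\<in>{..<N}. \<exists>a\<in>cube_grid (CARD('d)\<^sup>2).
          lam ^ 5 * overlap (fst x *v a) (spiked lam (fst x) (snd x)) k + (real (Suc k) / (2 * lam) + L) / \<alpha> * (a \<bullet> a)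
          < overlap (fst x *v a) (spiked lam (fst x) (snd x)) (Suc k))"
          by (intro pred_intros_finite borel_measurable_pred_less borel_measurable_add borel_measurable_times borel_measurable_const om) auto
        then show ?thesis unfolding Bad_def lessThan_iff[symmetric] Bex_def .
      qed
      have "(\<integral>\<^sup>+\<omega>. of_bool (Bad (U \<omega>, W \<omega>)) \<partial>\<Omega>) = (\<integral>\<^sup>+V. (\<integral>\<^sup>+G. of_bool (Bad (V, sym_part G)) \<partial>std_gauss) \<partial>\<mu>)"
        unfolding \<mu>_def by (rule nn_integral_indep_GOE[OF assms(1,4,6), of "\<lambda>x. of_bool (Bad x)"]) (use Badm in \<open>simp add: of_bool_def\<close>)
      also have "\<dots> \<le> ennreal \<delta>"
        unfolding Bad_def fst_conv snd_conv L_def \<alpha>_def m_def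
        by (rule overlap_growth_whp[OF \<mu> lam rdn dm[unfolded m_def] assms(11)])
      finally have Bad\<delta>: "(\<integral>\<^sup>+\<omega>. of_bool (Bad (U \<omega>, W \<omega>)) \<partial>\<Omega>) \<le> ennreal \<delta>" .
      let ?A = "{\<omega> \<in> space \<Omega>. (U \<omega>, run alg (M \<omega>) N) \<in> S}"
      have Am: "?A \<in> sets \<Omega>"
        using measurable_sets[OF measurable_Pair[OF U Y] S] by (auto simp: vimage_def Int_def conj_commute)
      have "AE \<omega> in \<Omega>. indicator (space \<Omega> - ?A) \<omega> \<le> (of_bool (Bad (U \<omega>, W \<omega>)) :: ennreal)"
        using St Ws AE_space
      proof eventually_elim
        case (elim \<omega>)
        show ?case
        proof (cases "Bad (U \<omega>, W \<omega>)")
          case False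
          have "nth_eigenvalue r' (gram (U \<omega>) (run alg (M \<omega>) N) K) \<le> R K" if K: "K \<in> {1..N}" for K
          proof -
            let ?c = "(real K / (2 * lam) + L) / \<alpha>"
            have c0: "?c \<ge> 0" using lam L0 \<alpha> by simp
            have \<rho>1: "lam ^ 5 > 1" using lam by (simp add: one_less_power)
            have "nth_eigenvalue r' (gram (U \<omega>) (run alg (M \<omega>) N) K)
              \<le> ((lam ^ 5) ^ K) powr (1 / r') * ((?c + 2 * (?r / real (CARD('d)\<^sup>2)) * (1 + lam ^ 5)) / (lam ^ 5 - 1))"
            proof (rule nth_eigenvalue_gram_le[OF elim(1) Msym[OF elim(2)] _ assms(13) \<rho>1 c0])
              fix k and a :: "(real, 'r) vec" assume k: "k < K" and a: "a \<in> cube_grid (CARD('d)\<^sup>2)"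
              have "overlap (U \<omega> *v a) (M \<omega>) (Suc k) \<le> lam ^ 5 * overlap (U \<omega> *v a) (M \<omega>) k
                + (real (Suc k) / (2 * lam) + L) / \<alpha> * (a \<bullet> a)"
              proof -
                have "k < N" using k K by simp
                then show ?thesis
                  using False a unfolding Bad_def M fst_conv snd_conv not_less[symmetric] by blast
              qed
              \<comment> \<open>The additive error of each round before \<open>K\<close> is at most
                its value at \<open>K\<close>. The eigenvalue bound is thus applied anew for every
                \<open>K\<close>, with its own constant.\<close>
              also have "(real (Suc k) / (2 * lam) + L) / \<alpha> * (a \<bullet> a) \<le> ?c * (a \<bullet> a)"
                using k lam \<alpha> by (intro mult_right_mono divide_right_mono add_right_mono) auto
              finally show "overlap (U \<omega> *v a) (M \<omega>) (Suc k) \<le> lam ^ 5 * overlap (U \<omega> *v a) (M \<omega>) k + ?c * (a \<bullet> a)"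
                by simp
            qed (use K in auto)
            \<comment> \<open>The mesh \<open>1 / d\<^sup>2\<close> makes the grid error
              \<open>r / d\<^sup>2\<close> at most \<open>1 / d\<close>, the same order as the
              additive error.\<close>
            also have "\<dots> \<le> ((lam ^ 5) ^ K) powr (1 / r') * ((?c + 2 * (1 / ?d) * (1 + lam ^ 5)) / (lam ^ 5 - 1))"
            proof -
              have "?r / real (CARD('d)\<^sup>2) \<le> ?d / real (CARD('d)\<^sup>2)" using rdn by (intro divide_right_mono) auto
              also have "\<dots> = 1 / ?d" by (simp add: power2_eq_square)
              finally have "2 * (?r / real (CARD('d)\<^sup>2)) * (1 + lam ^ 5) \<le> 2 * (1 / ?d) * (1 + lam ^ 5)"
                using lam by (intro mult_right_mono mult_left_mono) auto
              then show ?thesis using \<rho>1 by (intro mult_left_mono divide_right_mono add_left_mono) auto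
            qed
            also have "\<dots> \<le> R K"
              unfolding R_def L_def
              by (rule threshold_bound[OF lam gdef d1 r1 _ _ _ dm assms(11,12) \<alpha>_def]) (use assms(13) rdn in \<open>auto simp: m_def\<close>)
            finally show ?thesis .
          qed
          then show ?thesis using run_space[OF elim(3)] elim(3) by (simp add: S_def space_pair_measure)
        qed (simp add: indicator_def)
      qed
      then have "(\<integral>\<^sup>+\<omega>. indicator (space \<Omega> - ?A) \<omega> \<partial>\<Omega>) \<le> (\<integral>\<^sup>+\<omega>. of_bool (Bad (U \<omega>, W \<omega>)) \<partial>\<Omega>)"
        by (rule nn_integral_mono_AE)
      also note Bad\<delta>
      finally have "emeasure \<Omega> (space \<Omega> - ?A) \<le> ennreal \<delta>" using Am by simp
      then have "prob (space \<Omega> - ?A) \<le> \<delta>" using assms(11) by (simp add: emeasure_eq_measure)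
      then show ?thesis using prob_compl[OF Am] by simp
    qed
  qed
  have "expectation (\<lambda>\<omega>. measure (P (U \<omega>)) (Pair (U \<omega>) -` S)) = measure \<Omega> {\<omega> \<in> space \<Omega>. (U \<omega>, run alg (M \<omega>) N) \<in> S}"
    by (rule conditional_law_expectation[OF assms(1) U Y assms(9) S])
  with good show ?thesis unfolding sec R_def by simp
qed

end
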